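(* Let the ELISE filter (defined in the context) be uniformly asymptotically stable. Then its input estimate bias decays exponentially, i.e. there exist $\alpha_1$ and $\gamma$ such that $$\|\mathbb E[\tilde d]\|:=\|\mathbb E[d-\hat d]\|\le\alpha_1e^{-\gamma(t-t_0)},$$ where, assuming $\breve A:=\overline A-LC_2$ is bounded, $\gamma=\dfrac1{2\overline\lambda_{max}(S)}$, and $\alpha_1$ is the positive constant $$\alpha_1=\beta\,\sup\big(\|V_1M_1C_1\|+\|V_2M_2(\overline C_2\hat A+\overline T_2\overline{\overline C})\|\big),\qquad \beta=\sqrt{\frac{\mathbb E[\tilde x(t_0)]^\top S(t_0)\,\mathbb E[\tilde x(t_0)]}{\underline\lambda_{min}(S)}},$$ the supremum being over $t\ge t_0$, $\tilde x:=x-\hat x$, $S(t)=\lim_{T\to\infty}\int_t^T\Phi_{\breve A}(s,t)^\top\Phi_{\breve A}(s,t)\,ds\succ0$, $\Phi_{\breve A}$ the state transition matrix of $\dot x=\breve Ax$, and $\overline\lambda_{max}(S)$, $\underline\lambda_{min}(S)$ the supremum and infimum over $t\ge t_0$ of the largest and smallest eigenvalue of $S(t)$.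
   Context: **System.** All matrices and signals depend on time $t\ge t_0$ (argument omitted). $\dot x=Ax+Bu+Gd+Ww$, $y=Cx+Du+Hd+v$, with state $x\in\mathbb R^n$, known input $u\in\mathbb R^m$, unknown input $d\in\mathbb R^p$, output $y\in\mathbb R^l$, noises $w\in\mathbb R^q$, $v\in\mathbb R^l$; $A,B,G,C,D,W$ smooth, bounded, known; $H$ analytic, known, of constant rank $p_H$; $n\ge l\ge1$, $l\ge p\ge0$, $m\ge0$. $x(t_0)$ is independent of $v,w$, and an initial estimate $\hat x_0$ with covariance $\mathcal P_0^x$ is given. **Decoupling.** $H=[U_1\ U_2]\begin{bmatrix}\Sigma&0\\0&0\end{bmatrix}[V_1\ V_2]^\top$ is a singular value decomposition with $\Sigma\in\mathbb R^{p_H\times p_H}$ diagonal of full rank, $[U_1\ U_2]$, $[V_1\ V_2]$ unitary. $d_i=V_i^\top d$, $G_i=GV_i$; $T_1=U_1^\top-U_1^\top RU_2(U_2^\top RU_2)^{-1}U_2^\top$, $T_2=U_2^\top$; $z_i=T_iy$, $C_i=T_iC$, $D_i=T_iD$, $v_i=T_iv$, $R_i=T_iRT_i^\top$ ($i=1,2$). **Assumption (A1).** $w,v$ are mutually uncorrelated zero-mean white noises, $\mathbb E[w(t)w(t')^\top]=Q\delta(t-t')$, $\mathbb E[v(t)v(t')^\top]=R\delta(t-t')$, $\mathbb E[w(t)v(t')^\top]=0$, $Q\succeq0$, $R\succ0$. An additional measurement $\overline y=\overline C\dot x+\overline{\overline C}x+\overline D\dot u+\overline{\overline D}u+\overline H\dot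 d+\overline{\overline H}d+\overline v$ is available, with $\mathbb E[\overline v]=0$, $\mathbb E[w(t)\overline v(t')^\top]=0$, $\mathbb E[v(t)\overline v(t')^\top]=\grave R\delta(t-t')$, $\mathbb E[\overline v(t)\overline v(t')^\top]=\overline R\delta(t-t')$, $\overline R\succ0$, $\grave R$ known. With singular value decomposition $\overline H=[\overline U_1\ \overline U_2]\begin{bmatrix}\overline\Sigma&0\\0&0\end{bmatrix}[\overline V_1\ \overline V_2]^\top$ put $\overline T_2=\overline U_2^\top$ (so $\overline T_2\overline H=0$); also $\overline T_2\overline{\overline H}=0$ is assumed. $\overline z_2=\overline T_2\overline y$, $\overline C_2=\overline T_2\overline C$, $\overline D_2=\overline T_2\overline D$, $\overline v_2=\overline T_2\overline v$, $\overline R_2=\overline T_2\overline R\,\overline T_2^\top$, $\grave R_2=T_2\grave R\,\overline T_2^\top$, $\grave R_{12}=T_1\grave R\,\overline T_2^\top$. It is assumed ${\rm rk}(\overline C_2G_2)=p-p_H$. **ELISE filter.** $\hat d_1=M_1(z_1-C_1\hat x-D_1u)$, $\hat d_2=M_2(\overline z_2-(\overline C_2A+\overline T_2\overline{\overline C})\hat x-\overline C_2Bu-\overline C_2G_1\hat d_1-\overline D_2\dot u-\overline T_2\overline{\overline D}u)$, $\hat d=V_1\hat d_1+V_2\hat d_2$, $\dot{\hat x}=A\hat x+Bu+G_1\hat d_1+G_2\hat d_2+L(z_2-C_2\hat x-D_2u)$, $\hat x(t_0)=\hat x_0$, with $M_1=\Sigma^{-1}$, $\hat A=A-G_1M_1C_1$,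 $\hat Q=WQW^\top+G_1M_1R_1M_1^\top G_1^\top$, $\tilde R_2=(\overline C_2\hat A+\overline T_2\overline{\overline C})P^x(\overline C_2\hat A+\overline T_2\overline{\overline C})^\top+\overline C_2\hat Q\overline C_2^\top+\overline R_2-\grave R_{12}^\top M_1^\top G_1^\top\overline C_2^\top-\overline C_2G_1M_1\grave R_{12}$, $M_2=(G_2^\top\overline C_2^\top\tilde R_2^{-1}\overline C_2G_2)^{-1}G_2^\top\overline C_2^\top\tilde R_2^{-1}$, $\overline A=(I-G_2M_2\overline C_2)\hat A-G_2M_2\overline T_2\overline{\overline C}$, $\overline Q=(I-G_2M_2\overline C_2)\hat Q(I-G_2M_2\overline C_2)^\top+G_2M_2\overline R_2M_2^\top G_2^\top$, $L=(P^xC_2^\top-G_2M_2\grave R_2^\top)R_2^{-1}$, $\dot P^x=\overline AP^x+P^x\overline A^\top+\overline Q-LR_2L^\top$, $P^x(t_0)=\mathcal P_0^x$. **Stability.** The filter is called uniformly asymptotically stable if the linear system $\dot\xi=(\overline A-LC_2)\xi$ is uniformly asymptotically stable.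
   Formalization: The supremum in α1 is assumed finite (for H=exp(−t²), G=0 it is infinite and the bias need not decay); α1 is shown nonnegative, as it vanishes if E[x̃(t0)]=0; noise covariances, the matrices of ȳ and the SVD factors are taken continuous in t. *)

theory Defs
  imports
    "HOL-Probability.Probability"
    "HOL-Library.Function_Algebras"
    "Jordan_Normal_Form.Gauss_Jordan_Elimination"
    "Jordan_Normal_Form.Char_Poly"
    "Jordan_Normal_Form.DL_Rank"
begin

unbundle no vec_syntax
unbundle no inner_syntax

text \<open>
  Vectors and matrices carry their dimensions explicitly, because the blocks of the decoupled
  system (e.g. the columns of \<^term>\<open>U\<^sub>1\<close> or \<^term>\<open>V\<^sub>2\<close>), the unknown input and the known input
  may have dimension 0. Time-dependent objects are functions of \<^term>\<open>t :: real\<close> that are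
  only constrained on \<^term>\<open>{t0..}\<close>.
\<close>

definition vnorm :: "real vec \<Rightarrow> real" where
  "vnorm v = sqrt (scalar_prod v v)"

definition mnorm :: "real mat \<Rightarrow> real" where
  "mnorm A = (SUP v \<in> {v \<in> carrier_vec (dim_col A). vnorm v \<le> 1}. vnorm (A *\<^sub>v v))"

text \<open>Only meaningful for \<^term>\<open>invertible_mat A\<close>.\<close>
definition minv :: "real mat \<Rightarrow> real mat" where
  "minv A = the (mat_inverse A)"

definition hcat :: "real mat \<Rightarrow> real mat \<Rightarrow> real mat" where
  "hcat A B = four_block_mat A B (0\<^sub>m 0 (dim_col A)) (0\<^sub>m 0 (dim_col B))"

definition unitary :: "nat \<Rightarrow> real mat \<Rightarrow> bool" where
  "unitary k U \<longleftrightarrow> U \<in> carrier_mat k k \<and> U\<^sup>T * U = 1\<^sub>m k \<and> U * U\<^sup>T = 1\<^sub>m k"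

definition pos_semidef :: "nat \<Rightarrow> real mat \<Rightarrow> bool" where
  "pos_semidef k K \<longleftrightarrow> K \<in> carrier_mat k k \<and> K\<^sup>T = K \<and>
     (\<forall>a \<in> carrier_vec k. 0 \<le> scalar_prod a (K *\<^sub>v a))"

definition pos_def :: "nat \<Rightarrow> real mat \<Rightarrow> bool" where
  "pos_def k K \<longleftrightarrow> K \<in> carrier_mat k k \<and> K\<^sup>T = K \<and>
     (\<forall>a \<in> carrier_vec k. a \<noteq> 0\<^sub>v k \<longrightarrow> 0 < scalar_prod a (K *\<^sub>v a))"

text \<open>Singular value decomposition of a \<open>k \<times> m\<close> matrix of rank \<open>r\<close>. The singular values need
  not be sorted: an ordering is in general incompatible with factors that are continuous in time.\<close>
definition is_svd ::
  "nat \<Rightarrow> nat \<Rightarrow> nat \<Rightarrow> real mat \<Rightarrow> real mat \<Rightarrow> real mat \<Rightarrow> real mat \<Rightarrow> real mat \<Rightarrow> real mat \<Rightarrow> bool"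
  where
  "is_svd k m r H U1 U2 Sg V1 V2 \<longleftrightarrow>
     r \<le> k \<and> r \<le> m \<and>
     U1 \<in> carrier_mat k r \<and> U2 \<in> carrier_mat k (k - r) \<and>
     V1 \<in> carrier_mat m r \<and> V2 \<in> carrier_mat m (m - r) \<and>
     Sg \<in> carrier_mat r r \<and>
     unitary k (hcat U1 U2) \<and> unitary m (hcat V1 V2) \<and>
     diagonal_mat Sg \<and> (\<forall>i<r. 0 \<le> Sg $$ (i, i)) \<and> vec_space.rank r Sg = r \<and>
     H = hcat U1 U2 * four_block_mat Sg (0\<^sub>m r (m - r)) (0\<^sub>m (k - r) r) (0\<^sub>m (k - r) (m - r))
           * (hcat V1 V2)\<^sup>T"

definition cont_mat :: "real \<Rightarrow> nat \<Rightarrow> nat \<Rightarrow> (real \<Rightarrow> real mat) \<Rightarrow> bool" where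
  "cont_mat t0 k m F \<longleftrightarrow> (\<forall>t\<ge>t0. F t \<in> carrier_mat k m) \<and>
     (\<forall>i<k. \<forall>j<m. continuous_on {t0..} (\<lambda>t. F t $$ (i, j)))"

definition smooth_fun :: "real \<Rightarrow> (real \<Rightarrow> real) \<Rightarrow> bool" where
  "smooth_fun t0 f \<longleftrightarrow> (\<exists>D :: nat \<Rightarrow> real \<Rightarrow> real. (\<forall>t\<ge>t0. D 0 t = f t) \<and>
     (\<forall>k. \<forall>t\<ge>t0. (D k has_real_derivative D (Suc k) t) (at t within {t0..})))"

definition smooth_mat :: "real \<Rightarrow> nat \<Rightarrow> nat \<Rightarrow> (real \<Rightarrow> real mat) \<Rightarrow> bool" where
  "smooth_mat t0 k m F \<longleftrightarrow> (\<forall>t\<ge>t0. F t \<in> carrier_mat k m) \<and>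
     (\<forall>i<k. \<forall>j<m. smooth_fun t0 (\<lambda>t. F t $$ (i, j)))"

definition real_analytic_fun :: "real \<Rightarrow> (real \<Rightarrow> real) \<Rightarrow> bool" where
  "real_analytic_fun t0 f \<longleftrightarrow> (\<forall>t\<ge>t0. \<exists>r>0. \<exists>a :: nat \<Rightarrow> real.
     \<forall>s\<ge>t0. \<bar>s - t\<bar> < r \<longrightarrow> (\<lambda>k. a k * (s - t) ^ k) sums f s)"

definition analytic_mat :: "real \<Rightarrow> nat \<Rightarrow> nat \<Rightarrow> (real \<Rightarrow> real mat) \<Rightarrow> bool" where
  "analytic_mat t0 k m F \<longleftrightarrow> (\<forall>t\<ge>t0. F t \<in> carrier_mat k m) \<and>
     (\<forall>i<k. \<forall>j<m. real_analytic_fun t0 (\<lambda>t. F t $$ (i, j)))"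

definition bounded_mat :: "real \<Rightarrow> (real \<Rightarrow> real mat) \<Rightarrow> bool" where
  "bounded_mat t0 F \<longleftrightarrow> (\<exists>K. \<forall>t\<ge>t0. mnorm (F t) \<le> K)"

definition mat_has_deriv ::
  "real \<Rightarrow> nat \<Rightarrow> nat \<Rightarrow> (real \<Rightarrow> real mat) \<Rightarrow> (real \<Rightarrow> real mat) \<Rightarrow> bool" where
  "mat_has_deriv t0 k m F F' \<longleftrightarrow> (\<forall>t\<ge>t0. F t \<in> carrier_mat k m) \<and>
     (\<forall>t\<ge>t0. \<forall>i<k. \<forall>j<m.
        ((\<lambda>s. F s $$ (i, j)) has_real_derivative F' t $$ (i, j)) (at t within {t0..}))"

definition lin_solution :: "nat \<Rightarrow> (real \<Rightarrow> real mat) \<Rightarrow> real \<Rightarrow> (real \<Rightarrow> real vec) \<Rightarrow> bool" where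
  "lin_solution n F t1 \<xi> \<longleftrightarrow> (\<forall>t\<ge>t1. \<xi> t \<in> carrier_vec n) \<and>
     (\<forall>t\<ge>t1. \<forall>i<n.
        ((\<lambda>s. \<xi> s $ i) has_real_derivative (F t *\<^sub>v \<xi> t) $ i) (at t within {t1..}))"

definition uniformly_asymptotically_stable :: "real \<Rightarrow> nat \<Rightarrow> (real \<Rightarrow> real mat) \<Rightarrow> bool" where
  "uniformly_asymptotically_stable t0 n F \<longleftrightarrow>
     (\<forall>\<epsilon>>0. \<exists>\<delta>>0. \<forall>t1\<ge>t0. \<forall>\<xi>. lin_solution n F t1 \<xi> \<and> vnorm (\<xi> t1) < \<delta> \<longrightarrow>
        (\<forall>t\<ge>t1. vnorm (\<xi> t) < \<epsilon>)) \<and>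
     (\<exists>c>0. \<forall>\<eta>>0. \<exists>T\<ge>0. \<forall>t1\<ge>t0. \<forall>\<xi>. lin_solution n F t1 \<xi> \<and> vnorm (\<xi> t1) < c \<longrightarrow>
        (\<forall>t\<ge>t1 + T. vnorm (\<xi> t) < \<eta>))"

text \<open>\<open>\<Phi> s t\<close> maps the state at time \<open>t\<close> to the state at time \<open>s\<close>.\<close>
definition is_transition_matrix ::
  "real \<Rightarrow> nat \<Rightarrow> (real \<Rightarrow> real mat) \<Rightarrow> (real \<Rightarrow> real \<Rightarrow> real mat) \<Rightarrow> bool" where
  "is_transition_matrix t0 n F \<Phi> \<longleftrightarrow>
     (\<forall>t\<ge>t0. \<Phi> t t = 1\<^sub>m n \<and> mat_has_deriv t0 n n (\<lambda>s. \<Phi> s t) (\<lambda>s. F s * \<Phi> s t))"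

definition gramian :: "nat \<Rightarrow> (real \<Rightarrow> real \<Rightarrow> real mat) \<Rightarrow> real \<Rightarrow> real \<Rightarrow> real mat" where
  "gramian n \<Phi> t T = mat n n (\<lambda>(i, j). integral {t..T} (\<lambda>s. ((\<Phi> s t)\<^sup>T * \<Phi> s t) $$ (i, j)))"

definition gramian_lim :: "nat \<Rightarrow> (real \<Rightarrow> real \<Rightarrow> real mat) \<Rightarrow> real \<Rightarrow> real mat" where
  "gramian_lim n \<Phi> t = mat n n (\<lambda>(i, j). Lim at_top (\<lambda>T. gramian n \<Phi> t T $$ (i, j)))"

definition lam_max :: "real mat \<Rightarrow> real" where
  "lam_max K = Max {k. eigenvalue K k}"

definition lam_min :: "real mat \<Rightarrow> real" where
  "lam_min K = Min {k. eigenvalue K k}"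

definition lam_sup :: "real \<Rightarrow> (real \<Rightarrow> real mat) \<Rightarrow> real" where
  "lam_sup t0 F = (SUP t\<in>{t0..}. lam_max (F t))"

definition lam_inf :: "real \<Rightarrow> (real \<Rightarrow> real mat) \<Rightarrow> real" where
  "lam_inf t0 F = (INF t\<in>{t0..}. lam_min (F t))"

text \<open>
  White noise has no values at single time instants. A signal \<open>g\<close> containing white noise is
  therefore represented by its action on test functions \<open>f\<close>: the random variable \<open>g f\<close> stands for
  the integral of \<open>f(t)\<^sup>T g(t)\<close> over \<open>t \<ge> t0\<close>. Test functions are bounded, measurable and vanish
  for large \<open>t\<close>; indicator functions of intervals are included, so that integrals of \<open>g\<close> over
  intervals make sense. Sums of signals are pointwise sums of such functionals.
\<close>

type_synonym 'w proc = "real \<Rightarrow> 'w \<Rightarrow> real vec"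
type_synonym 'w signal = "(real \<Rightarrow> real vec) \<Rightarrow> 'w \<Rightarrow> real"

definition test_fun :: "real \<Rightarrow> nat \<Rightarrow> (real \<Rightarrow> real vec) \<Rightarrow> bool" where
  "test_fun t0 k f \<longleftrightarrow> (\<forall>t\<ge>t0. f t \<in> carrier_vec k) \<and>
     (\<forall>i<k. set_borel_measurable lborel {t0..} (\<lambda>t. f t $ i)) \<and>
     (\<exists>b T. \<forall>t\<ge>t0. (\<forall>i<k. \<bar>f t $ i\<bar> \<le> b) \<and> (t > T \<longrightarrow> f t = 0\<^sub>v k))"

text \<open>Jointly measurable processes whose second moments are bounded on bounded time intervals.\<close>
definition second_order_process :: "'w measure \<Rightarrow> real \<Rightarrow> nat \<Rightarrow> 'w proc \<Rightarrow> bool" where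
  "second_order_process M t0 k x \<longleftrightarrow>
     (\<forall>t\<ge>t0. \<forall>\<omega>\<in>space M. x t \<omega> \<in> carrier_vec k) \<and>
     (\<forall>i<k. (\<lambda>(t, \<omega>). x t \<omega> $ i) \<in> borel_measurable (restrict_space borel {t0..} \<Otimes>\<^sub>M M)) \<and>
     (\<forall>T. \<exists>b. \<forall>t\<in>{t0..T}. \<forall>i<k. integrable M (\<lambda>\<omega>. (x t \<omega> $ i)\<^sup>2) \<and>
        (LINT \<omega>|M. (x t \<omega> $ i)\<^sup>2) \<le> b)"

definition proc_has_deriv :: "'w measure \<Rightarrow> real \<Rightarrow> nat \<Rightarrow> 'w proc \<Rightarrow> 'w proc \<Rightarrow> bool" where
  "proc_has_deriv M t0 k x x' \<longleftrightarrow> (\<forall>\<omega>\<in>space M. \<forall>t\<ge>t0. \<forall>i<k.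
     ((\<lambda>s. x s \<omega> $ i) has_real_derivative x' t \<omega> $ i) (at t within {t0..}))"

definition sig :: "real \<Rightarrow> 'w proc \<Rightarrow> 'w signal" where
  "sig t0 x = (\<lambda>f \<omega>. LINT t:{t0..}|lborel. scalar_prod (f t) (x t \<omega>))"

definition sig_mult :: "(real \<Rightarrow> real mat) \<Rightarrow> 'w signal \<Rightarrow> 'w signal" (infixr \<open>\<triangleright>\<close> 75) where
  "F \<triangleright> g = (\<lambda>f. g (\<lambda>t. (F t)\<^sup>T *\<^sub>v f t))"

text \<open>The equation \<open>dx/dt = g\<close> in integrated form: for every \<open>t\<close>, almost surely, \<open>x(t) - x(t0)\<close> is the integral
  of \<open>g\<close> over \<open>[t0, t]\<close>.\<close>
definition solves :: "'w measure \<Rightarrow> real \<Rightarrow> nat \<Rightarrow> 'w proc \<Rightarrow> 'w signal \<Rightarrow> bool" where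
  "solves M t0 k x g \<longleftrightarrow> (\<forall>t\<ge>t0. \<forall>i<k. AE \<omega> in M.
     x t \<omega> $ i = x t0 \<omega> $ i + g (\<lambda>s. if s \<in> {t0..t} then unit_vec k i else 0\<^sub>v k) \<omega>)"

definition expect_vec :: "'w measure \<Rightarrow> nat \<Rightarrow> ('w \<Rightarrow> real vec) \<Rightarrow> real vec" where
  "expect_vec M k X = vec k (\<lambda>i. LINT \<omega>|M. X \<omega> $ i)"

text \<open>\<open>m\<close> is the mean function \<open>t \<mapsto> E[g(t)]\<close>. Continuity makes it unique on \<open>{t0..}\<close>.\<close>
definition has_mean ::
  "'w measure \<Rightarrow> real \<Rightarrow> nat \<Rightarrow> 'w signal \<Rightarrow> (real \<Rightarrow> real vec) \<Rightarrow> bool" where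
  "has_mean M t0 k g m \<longleftrightarrow>
     (\<forall>t\<ge>t0. m t \<in> carrier_vec k) \<and> (\<forall>i<k. continuous_on {t0..} (\<lambda>t. m t $ i)) \<and>
     (\<forall>f. test_fun t0 k f \<longrightarrow> integrable M (g f) \<and>
        (LINT \<omega>|M. g f \<omega>) = (LINT t:{t0..}|lborel. scalar_prod (f t) (m t)))"

definition zero_mean_noise :: "'w measure \<Rightarrow> real \<Rightarrow> nat \<Rightarrow> 'w signal \<Rightarrow> bool" where
  "zero_mean_noise M t0 k N \<longleftrightarrow>
     (\<forall>f. test_fun t0 k f \<longrightarrow> N f \<in> borel_measurable M \<and> integrable M (\<lambda>\<omega>. (N f \<omega>)\<^sup>2) \<and>
        (LINT \<omega>|M. N f \<omega>) = 0) \<and>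
     (\<forall>f g a b. test_fun t0 k f \<longrightarrow> test_fun t0 k g \<longrightarrow>
        (AE \<omega> in M. N (\<lambda>t. a \<cdot>\<^sub>v f t + b \<cdot>\<^sub>v g t) \<omega> = a * N f \<omega> + b * N g \<omega>))"

text \<open>\<open>E[N(t) N'(t')\<^sup>T] = K(t) \<delta>(t - t')\<close>, tested on both sides.\<close>
definition delta_correlated ::
  "'w measure \<Rightarrow> real \<Rightarrow> nat \<Rightarrow> 'w signal \<Rightarrow> nat \<Rightarrow> 'w signal \<Rightarrow> (real \<Rightarrow> real mat) \<Rightarrow> bool" where
  "delta_correlated M t0 k N k' N' K \<longleftrightarrow>
     (\<forall>f g. test_fun t0 k f \<longrightarrow> test_fun t0 k' g \<longrightarrow>
        (LINT \<omega>|M. N f \<omega> * N' g \<omega>) = (LINT t:{t0..}|lborel. scalar_prod (f t) (K t *\<^sub>v g t)))"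

definition sigma_vec :: "'w measure \<Rightarrow> nat \<Rightarrow> ('w \<Rightarrow> real vec) \<Rightarrow> 'w set set" where
  "sigma_vec M k X = sigma_sets (space M)
     {(\<lambda>\<omega>. X \<omega> $ i) -` B \<inter> space M | i B. i < k \<and> B \<in> sets borel}"

definition sigma_noises ::
  "'w measure \<Rightarrow> real \<Rightarrow> nat \<Rightarrow> 'w signal \<Rightarrow> nat \<Rightarrow> 'w signal \<Rightarrow> 'w set set" where
  "sigma_noises M t0 k N k' N' = sigma_sets (space M)
     ({N f -` B \<inter> space M | f B. test_fun t0 k f \<and> B \<in> sets borel} \<union>
      {N' f -` B \<inter> space M | f B. test_fun t0 k' f \<and> B \<in> sets borel})"

text \<open>
  The names ending in \<open>b\<close> belong to the additional measurement \<open>yb\<close> (over-lined letters),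
  \<open>mCbb\<close>, \<open>mDbb\<close>, \<open>mHbb\<close> are the doubly over-lined matrices and \<open>mRg\<close> is R-grave.
  The fields \<open>dn\<close>, \<open>dm\<close>, \<open>dp\<close>, \<open>dl\<close>, \<open>dq\<close>, \<open>dlb\<close> are the dimensions of \<open>x\<close>, \<open>u\<close>, \<open>d\<close>, \<open>y\<close>, \<open>w\<close>, \<open>yb\<close>,
  \<open>pH\<close> and \<open>pHb\<close> are the ranks of \<open>mH\<close> and \<open>mHb\<close>, and \<open>mP\<close> is the solution \<open>P\<^sup>x\<close> of the Riccati equation.
\<close>
record elise_data =
  tini :: real
  dn :: nat
  dm :: nat
  dp :: nat
  dl :: nat
  dq :: nat
  dlb :: nat
  pH :: nat
  pHb :: nat
  mA :: "real \<Rightarrow> real mat"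
  mB :: "real \<Rightarrow> real mat"
  mG :: "real \<Rightarrow> real mat"
  mC :: "real \<Rightarrow> real mat"
  mD :: "real \<Rightarrow> real mat"
  mH :: "real \<Rightarrow> real mat"
  mW :: "real \<Rightarrow> real mat"
  mCb :: "real \<Rightarrow> real mat"
  mCbb :: "real \<Rightarrow> real mat"
  mDb :: "real \<Rightarrow> real mat"
  mDbb :: "real \<Rightarrow> real mat"
  mHb :: "real \<Rightarrow> real mat"
  mHbb :: "real \<Rightarrow> real mat"
  mU1 :: "real \<Rightarrow> real mat"
  mU2 :: "real \<Rightarrow> real mat"
  mSig :: "real \<Rightarrow> real mat"
  mV1 :: "real \<Rightarrow> real mat"
  mV2 :: "real \<Rightarrow> real mat"
  mU1b :: "real \<Rightarrow> real mat"
  mU2b :: "real \<Rightarrow> real mat"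
  mSigb :: "real \<Rightarrow> real mat"
  mV1b :: "real \<Rightarrow> real mat"
  mV2b :: "real \<Rightarrow> real mat"
  mQ :: "real \<Rightarrow> real mat"
  mR :: "real \<Rightarrow> real mat"
  mRg :: "real \<Rightarrow> real mat"
  mRb :: "real \<Rightarrow> real mat"
  mP0 :: "real mat"
  mP :: "real \<Rightarrow> real mat"

definition mT1 :: "elise_data \<Rightarrow> real \<Rightarrow> real mat" where
  "mT1 S t = (mU1 S t)\<^sup>T -
     (mU1 S t)\<^sup>T * mR S t * mU2 S t * minv ((mU2 S t)\<^sup>T * mR S t * mU2 S t) * (mU2 S t)\<^sup>T"

definition mT2 :: "elise_data \<Rightarrow> real \<Rightarrow> real mat" where
  "mT2 S t = (mU2 S t)\<^sup>T"

definition mT2b :: "elise_data \<Rightarrow> real \<Rightarrow> real mat" where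
  "mT2b S t = (mU2b S t)\<^sup>T"

definition mG1 :: "elise_data \<Rightarrow> real \<Rightarrow> real mat" where "mG1 S t = mG S t * mV1 S t"
definition mG2 :: "elise_data \<Rightarrow> real \<Rightarrow> real mat" where "mG2 S t = mG S t * mV2 S t"
definition mC1 :: "elise_data \<Rightarrow> real \<Rightarrow> real mat" where "mC1 S t = mT1 S t * mC S t"
definition mC2 :: "elise_data \<Rightarrow> real \<Rightarrow> real mat" where "mC2 S t = mT2 S t * mC S t"
definition mD1 :: "elise_data \<Rightarrow> real \<Rightarrow> real mat" where "mD1 S t = mT1 S t * mD S t"
definition mD2 :: "elise_data \<Rightarrow> real \<Rightarrow> real mat" where "mD2 S t = mT2 S t * mD S t"

definition mR1 :: "elise_data \<Rightarrow> real \<Rightarrow> real mat" where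
  "mR1 S t = mT1 S t * mR S t * (mT1 S t)\<^sup>T"
definition mR2 :: "elise_data \<Rightarrow> real \<Rightarrow> real mat" where
  "mR2 S t = mT2 S t * mR S t * (mT2 S t)\<^sup>T"

definition mC2b :: "elise_data \<Rightarrow> real \<Rightarrow> real mat" where "mC2b S t = mT2b S t * mCb S t"
definition mD2b :: "elise_data \<Rightarrow> real \<Rightarrow> real mat" where "mD2b S t = mT2b S t * mDb S t"

definition mR2b :: "elise_data \<Rightarrow> real \<Rightarrow> real mat" where
  "mR2b S t = mT2b S t * mRb S t * (mT2b S t)\<^sup>T"
definition mR2g :: "elise_data \<Rightarrow> real \<Rightarrow> real mat" where
  "mR2g S t = mT2 S t * mRg S t * (mT2b S t)\<^sup>T"
definition mR12g :: "elise_data \<Rightarrow> real \<Rightarrow> real mat" where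
  "mR12g S t = mT1 S t * mRg S t * (mT2b S t)\<^sup>T"

definition mM1 :: "elise_data \<Rightarrow> real \<Rightarrow> real mat" where
  "mM1 S t = minv (mSig S t)"

definition mAhat :: "elise_data \<Rightarrow> real \<Rightarrow> real mat" where
  "mAhat S t = mA S t - mG1 S t * mM1 S t * mC1 S t"

definition mQhat :: "elise_data \<Rightarrow> real \<Rightarrow> real mat" where
  "mQhat S t = mW S t * mQ S t * (mW S t)\<^sup>T +
     mG1 S t * mM1 S t * mR1 S t * (mM1 S t)\<^sup>T * (mG1 S t)\<^sup>T"

definition mE :: "elise_data \<Rightarrow> real \<Rightarrow> real mat" where
  "mE S t = mC2b S t * mAhat S t + mT2b S t * mCbb S t"

definition mR2tilde :: "elise_data \<Rightarrow> real \<Rightarrow> real mat" where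
  "mR2tilde S t =
     mE S t * mP S t * (mE S t)\<^sup>T + mC2b S t * mQhat S t * (mC2b S t)\<^sup>T + mR2b S t
     - (mR12g S t)\<^sup>T * (mM1 S t)\<^sup>T * (mG1 S t)\<^sup>T * (mC2b S t)\<^sup>T
     - mC2b S t * mG1 S t * mM1 S t * mR12g S t"

text \<open>The matrix inverted in the definition of \<open>M\<^sub>2\<close>.\<close>
definition mN2 :: "elise_data \<Rightarrow> real \<Rightarrow> real mat" where
  "mN2 S t = (mG2 S t)\<^sup>T * (mC2b S t)\<^sup>T * minv (mR2tilde S t) * mC2b S t * mG2 S t"

definition mM2 :: "elise_data \<Rightarrow> real \<Rightarrow> real mat" where
  "mM2 S t = minv (mN2 S t) * (mG2 S t)\<^sup>T * (mC2b S t)\<^sup>T * minv (mR2tilde S t)"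

definition mAbar :: "elise_data \<Rightarrow> real \<Rightarrow> real mat" where
  "mAbar S t = (1\<^sub>m (dn S) - mG2 S t * mM2 S t * mC2b S t) * mAhat S t
     - mG2 S t * mM2 S t * mT2b S t * mCbb S t"

definition mQbar :: "elise_data \<Rightarrow> real \<Rightarrow> real mat" where
  "mQbar S t =
     (1\<^sub>m (dn S) - mG2 S t * mM2 S t * mC2b S t) * mQhat S t
       * (1\<^sub>m (dn S) - mG2 S t * mM2 S t * mC2b S t)\<^sup>T
     + mG2 S t * mM2 S t * mR2b S t * (mM2 S t)\<^sup>T * (mG2 S t)\<^sup>T"

definition mL :: "elise_data \<Rightarrow> real \<Rightarrow> real mat" where
  "mL S t = (mP S t * (mC2 S t)\<^sup>T - mG2 S t * mM2 S t * (mR2g S t)\<^sup>T) * minv (mR2 S t)"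

definition mAbreve :: "elise_data \<Rightarrow> real \<Rightarrow> real mat" where
  "mAbreve S t = mAbar S t - mL S t * mC2 S t"

definition input_gain :: "elise_data \<Rightarrow> real \<Rightarrow> real" where
  "input_gain S t = mnorm (mV1 S t * mM1 S t * mC1 S t) + mnorm (mV2 S t * mM2 S t * mE S t)"

definition xdot_sig ::
  "elise_data \<Rightarrow> 'w proc \<Rightarrow> 'w proc \<Rightarrow> 'w proc \<Rightarrow> 'w signal \<Rightarrow> 'w signal" where
  "xdot_sig S x u d w =
     mA S \<triangleright> sig (tini S) x + mB S \<triangleright> sig (tini S) u + mG S \<triangleright> sig (tini S) d + mW S \<triangleright> w"

definition y_sig ::
  "elise_data \<Rightarrow> 'w proc \<Rightarrow> 'w proc \<Rightarrow> 'w proc \<Rightarrow> 'w signal \<Rightarrow> 'w signal" where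
  "y_sig S x u d v =
     mC S \<triangleright> sig (tini S) x + mD S \<triangleright> sig (tini S) u + mH S \<triangleright> sig (tini S) d + v"

definition yb_sig ::
  "elise_data \<Rightarrow> 'w proc \<Rightarrow> 'w proc \<Rightarrow> 'w proc \<Rightarrow> 'w proc \<Rightarrow> 'w proc \<Rightarrow>
   'w signal \<Rightarrow> 'w signal \<Rightarrow> 'w signal" where
  "yb_sig S x u u' d d' w vb =
     mCb S \<triangleright> xdot_sig S x u d w + mCbb S \<triangleright> sig (tini S) x
     + mDb S \<triangleright> sig (tini S) u' + mDbb S \<triangleright> sig (tini S) u
     + mHb S \<triangleright> sig (tini S) d' + mHbb S \<triangleright> sig (tini S) d + vb"

definition d1hat_sig ::
  "elise_data \<Rightarrow> 'w proc \<Rightarrow> 'w proc \<Rightarrow> 'w signal \<Rightarrow> 'w signal" where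
  "d1hat_sig S xh u y =
     mM1 S \<triangleright> (mT1 S \<triangleright> y - mC1 S \<triangleright> sig (tini S) xh - mD1 S \<triangleright> sig (tini S) u)"

definition d2hat_sig ::
  "elise_data \<Rightarrow> 'w proc \<Rightarrow> 'w proc \<Rightarrow> 'w proc \<Rightarrow> 'w signal \<Rightarrow> 'w signal \<Rightarrow> 'w signal" where
  "d2hat_sig S xh u u' y yb =
     mM2 S \<triangleright> (mT2b S \<triangleright> yb
       - (\<lambda>t. mC2b S t * mA S t + mT2b S t * mCbb S t) \<triangleright> sig (tini S) xh
       - (\<lambda>t. mC2b S t * mB S t) \<triangleright> sig (tini S) u
       - (\<lambda>t. mC2b S t * mG1 S t) \<triangleright> d1hat_sig S xh u y
       - mD2b S \<triangleright> sig (tini S) u'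
       - (\<lambda>t. mT2b S t * mDbb S t) \<triangleright> sig (tini S) u)"

definition dhat_sig ::
  "elise_data \<Rightarrow> 'w proc \<Rightarrow> 'w proc \<Rightarrow> 'w proc \<Rightarrow> 'w signal \<Rightarrow> 'w signal \<Rightarrow> 'w signal" where
  "dhat_sig S xh u u' y yb =
     mV1 S \<triangleright> d1hat_sig S xh u y + mV2 S \<triangleright> d2hat_sig S xh u u' y yb"

definition xhdot_sig ::
  "elise_data \<Rightarrow> 'w proc \<Rightarrow> 'w proc \<Rightarrow> 'w proc \<Rightarrow> 'w signal \<Rightarrow> 'w signal \<Rightarrow> 'w signal" where
  "xhdot_sig S xh u u' y yb =
     mA S \<triangleright> sig (tini S) xh + mB S \<triangleright> sig (tini S) u
     + mG1 S \<triangleright> d1hat_sig S xh u y + mG2 S \<triangleright> d2hat_sig S xh u u' y yb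
     + mL S \<triangleright> (mT2 S \<triangleright> y - mC2 S \<triangleright> sig (tini S) xh - mD2 S \<triangleright> sig (tini S) u)"

locale elise = prob_space M
  for M :: "'w measure" and S :: elise_data
    and x xh :: "'w proc" and xh0 :: "'w \<Rightarrow> real vec"
    and u u' d d' :: "'w proc"
    and w v vb :: "'w signal" +
  assumes dims: "dn S \<ge> dl S" "dl S \<ge> 1" "dl S \<ge> dp S"
    and smooth:
      "smooth_mat (tini S) (dn S) (dn S) (mA S)"
      "smooth_mat (tini S) (dn S) (dm S) (mB S)"
      "smooth_mat (tini S) (dn S) (dp S) (mG S)"
      "smooth_mat (tini S) (dl S) (dn S) (mC S)"
      "smooth_mat (tini S) (dl S) (dm S) (mD S)"
      "smooth_mat (tini S) (dn S) (dq S) (mW S)"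
    and bounded:
      "bounded_mat (tini S) (mA S)" "bounded_mat (tini S) (mB S)" "bounded_mat (tini S) (mG S)"
      "bounded_mat (tini S) (mC S)" "bounded_mat (tini S) (mD S)" "bounded_mat (tini S) (mW S)"
    and H_analytic: "analytic_mat (tini S) (dl S) (dp S) (mH S)"
    and H_rank: "\<And>t. t \<ge> tini S \<Longrightarrow> vec_space.rank (dl S) (mH S t) = pH S"
    and H_svd: "\<And>t. t \<ge> tini S \<Longrightarrow>
      is_svd (dl S) (dp S) (pH S) (mH S t) (mU1 S t) (mU2 S t) (mSig S t) (mV1 S t) (mV2 S t)"
    \<comment> \<open>such a choice of factors exists since \<open>H\<close> is analytic of constant rank\<close>
    and H_svd_cont:
      "cont_mat (tini S) (dl S) (pH S) (mU1 S)" "cont_mat (tini S) (dl S) (dl S - pH S) (mU2 S)"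
      "cont_mat (tini S) (pH S) (pH S) (mSig S)"
      "cont_mat (tini S) (dp S) (pH S) (mV1 S)" "cont_mat (tini S) (dp S) (dp S - pH S) (mV2 S)"
    and yb_cont:
      "cont_mat (tini S) (dlb S) (dn S) (mCb S)" "cont_mat (tini S) (dlb S) (dn S) (mCbb S)"
      "cont_mat (tini S) (dlb S) (dm S) (mDb S)" "cont_mat (tini S) (dlb S) (dm S) (mDbb S)"
      "cont_mat (tini S) (dlb S) (dp S) (mHb S)" "cont_mat (tini S) (dlb S) (dp S) (mHbb S)"
    and Hb_svd: "\<And>t. t \<ge> tini S \<Longrightarrow>
      is_svd (dlb S) (dp S) (pHb S) (mHb S t) (mU1b S t) (mU2b S t) (mSigb S t) (mV1b S t) (mV2b S t)"
    and Hb_svd_cont: "cont_mat (tini S) (dlb S) (dlb S - pHb S) (mU2b S)"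
    and Hbb: "\<And>t. t \<ge> tini S \<Longrightarrow> mT2b S t * mHbb S t = 0\<^sub>m (dlb S - pHb S) (dp S)"
    and rank_C2bG2: "\<And>t. t \<ge> tini S \<Longrightarrow>
      vec_space.rank (dlb S - pHb S) (mC2b S t * mG2 S t) = dp S - pH S"
    and cov_cont:
      "cont_mat (tini S) (dq S) (dq S) (mQ S)" "cont_mat (tini S) (dl S) (dl S) (mR S)"
      "cont_mat (tini S) (dl S) (dlb S) (mRg S)" "cont_mat (tini S) (dlb S) (dlb S) (mRb S)"
    and cov_def: "\<And>t. t \<ge> tini S \<Longrightarrow> pos_semidef (dq S) (mQ S t)"
      "\<And>t. t \<ge> tini S \<Longrightarrow> pos_def (dl S) (mR S t)"
      "\<And>t. t \<ge> tini S \<Longrightarrow> pos_def (dlb S) (mRb S t)"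
    and noise: "zero_mean_noise M (tini S) (dq S) w" "zero_mean_noise M (tini S) (dl S) v"
      "zero_mean_noise M (tini S) (dlb S) vb"
    and noise_cov:
      "delta_correlated M (tini S) (dq S) w (dq S) w (mQ S)"
      "delta_correlated M (tini S) (dl S) v (dl S) v (mR S)"
      "delta_correlated M (tini S) (dq S) w (dl S) v (\<lambda>t. 0\<^sub>m (dq S) (dl S))"
      "delta_correlated M (tini S) (dq S) w (dlb S) vb (\<lambda>t. 0\<^sub>m (dq S) (dlb S))"
      "delta_correlated M (tini S) (dl S) v (dlb S) vb (mRg S)"
      "delta_correlated M (tini S) (dlb S) vb (dlb S) vb (mRb S)"
    and processes:
      "second_order_process M (tini S) (dn S) x" "second_order_process M (tini S) (dn S) xh"
      "second_order_process M (tini S) (dm S) u" "second_order_process M (tini S) (dm S) u'"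
      "second_order_process M (tini S) (dp S) d" "second_order_process M (tini S) (dp S) d'"
    and input_derivs: "proc_has_deriv M (tini S) (dm S) u u'"
      "proc_has_deriv M (tini S) (dp S) d d'"
    and init_indep: "indep_set (sigma_vec M (dn S) (x (tini S)))
      (sigma_noises M (tini S) (dq S) w (dl S) v)"
    and state_eq: "solves M (tini S) (dn S) x (xdot_sig S x u d w)"
    and P0: "pos_semidef (dn S) (mP0 S)"
    and riccati_init: "mP S (tini S) = mP0 S"
    and riccati: "mat_has_deriv (tini S) (dn S) (dn S) (mP S)
      (\<lambda>t. mAbar S t * mP S t + mP S t * (mAbar S t)\<^sup>T + mQbar S t - mL S t * mR2 S t * (mL S t)\<^sup>T)"
    \<comment> \<open>the filter is well defined: the inverses occurring in \<open>M\<^sub>2\<close> exist\<close>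
    and filter_defined: "\<And>t. t \<ge> tini S \<Longrightarrow> invertible_mat (mR2tilde S t)"
      "\<And>t. t \<ge> tini S \<Longrightarrow> invertible_mat (mN2 S t)"
    and filter_init: "AE \<omega> in M. xh (tini S) \<omega> = xh0 \<omega>"
    and filter_eq: "solves M (tini S) (dn S) xh
      (xhdot_sig S xh u u' (y_sig S x u d v) (yb_sig S x u u' d d' w vb))"

definition elise_uas :: "elise_data \<Rightarrow> bool" where
  "elise_uas S \<longleftrightarrow> uniformly_asymptotically_stable (tini S) (dn S) (mAbreve S)"

definition dtilde_sig ::
  "elise_data \<Rightarrow> 'w proc \<Rightarrow> 'w proc \<Rightarrow> 'w proc \<Rightarrow> 'w proc \<Rightarrow> 'w proc \<Rightarrow> 'w proc \<Rightarrow>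
   'w signal \<Rightarrow> 'w signal \<Rightarrow> 'w signal \<Rightarrow> 'w signal" where
  "dtilde_sig S x xh u u' d d' w v vb =
     sig (tini S) d - dhat_sig S xh u u' (y_sig S x u d v) (yb_sig S x u u' d d' w vb)"

definition xtilde :: "'w proc \<Rightarrow> 'w proc \<Rightarrow> 'w proc" where
  "xtilde x xh t \<omega> = x t \<omega> - xh t \<omega>"

definition bias_gamma :: "real \<Rightarrow> (real \<Rightarrow> real mat) \<Rightarrow> real" where
  "bias_gamma t0 Sm = 1 / (2 * lam_sup t0 Sm)"

definition bias_beta :: "real \<Rightarrow> (real \<Rightarrow> real mat) \<Rightarrow> real vec \<Rightarrow> real" where
  "bias_beta t0 Sm e0 = sqrt (scalar_prod e0 (Sm t0 *\<^sub>v e0) / lam_inf t0 Sm)"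

definition bias_alpha :: "elise_data \<Rightarrow> (real \<Rightarrow> real mat) \<Rightarrow> real vec \<Rightarrow> real" where
  "bias_alpha S Sm e0 = bias_beta (tini S) Sm e0 * (SUP t\<in>{tini S..}. input_gain S t)"

end

theory Submission
  imports Defs
begin

text \<open>
  Let \<open>e\<close> be the mean of the state error \<open>x - xh\<close>. Taking means in the equations of the system and of
  the filter removes the noises, and the unknown input cancels: \<open>M\<^sub>1 T\<^sub>1 H = V\<^sub>1\<^sup>T\<close> makes the first
  estimate exact up to \<open>M\<^sub>1 C\<^sub>1 e\<close>, \<open>M\<^sub>2\<close> is a left inverse of the product of the additional output
  matrix with \<open>G\<^sub>2\<close>, which makes the second estimate exact up to \<open>M\<^sub>2 E e\<close>, and
  \<open>V\<^sub>1 V\<^sub>1\<^sup>T + V\<^sub>2 V\<^sub>2\<^sup>T = I\<close> reassembles \<open>d\<close>. So the input bias is \<open>- (V\<^sub>1 M\<^sub>1 C\<^sub>1 + V\<^sub>2 M\<^sub>2 E) e\<close>, and \<open>e\<close>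
  solves the homogeneous filter error system (\<open>filter_error_algebra\<close>, \<open>mean_error_equations\<close>). The
  input bias therefore decays as fast as \<open>e\<close>, and the gain enters as a factor.

  White noise is only given by its action on test functions, so this is carried out with mean
  functions tested in the same way. Processes are handled by Fubini's theorem (\<open>mean_of_process\<close>),
  and sums and matrix multiples by duality. The result is an integral equation for \<open>e\<close>; since all
  filter matrices are continuous in time, \<open>e\<close> is a classical solution
  (\<open>lin_solution_of_integral_equation\<close>).

  Uniform asymptotic stability of a linear system is exponential stability
  (\<open>uniformly_asymptotically_stable_exponential\<close>), which gives some exponential rate. For the explicit
  rate let \<open>S(t)\<close> be the Gramian. Exponential stability makes its defining integral converge with a
  bound uniform in \<open>t\<close>, and bounded coefficients keep it uniformly away from \<open>0\<close>. The function
  \<open>V = e\<^sup>T S e\<close> is the integral of \<open>|e|\<^sup>2\<close> from \<open>t\<close> to infinity, so \<open>V' = - |e|\<^sup>2 \<le> - V / \<lambda>\<close> with \<open>\<lambda>\<close> the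
  supremum of the largest eigenvalues of \<open>S\<close>. Hence \<open>V\<close> decays at the rate \<open>1 / \<lambda>\<close>, and comparing \<open>V\<close>
  with \<open>|e|\<^sup>2\<close> through the smallest eigenvalues gives the constant \<open>\<beta>\<close> and half that rate for \<open>|e|\<close>
  (\<open>lyapunov_decay\<close>).
\<close>

section \<open>Euclidean and operator norms\<close>

lemma vnorm_eq_L2_set:
  assumes "v \<in> carrier_vec n"
  shows "vnorm v = L2_set (\<lambda>i. v $ i) {..<n}"
  using assms unfolding vnorm_def L2_set_def scalar_prod_def
  by (auto simp: power2_eq_square lessThan_atLeast0)

lemma vnorm_square: "(vnorm v)\<^sup>2 = scalar_prod v v"
  unfolding vnorm_def by (simp add: scalar_prod_def sum_nonneg)

lemma vnorm_nonneg [simp]: "0 \<le> vnorm v"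
  unfolding vnorm_def by (simp add: scalar_prod_def sum_nonneg)

lemma vnorm_zero_vec [simp]: "vnorm (0\<^sub>v n) = 0"
  by (simp add: vnorm_eq_L2_set[of _ n] L2_set_def)

lemma abs_index_le_vnorm:
  assumes "v \<in> carrier_vec n" "i < n"
  shows "\<bar>v $ i\<bar> \<le> vnorm v"
  using member_le_L2_set[of "{..<n}" i "\<lambda>i. \<bar>v $ i\<bar>"] assms
  by (simp add: vnorm_eq_L2_set L2_set_def)

lemma vnorm_eq_0_iff:
  assumes "v \<in> carrier_vec n"
  shows "vnorm v = 0 \<longleftrightarrow> v = 0\<^sub>v n"
  using assms by (auto simp: vnorm_eq_L2_set[OF assms] L2_set_eq_0_iff intro!: eq_vecI)

lemma vnorm_le_sum_abs:
  assumes "v \<in> carrier_vec n"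
  shows "vnorm v \<le> (\<Sum>i<n. \<bar>v $ i\<bar>)"
  using L2_set_le_sum_abs by (simp add: vnorm_eq_L2_set[OF assms])

lemma vnorm_smult: "vnorm (c \<cdot>\<^sub>v v) = \<bar>c\<bar> * vnorm v"
proof -
  have "scalar_prod (c \<cdot>\<^sub>v v) (c \<cdot>\<^sub>v v) = c\<^sup>2 * scalar_prod v v"
    by (simp add: scalar_prod_def sum_distrib_left power2_eq_square algebra_simps)
  then show ?thesis unfolding vnorm_def by (simp add: real_sqrt_mult)
qed

lemma vnorm_uminus: "vnorm (- v) = vnorm v"
  unfolding vnorm_def by (simp add: scalar_prod_def)

lemma vnorm_triangle:
  assumes "v \<in> carrier_vec n" "w \<in> carrier_vec n"
  shows "vnorm (v + w) \<le> vnorm v + vnorm w"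
proof -
  have "vnorm (v + w) = L2_set (\<lambda>i. v $ i + w $ i) {..<n}"
    using assms by (auto simp: vnorm_eq_L2_set[of _ n] intro!: L2_set_cong)
  then show ?thesis
    using assms L2_set_triangle_ineq[of "\<lambda>i. v $ i" "\<lambda>i. w $ i" "{..<n}"]
    by (simp add: vnorm_eq_L2_set)
qed

lemma abs_scalar_prod_le_vnorm:
  assumes "v \<in> carrier_vec n" "w \<in> carrier_vec n"
  shows "\<bar>scalar_prod v w\<bar> \<le> vnorm v * vnorm w"
proof -
  have "\<bar>scalar_prod v w\<bar> \<le> (\<Sum>i<n. \<bar>v $ i\<bar> * \<bar>w $ i\<bar>)"
    using assms sum_abs[of "\<lambda>i. v $ i * w $ i" "{..<n}"]
    by (simp add: scalar_prod_def lessThan_atLeast0 abs_mult)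
  also have "\<dots> \<le> vnorm v * vnorm w"
    unfolding vnorm_eq_L2_set[OF assms(1)] vnorm_eq_L2_set[OF assms(2)]
    by (rule L2_set_mult_ineq)
  finally show ?thesis .
qed

text \<open>This crude bound shows that the supremum defining the operator norm is finite.\<close>
lemma vnorm_mult_mat_vec_le_entries:
  assumes A: "A \<in> carrier_mat k m" and v: "v \<in> carrier_vec m"
  shows "vnorm (A *\<^sub>v v) \<le> (\<Sum>i<k. \<Sum>j<m. \<bar>A $$ (i, j)\<bar>) * vnorm v"
proof -
  have Av: "A *\<^sub>v v \<in> carrier_vec k" using A v by (rule mult_mat_vec_carrier)
  have "\<bar>(A *\<^sub>v v) $ i\<bar> \<le> (\<Sum>j<m. \<bar>A $$ (i, j)\<bar>) * vnorm v" if "i < k" for i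
  proof -
    have "(A *\<^sub>v v) $ i = (\<Sum>j<m. A $$ (i, j) * v $ j)"
      using A v that by (auto simp: scalar_prod_def lessThan_atLeast0)
    then have "\<bar>(A *\<^sub>v v) $ i\<bar> \<le> (\<Sum>j<m. \<bar>A $$ (i, j) * v $ j\<bar>)" by simp
    also have "\<dots> \<le> (\<Sum>j<m. \<bar>A $$ (i, j)\<bar> * vnorm v)"
      by (rule sum_mono) (auto simp: abs_mult intro!: mult_left_mono abs_index_le_vnorm[OF v])
    finally show ?thesis by (simp add: sum_distrib_right)
  qed
  then have "(\<Sum>i<k. \<bar>(A *\<^sub>v v) $ i\<bar>) \<le> (\<Sum>i<k. (\<Sum>j<m. \<bar>A $$ (i, j)\<bar>) * vnorm v)"
    by (intro sum_mono) auto
  then show ?thesis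
    using vnorm_le_sum_abs[OF Av] by (simp add: sum_distrib_right)
qed

lemma mnorm_bdd_above:
  assumes A: "A \<in> carrier_mat k m"
  shows "bdd_above ((\<lambda>v. vnorm (A *\<^sub>v v)) ` {v \<in> carrier_vec m. vnorm v \<le> 1})"
proof (rule bdd_aboveI2)
  fix v :: "real vec" assume v: "v \<in> {v \<in> carrier_vec m. vnorm v \<le> 1}"
  have "vnorm (A *\<^sub>v v) \<le> (\<Sum>i<k. \<Sum>j<m. \<bar>A $$ (i, j)\<bar>) * vnorm v"
    using v by (intro vnorm_mult_mat_vec_le_entries[OF A]) auto
  also have "\<dots> \<le> (\<Sum>i<k. \<Sum>j<m. \<bar>A $$ (i, j)\<bar>) * 1"
    using v by (intro mult_left_mono) (auto intro!: sum_nonneg)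
  finally show "vnorm (A *\<^sub>v v) \<le> (\<Sum>i<k. \<Sum>j<m. \<bar>A $$ (i, j)\<bar>)" by simp
qed

lemma vnorm_mult_mat_vec_le:
  assumes A: "A \<in> carrier_mat k m" and v: "v \<in> carrier_vec m"
  shows "vnorm (A *\<^sub>v v) \<le> mnorm A * vnorm v"
proof (cases "v = 0\<^sub>v m")
  case True
  then have "A *\<^sub>v v = 0\<^sub>v k" using A by auto
  then show ?thesis using True by simp
next
  case False
  then have pos: "vnorm v > 0" using vnorm_eq_0_iff[OF v] vnorm_nonneg[of v] by linarith
  let ?u = "(1 / vnorm v) \<cdot>\<^sub>v v"
  have u: "?u \<in> carrier_vec m" "vnorm ?u \<le> 1" using v pos by (auto simp: vnorm_smult)
  have "vnorm (A *\<^sub>v ?u) \<le> mnorm A"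
    unfolding mnorm_def using A u
    by (intro cSUP_upper) (auto intro: mnorm_bdd_above[OF A])
  moreover have "A *\<^sub>v ?u = (1 / vnorm v) \<cdot>\<^sub>v (A *\<^sub>v v)"
    using A v by (simp add: mult_mat_vec)
  ultimately show ?thesis using pos by (simp add: vnorm_smult field_simps)
qed

lemma mnorm_nonneg:
  assumes A: "A \<in> carrier_mat k m"
  shows "0 \<le> mnorm A"
proof -
  have "vnorm (A *\<^sub>v 0\<^sub>v m) \<le> mnorm A"
    unfolding mnorm_def using A
    by (intro cSUP_upper) (auto intro: mnorm_bdd_above[OF A])
  then show ?thesis using vnorm_nonneg[of "A *\<^sub>v 0\<^sub>v m"] by linarith
qed

section \<open>Inverses of matrices and their continuity in time\<close>

lemma minv:
  assumes A: "A \<in> carrier_mat n n" and inv: "invertible_mat A"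
  shows "minv A \<in> carrier_mat n n" "A * minv A = 1\<^sub>m n" "minv A * A = 1\<^sub>m n"
proof -
  obtain B where B: "A * B = 1\<^sub>m n" "B * A = 1\<^sub>m (dim_row B)"
    using inv A unfolding invertible_mat_def inverts_mat_def by auto
  have Bc: "B \<in> carrier_mat n n"
    using arg_cong[OF B(1), of dim_col] arg_cong[OF B(2), of dim_col] A by auto
  then have "A \<in> Units (ring_mat TYPE(real) n ())"
    using A B unfolding Units_def ring_mat_def by auto
  then obtain C where "mat_inverse A = Some C"
    using mat_inverse(1)[OF A, of "()"] by (cases "mat_inverse A") auto
  then show "minv A \<in> carrier_mat n n" "A * minv A = 1\<^sub>m n" "minv A * A = 1\<^sub>m n"
    using mat_inverse(2)[OF A] by (auto simp: minv_def)
qed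

lemma invertible_matI_det:
  assumes A: "(A :: real mat) \<in> carrier_mat n n" and d: "det A \<noteq> 0"
  shows "invertible_mat A"
proof -
  let ?B = "(1 / det A) \<cdot>\<^sub>m adj_mat A"
  have "A * ?B = 1\<^sub>m n" "?B * A = 1\<^sub>m n"
    using adj_mat[OF A] d
    by (auto simp: mult_smult_distrib[OF A adj_mat(1)[OF A]] mult_smult_assoc_mat[OF adj_mat(1)[OF A] A]
        intro!: eq_matI)
  then show ?thesis
    using A adj_mat(1)[OF A] unfolding invertible_mat_def inverts_mat_def
    by (intro conjI exI[of _ ?B]) auto
qed

lemma invertible_mat_det:
  assumes A: "(A :: real mat) \<in> carrier_mat n n" and inv: "invertible_mat A"
  shows "det A \<noteq> 0"
proof
  assume "det A = 0"
  then have "det (A * minv A) = 0" using det_mult[OF A minv(1)[OF A inv]] by simp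
  then show False using minv(2)[OF A inv] by simp
qed

lemma smult_one_eq:
  assumes "c \<noteq> (0 :: real)"
  shows "(1 / c) \<cdot>\<^sub>m (c \<cdot>\<^sub>m B) = B"
  using assms by (intro eq_matI) auto

text \<open>Cramer's formula writes the entries of the inverse as quotients of polynomials in the entries of
  the matrix, so that inversion preserves continuity in time.\<close>
lemma minv_eq_adj_mat:
  assumes A: "A \<in> carrier_mat n n" and inv: "invertible_mat A"
  shows "minv A = (1 / det A) \<cdot>\<^sub>m adj_mat A"
proof -
  have "minv A = minv A * 1\<^sub>m n" using minv[OF A inv] by simp
  also have "\<dots> = minv A * (A * ((1 / det A) \<cdot>\<^sub>m adj_mat A))"
    using adj_mat(2)[OF A] invertible_mat_det[OF A inv] minv(1)[OF A inv]
    by (simp add: mult_smult_distrib[OF A adj_mat(1)[OF A]] smult_one_eq)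
  also have "\<dots> = (minv A * A) * ((1 / det A) \<cdot>\<^sub>m adj_mat A)"
    using minv[OF A inv] A adj_mat(1)[OF A] by (intro assoc_mult_mat[symmetric]) auto
  also have "\<dots> = (1 / det A) \<cdot>\<^sub>m adj_mat A"
    using minv[OF A inv] adj_mat(1)[OF A] by simp
  finally show ?thesis .
qed

lemma pos_def_invertible:
  assumes K: "pos_def n K"
  shows "invertible_mat K"
proof (rule invertible_matI_det)
  show Kc: "K \<in> carrier_mat n n" using K by (simp add: pos_def_def)
  show "det K \<noteq> 0"
  proof
    assume "det K = 0"
    then obtain v where v: "v \<in> carrier_vec n" "v \<noteq> 0\<^sub>v n" "K *\<^sub>v v = 0\<^sub>v n"
      using det_0_iff_vec_prod_zero_field[OF Kc] by auto
    then show False using K unfolding pos_def_def by (metis scalar_prod_right_zero less_irrefl)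
  qed
qed

lemma cont_mat_carrier: "cont_mat t0 k m F \<Longrightarrow> t \<ge> t0 \<Longrightarrow> F t \<in> carrier_mat k m"
  by (simp add: cont_mat_def)

lemma cont_matD:
  "cont_mat t0 k m F \<Longrightarrow> i < k \<Longrightarrow> j < m \<Longrightarrow> continuous_on {t0..} (\<lambda>t. F t $$ (i, j))"
  by (simp add: cont_mat_def)

lemma cont_matI:
  assumes "\<And>t. t \<ge> t0 \<Longrightarrow> F t \<in> carrier_mat k m"
    and "\<And>i j. i < k \<Longrightarrow> j < m \<Longrightarrow> continuous_on {t0..} (\<lambda>t. f i j t)"
    and "\<And>i j t. i < k \<Longrightarrow> j < m \<Longrightarrow> t \<ge> t0 \<Longrightarrow> F t $$ (i, j) = f i j t"
  shows "cont_mat t0 k m F"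
  unfolding cont_mat_def
proof (intro conjI allI impI)
  fix i j assume ij: "i < k" "j < m"
  show "continuous_on {t0..} (\<lambda>t. F t $$ (i, j))"
    using assms(2)[OF ij] by (rule continuous_on_eq) (use assms(3)[OF ij] in auto)
qed (rule assms(1))

lemma cont_mat_add:
  assumes "cont_mat t0 k m F" "cont_mat t0 k m G"
  shows "cont_mat t0 k m (\<lambda>t. F t + G t)"
proof (rule cont_matI[where f = "\<lambda>i j t. F t $$ (i, j) + G t $$ (i, j)"])
  show "F t + G t \<in> carrier_mat k m" if "t \<ge> t0" for t
    using cont_mat_carrier[OF assms(2) that] by (rule add_carrier_mat)
  show "(F t + G t) $$ (i, j) = F t $$ (i, j) + G t $$ (i, j)" if "i < k" "j < m" "t \<ge> t0" for i j t
    using cont_mat_carrier[OF assms(2) that(3)] that by simp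
qed (use assms in \<open>auto simp: cont_mat_def intro!: continuous_intros\<close>)

lemma cont_mat_diff:
  assumes "cont_mat t0 k m F" "cont_mat t0 k m G"
  shows "cont_mat t0 k m (\<lambda>t. F t - G t)"
proof (rule cont_matI[where f = "\<lambda>i j t. F t $$ (i, j) - G t $$ (i, j)"])
  show "F t - G t \<in> carrier_mat k m" if "t \<ge> t0" for t
    using cont_mat_carrier[OF assms(2) that] by (rule minus_carrier_mat)
  show "(F t - G t) $$ (i, j) = F t $$ (i, j) - G t $$ (i, j)" if "i < k" "j < m" "t \<ge> t0" for i j t
    using cont_mat_carrier[OF assms(2) that(3)] that by simp
qed (use assms in \<open>auto simp: cont_mat_def intro!: continuous_intros\<close>)

lemma cont_mat_transpose:
  assumes "cont_mat t0 k m F"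
  shows "cont_mat t0 m k (\<lambda>t. (F t)\<^sup>T)"
proof (rule cont_matI[where f = "\<lambda>i j t. F t $$ (j, i)"])
  show "(F t)\<^sup>T $$ (i, j) = F t $$ (j, i)" if "i < m" "j < k" "t \<ge> t0" for i j t
    using cont_mat_carrier[OF assms that(3)] that by simp
qed (use assms in \<open>auto simp: cont_mat_def\<close>)

lemma cont_mat_const: "A \<in> carrier_mat k m \<Longrightarrow> cont_mat t0 k m (\<lambda>t. A)"
  by (simp add: cont_mat_def)

lemma index_mult_mat_sum:
  assumes "A \<in> carrier_mat k m" "B \<in> carrier_mat m l" "i < k" "j < l"
  shows "(A * B) $$ (i, j) = (\<Sum>r<m. A $$ (i, r) * B $$ (r, j))"
  using assms by (auto simp: scalar_prod_def lessThan_atLeast0)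

lemma index_mult_mat_vec_sum:
  assumes "A \<in> carrier_mat k m" "v \<in> carrier_vec m" "i < k"
  shows "(A *\<^sub>v v) $ i = (\<Sum>r<m. A $$ (i, r) * v $ r)"
  using assms by (auto simp: scalar_prod_def lessThan_atLeast0)

lemma cont_mat_mult:
  assumes F: "cont_mat t0 k m F" and G: "cont_mat t0 m l G"
  shows "cont_mat t0 k l (\<lambda>t. F t * G t)"
proof (rule cont_matI[where f = "\<lambda>i j t. \<Sum>r<m. F t $$ (i, r) * G t $$ (r, j)"])
  show "F t * G t \<in> carrier_mat k l" if "t \<ge> t0" for t
    using cont_mat_carrier[OF F that] cont_mat_carrier[OF G that] by simp
  show "(F t * G t) $$ (i, j) = (\<Sum>r<m. F t $$ (i, r) * G t $$ (r, j))"
    if "i < k" "j < l" "t \<ge> t0" for i j t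
    using cont_mat_carrier[OF F that(3)] cont_mat_carrier[OF G that(3)] that
    by (intro index_mult_mat_sum) auto
qed (use F G in \<open>auto simp: cont_mat_def intro!: continuous_intros\<close>)

lemma continuous_on_det:
  assumes F: "cont_mat t0 n n F"
  shows "continuous_on {t0..} (\<lambda>t. det (F t))"
proof (rule continuous_on_eq)
  show "(\<Sum>p | p permutes {0..<n}. signof p * (\<Prod>i = 0..<n. F t $$ (i, p i))) = det (F t)"
    if "t \<in> {t0..}" for t
    using cont_mat_carrier[OF F] that by (simp add: Determinant.det_def'[of _ n])
  show "continuous_on {t0..} (\<lambda>t. \<Sum>p | p permutes {0..<n}. signof p * (\<Prod>i = 0..<n. F t $$ (i, p i)))"
    by (intro continuous_intros) (auto intro!: cont_matD[OF F] dest: permutes_in_image)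
qed

lemma cont_mat_delete:
  assumes F: "cont_mat t0 n n F"
  shows "cont_mat t0 (n - 1) (n - 1) (\<lambda>t. mat_delete (F t) i j)"
proof (rule cont_matI)
  show "mat_delete (F t) i j \<in> carrier_mat (n - 1) (n - 1)" if "t \<ge> t0" for t
    using cont_mat_carrier[OF F that] by (rule mat_delete_carrier)
  show "mat_delete (F t) i j $$ (a, b) = F t $$ (if a < i then a else Suc a, if b < j then b else Suc b)"
    if "a < n - 1" "b < n - 1" "t \<ge> t0" for a b t
    using cont_mat_carrier[OF F that(3)] that by (auto simp: mat_delete_def)
qed (auto intro!: cont_matD[OF F])

lemma cont_mat_minv:
  assumes F: "cont_mat t0 n n F" and inv: "\<And>t. t \<ge> t0 \<Longrightarrow> invertible_mat (F t)"
  shows "cont_mat t0 n n (\<lambda>t. minv (F t))"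
proof (rule cont_matI)
  show "minv (F t) \<in> carrier_mat n n" if "t \<ge> t0" for t
    using minv(1)[OF cont_mat_carrier[OF F that] inv[OF that]] .
  show "minv (F t) $$ (i, j) = 1 / det (F t) * ((-1) ^ (j + i) * det (mat_delete (F t) j i))"
    if "i < n" "j < n" "t \<ge> t0" for i j t
    using minv_eq_adj_mat[OF cont_mat_carrier[OF F that(3)] inv[OF that(3)]]
      cont_mat_carrier[OF F that(3)] that by (simp add: adj_mat_def cofactor_def)
  show "continuous_on {t0..} (\<lambda>t. 1 / det (F t) * ((-1) ^ (j + i) * det (mat_delete (F t) j i)))" for i j
    using invertible_mat_det[OF cont_mat_carrier[OF F] inv]
    by (intro continuous_intros continuous_on_det[OF F] continuous_on_det[OF cont_mat_delete[OF F]]) auto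
qed

lemma cont_mat_smooth: "smooth_mat t0 k m F \<Longrightarrow> cont_mat t0 k m F"
  unfolding cont_mat_def smooth_mat_def smooth_fun_def
proof (intro conjI allI impI; elim conjE)
  fix i j assume ij: "i < k" "j < m"
    and s: "\<forall>i<k. \<forall>j<m. \<exists>D. (\<forall>t\<ge>t0. D 0 t = F t $$ (i, j)) \<and>
      (\<forall>k. \<forall>t\<ge>t0. (D k has_real_derivative D (Suc k) t) (at t within {t0..}))"
  obtain D where D: "\<forall>t\<ge>t0. D 0 t = F t $$ (i, j)"
    "\<forall>k. \<forall>t\<ge>t0. (D k has_real_derivative D (Suc k) t) (at t within {t0..})"
    using s ij by metis
  have "continuous_on {t0..} (D 0)"
    using D(2) by (intro DERIV_continuous_on) auto
  then show "continuous_on {t0..} (\<lambda>t. F t $$ (i, j))"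
    by (rule continuous_on_eq) (use D(1) in auto)
qed auto

lemma cont_mat_has_deriv: "mat_has_deriv t0 k m F F' \<Longrightarrow> cont_mat t0 k m F"
  unfolding cont_mat_def mat_has_deriv_def by (auto intro!: DERIV_continuous_on)

section \<open>Extremal eigenvalues of a symmetric matrix\<close>

lemma quadratic_form_sum:
  assumes "K \<in> carrier_mat n n" "v \<in> carrier_vec n"
  shows "scalar_prod v (K *\<^sub>v v) = (\<Sum>i<n. \<Sum>j<n. v $ i * K $$ (i, j) * v $ j)"
proof -
  have "scalar_prod v (K *\<^sub>v v) = (\<Sum>i<n. v $ i * (K *\<^sub>v v) $ i)"
    using assms by (simp add: scalar_prod_def lessThan_atLeast0)
  also have "\<dots> = (\<Sum>i<n. v $ i * (\<Sum>j<n. K $$ (i, j) * v $ j))"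
    by (intro sum.cong refl arg_cong2[where f = "(*)"] index_mult_mat_vec_sum[OF assms]) auto
  finally show ?thesis by (simp add: sum_distrib_left mult.assoc)
qed

lemma symmetric_mat_scalar_prod:
  assumes K: "K \<in> carrier_mat n n" "K\<^sup>T = K" and v: "v \<in> carrier_vec n" "w \<in> carrier_vec n"
  shows "scalar_prod v (K *\<^sub>v w) = scalar_prod w (K *\<^sub>v (v :: real vec))"
proof -
  have "scalar_prod v (K *\<^sub>v w) = scalar_prod (K *\<^sub>v v) w"
    using transpose_vec_mult_scalar[OF K(1) v(2,1)] K(2) by simp
  also have "\<dots> = scalar_prod w (K *\<^sub>v v)" using K v by (intro comm_scalar_prod) auto
  finally show ?thesis .
qed

text \<open>Vectors of explicit dimension carry no topology of their own. The unit sphere is therefore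
  embedded into the product space of all real sequences by padding with zeros, where it is a closed
  subset of a product of compact intervals.\<close>
lemma compact_unit_sphere_functions:
  "compact {f :: nat \<Rightarrow> real. (\<forall>i. n \<le> i \<longrightarrow> f i = 0) \<and> (\<Sum>i<n. (f i)\<^sup>2) = 1}"
proof -
  let ?P = "\<Pi>\<^sub>E i\<in>UNIV. (if i < n then {-1..1} else {0 :: real})"
  let ?Q = "{f :: nat \<Rightarrow> real. (\<Sum>i<n. (f i)\<^sup>2) = 1}"
  have "compactin (product_topology (\<lambda>i. euclidean) UNIV) ?P"
    unfolding compactin_PiE by auto
  then have "compact ?P" by (simp add: euclidean_product_topology)
  moreover have "closed ?Q"
    by (intro closed_Collect_eq continuous_on_sum continuous_on_power continuous_on_const
        continuous_on_product_coordinates)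
  ultimately have "compact (?P \<inter> ?Q)" by (rule compact_Int_closed)
  moreover have "?P \<inter> ?Q = {f. (\<forall>i. n \<le> i \<longrightarrow> f i = 0) \<and> (\<Sum>i<n. (f i)\<^sup>2) = 1}"
  proof (intro equalityI subsetI)
    fix f :: "nat \<Rightarrow> real" assume f: "f \<in> {f. (\<forall>i. n \<le> i \<longrightarrow> f i = 0) \<and> (\<Sum>i<n. (f i)\<^sup>2) = 1}"
    have "\<bar>f i\<bar> \<le> 1" if "i < n" for i
    proof -
      have "(f i)\<^sup>2 \<le> (\<Sum>i<n. (f i)\<^sup>2)" using that by (intro member_le_sum) auto
      then show ?thesis using f by (simp add: abs_square_le_1)
    qed
    then show "f \<in> ?P \<inter> ?Q" using f by (auto simp: PiE_iff abs_le_iff)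
  next
    fix f :: "nat \<Rightarrow> real" assume f: "f \<in> ?P \<inter> ?Q"
    then have "f i \<in> (if i < n then {-1..1} else {0 :: real})" for i by (auto simp: PiE_iff)
    then have "f i = 0" if "n \<le> i" for i using that by (metis not_le singletonD)
    then show "f \<in> {f. (\<forall>i. n \<le> i \<longrightarrow> f i = 0) \<and> (\<Sum>i<n. (f i)\<^sup>2) = 1}" using f by auto
  qed
  ultimately show ?thesis by simp
qed

text \<open>A maximiser \<open>u\<close> of the quadratic form on the unit sphere is an eigenvector: the form
  \<open>\<lambda>|x|\<^sup>2 - x\<^sup>T K x\<close> is nonnegative and vanishes at \<open>u\<close>, so its derivative there in the direction
  of the residual \<open>\<lambda>u - K u\<close> vanishes as well.\<close>
lemma rayleigh_max:
  assumes K: "K \<in> carrier_mat n n" "K\<^sup>T = K" and n: "0 < n"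
  obtains u l where "u \<in> carrier_vec n" "vnorm u = 1" "K *\<^sub>v u = l \<cdot>\<^sub>v u"
    "\<And>v. v \<in> carrier_vec n \<Longrightarrow> scalar_prod v (K *\<^sub>v v) \<le> l * (vnorm v)\<^sup>2"
proof -
  let ?X = "{f :: nat \<Rightarrow> real. (\<forall>i. n \<le> i \<longrightarrow> f i = 0) \<and> (\<Sum>i<n. (f i)\<^sup>2) = 1}"
  let ?q = "\<lambda>f. \<Sum>i<n. \<Sum>j<n. f i * K $$ (i, j) * f j"
  have "(\<lambda>i. if i = 0 then 1 else 0) \<in> ?X"
    using n by (auto simp: if_distrib[of "\<lambda>x. x\<^sup>2"] sum.delta cong: if_cong)
  then have "?X \<noteq> {}" by (intro notI) (simp only: empty_iff)
  moreover have "continuous_on ?X ?q"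
    by (intro continuous_on_sum continuous_on_mult continuous_on_const
        continuous_on_subset[OF continuous_on_product_coordinates] subset_UNIV)
  ultimately have "\<exists>f\<in>?X. \<forall>g\<in>?X. ?q g \<le> ?q f"
    by (rule continuous_attains_sup[OF compact_unit_sphere_functions])
  then obtain f where f: "f \<in> ?X" and f_max: "\<forall>g\<in>?X. ?q g \<le> ?q f" by (rule bexE)
  have max: "?q g \<le> ?q f" if "g \<in> ?X" for g using f_max that by (rule bspec)
  define u where "u = vec n f"
  define l where "l = ?q f"
  have u: "u \<in> carrier_vec n" by (simp add: u_def)
  have ql: "scalar_prod u (K *\<^sub>v u) = l"
    unfolding quadratic_form_sum[OF K(1) u] l_def by (simp add: u_def)
  have nu: "vnorm u = 1"
    using f unfolding vnorm_eq_L2_set[OF u] L2_set_def by (simp add: u_def)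
  have bound: "scalar_prod v (K *\<^sub>v v) \<le> l * (vnorm v)\<^sup>2" if v: "v \<in> carrier_vec n" for v
  proof (cases "v = 0\<^sub>v n")
    case True
    then show ?thesis using K(1) by simp
  next
    case False
    then have pos: "vnorm v > 0" using vnorm_eq_0_iff[OF v] vnorm_nonneg[of v] by linarith
    define g where "g i = (if i < n then v $ i / vnorm v else 0)" for i
    have "(\<Sum>i<n. (g i)\<^sup>2) = (\<Sum>i<n. (v $ i)\<^sup>2) / (vnorm v)\<^sup>2"
      by (simp add: g_def power_divide sum_divide_distrib)
    also have "(\<Sum>i<n. (v $ i)\<^sup>2) = (vnorm v)\<^sup>2"
      by (simp add: vnorm_eq_L2_set[OF v] L2_set_def sum_nonneg)
    finally have "g \<in> ?X" using pos by (auto simp: g_def)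
    then have "?q g \<le> l" unfolding l_def by (rule max)
    moreover have "?q g = scalar_prod v (K *\<^sub>v v) / (vnorm v)\<^sup>2"
      unfolding quadratic_form_sum[OF K(1) v]
      by (simp add: g_def sum_divide_distrib power2_eq_square)
    ultimately have "scalar_prod v (K *\<^sub>v v) / (vnorm v)\<^sup>2 \<le> l" by linarith
    then show ?thesis using pos by (simp add: divide_le_eq)
  qed
  define r where "r = l \<cdot>\<^sub>v u - K *\<^sub>v u"
  have r: "r \<in> carrier_vec n" using u K by (simp add: r_def)
  have Ku: "K *\<^sub>v u \<in> carrier_vec n" "K *\<^sub>v r \<in> carrier_vec n" using K(1) u r by auto
  \<comment> \<open>nonnegativity of \<open>\<lambda>|x|\<^sup>2 - x\<^sup>T K x\<close> along the line \<open>x = u + t r\<close>\<close>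
  have quad: "0 \<le> 2 * t * scalar_prod r r + t\<^sup>2 * (l * scalar_prod r r - scalar_prod r (K *\<^sub>v r))" for t
  proof -
    let ?v = "u + t \<cdot>\<^sub>v r"
    have v: "?v \<in> carrier_vec n" using u r by simp
    have uu: "scalar_prod u u = 1" using nu vnorm_square[of u] by simp
    have cru: "scalar_prod r u = scalar_prod u r" by (rule comm_scalar_prod[OF r u])
    have "K *\<^sub>v ?v = K *\<^sub>v u + t \<cdot>\<^sub>v (K *\<^sub>v r)"
      using K(1) u r by (simp add: mult_add_distrib_mat_vec[OF K(1)] mult_mat_vec[OF K(1)])
    then have e1: "scalar_prod ?v (K *\<^sub>v ?v) = scalar_prod u (K *\<^sub>v u) + t * scalar_prod u (K *\<^sub>v r)
        + t * scalar_prod r (K *\<^sub>v u) + t * (t * scalar_prod r (K *\<^sub>v r))"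
      using u r Ku by (simp add: add_scalar_prod_distrib[of _ n] scalar_prod_add_distrib[of _ n] algebra_simps)
    have e2: "scalar_prod u (K *\<^sub>v r) = scalar_prod r (K *\<^sub>v u)"
      by (rule symmetric_mat_scalar_prod[OF K u r])
    have e3: "scalar_prod ?v ?v = 1 + 2 * t * scalar_prod r u + t * (t * scalar_prod r r)"
      using u r by (simp add: add_scalar_prod_distrib[of _ n] scalar_prod_add_distrib[of _ n] uu cru algebra_simps)
    have e4: "scalar_prod r r = l * scalar_prod r u - scalar_prod r (K *\<^sub>v u)"
      by (subst (2) r_def) (use u r Ku in \<open>simp add: scalar_prod_minus_distrib[of _ n]\<close>)
    have "scalar_prod ?v (K *\<^sub>v ?v) \<le> l * scalar_prod ?v ?v"
      using bound[OF v] by (simp only: vnorm_square)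
    then have "l + 2 * t * scalar_prod r (K *\<^sub>v u) + t\<^sup>2 * scalar_prod r (K *\<^sub>v r)
        \<le> l * (1 + 2 * t * scalar_prod r u + t\<^sup>2 * scalar_prod r r)"
      unfolding e1 e2 e3 ql by (simp add: power2_eq_square algebra_simps)
    moreover have "2 * t * scalar_prod r r = 2 * t * (l * scalar_prod r u - scalar_prod r (K *\<^sub>v u))"
      using e4 by simp
    ultimately show ?thesis by (simp add: algebra_simps)
  qed
  have "scalar_prod r r = 0"
  proof (rule ccontr)
    assume "scalar_prod r r \<noteq> 0"
    then have pos: "scalar_prod r r > 0" using vnorm_square[of r] zero_le_power2[of "vnorm r"] by linarith
    define c where "c = \<bar>l * scalar_prod r r - scalar_prod r (K *\<^sub>v r)\<bar> + 1"
    have c: "c > 0" "l * scalar_prod r r - scalar_prod r (K *\<^sub>v r) \<le> c" by (auto simp: c_def)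
    \<comment> \<open>\<open>c\<close> dominates the coefficient of \<open>t\<^sup>2\<close>; the quadratic with leading coefficient \<open>c\<close> is
      minimal, and negative, at \<open>?t\<close>\<close>
    let ?t = "- scalar_prod r r / c"
    have "0 \<le> 2 * ?t * scalar_prod r r + ?t\<^sup>2 * c"
      using quad[of ?t] mult_left_mono[OF c(2) zero_le_power2[of ?t]] by linarith
    also have "\<dots> = - ((scalar_prod r r)\<^sup>2 / c)"
      using c(1) by (simp add: power2_eq_square field_simps)
    finally show False using pos c(1) by (simp add: field_simps)
  qed
  then have "r = 0\<^sub>v n" using vnorm_square[of r] vnorm_eq_0_iff[OF r] by simp
  then have "K *\<^sub>v u = l \<cdot>\<^sub>v u"
    unfolding r_def using u Ku by (auto simp: vec_eq_iff)
  then show thesis using that[OF u nu _ bound] by blast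
qed

lemma finite_eigenvalues:
  assumes "(K :: real mat) \<in> carrier_mat n n"
  shows "finite {k. eigenvalue K k}"
proof -
  have "char_poly K \<noteq> 0" using degree_monic_char_poly[OF assms] by auto
  then show ?thesis by (simp add: eigenvalue_root_char_poly[OF assms] poly_roots_finite)
qed

lemma eigenvalueI:
  assumes "K \<in> carrier_mat n n" "u \<in> carrier_vec n" "vnorm u = 1" "K *\<^sub>v u = l \<cdot>\<^sub>v u"
  shows "eigenvalue K l"
  using assms unfolding eigenvalue_def eigenvector_def
  by (intro exI[of _ u]) auto

lemma quadratic_form_le_lam_max:
  assumes K: "K \<in> carrier_mat n n" "K\<^sup>T = K" and v: "v \<in> carrier_vec n"
  shows "scalar_prod v (K *\<^sub>v v) \<le> lam_max K * (vnorm v)\<^sup>2"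
proof (cases "n = 0")
  case True
  then show ?thesis using K v by (simp add: vnorm_square scalar_prod_def)
next
  case False
  then have n: "0 < n" by simp
  obtain u l where u: "u \<in> carrier_vec n" "vnorm u = 1" "K *\<^sub>v u = l \<cdot>\<^sub>v u"
    and b: "\<And>v. v \<in> carrier_vec n \<Longrightarrow> scalar_prod v (K *\<^sub>v v) \<le> l * (vnorm v)\<^sup>2"
    by (rule rayleigh_max[OF K n]) (rule that)
  have "l \<le> lam_max K"
    unfolding lam_max_def using finite_eigenvalues[OF K(1)] eigenvalueI[OF K(1) u(1-3)]
    by (intro Max_ge) auto
  then have "l * (vnorm v)\<^sup>2 \<le> lam_max K * (vnorm v)\<^sup>2" by (intro mult_right_mono) auto
  then show ?thesis using b[OF v] by linarith
qed

lemma eigenvalue_quadratic_form: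
  assumes K: "K \<in> carrier_mat n n" and ev: "eigenvalue K l"
  obtains v where "v \<in> carrier_vec n" "vnorm v > 0" "scalar_prod v (K *\<^sub>v v) = l * (vnorm v)\<^sup>2"
proof -
  obtain v where v: "v \<in> carrier_vec n" "v \<noteq> 0\<^sub>v n" "K *\<^sub>v v = l \<cdot>\<^sub>v v"
    using ev K unfolding eigenvalue_def eigenvector_def by auto
  have "vnorm v > 0" using vnorm_eq_0_iff[OF v(1)] v(2) vnorm_nonneg[of v] by linarith
  moreover have "scalar_prod v (K *\<^sub>v v) = l * (vnorm v)\<^sup>2" using v by (simp add: vnorm_square)
  ultimately show thesis using that v(1) by blast
qed

lemma eigenvalues_nonempty:
  assumes K: "K \<in> carrier_mat n n" "K\<^sup>T = K" and n: "0 < n"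
  shows "{k :: real. eigenvalue K k} \<noteq> {}"
proof -
  obtain u l where u: "u \<in> carrier_vec n" "vnorm u = 1" "K *\<^sub>v u = l \<cdot>\<^sub>v u"
    by (rule rayleigh_max[OF K n]) (rule that)
  have "l \<in> {k. eigenvalue K k}" using eigenvalueI[OF K(1) u] by simp
  then show ?thesis by (intro notI) (simp only: empty_iff)
qed

lemma lam_max_le:
  assumes K: "K \<in> carrier_mat n n" "K\<^sup>T = K" and n: "0 < n"
    and b: "\<And>v. v \<in> carrier_vec n \<Longrightarrow> scalar_prod v (K *\<^sub>v v) \<le> b * (vnorm v)\<^sup>2"
  shows "lam_max K \<le> b"
proof -
  have "l \<le> b" if ev: "eigenvalue K l" for l
  proof -
    obtain v where "v \<in> carrier_vec n" "vnorm v > 0" "scalar_prod v (K *\<^sub>v v) = l * (vnorm v)\<^sup>2"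
      using eigenvalue_quadratic_form[OF K(1) ev] .
    then show ?thesis using b[of v] by simp
  qed
  then show ?thesis
    unfolding lam_max_def using finite_eigenvalues[OF K(1)] eigenvalues_nonempty[OF K n] by auto
qed

lemma le_lam_min:
  assumes K: "K \<in> carrier_mat n n" "K\<^sup>T = K" and n: "0 < n"
    and b: "\<And>v. v \<in> carrier_vec n \<Longrightarrow> b * (vnorm v)\<^sup>2 \<le> scalar_prod v (K *\<^sub>v v)"
  shows "b \<le> lam_min K"
proof -
  have "b \<le> l" if ev: "eigenvalue K l" for l
  proof -
    obtain v where "v \<in> carrier_vec n" "vnorm v > 0" "scalar_prod v (K *\<^sub>v v) = l * (vnorm v)\<^sup>2"
      using eigenvalue_quadratic_form[OF K(1) ev] .
    then show ?thesis using b[of v] by simp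
  qed
  then show ?thesis
    unfolding lam_min_def using finite_eigenvalues[OF K(1)] eigenvalues_nonempty[OF K n] by auto
qed

text \<open>The smallest eigenvalue of \<open>K\<close> is minus the largest one of \<open>- K\<close>.\<close>
lemma lam_min_quadratic_form_le:
  assumes K: "K \<in> carrier_mat n n" "K\<^sup>T = K" and v: "v \<in> carrier_vec n"
  shows "lam_min K * (vnorm v)\<^sup>2 \<le> scalar_prod v (K *\<^sub>v v)"
proof (cases "n = 0")
  case True
  then show ?thesis using K v by (simp add: vnorm_square scalar_prod_def)
next
  case False
  then have n: "0 < n" by simp
  have mv: "(- K) *\<^sub>v x = - (K *\<^sub>v x)" if "x \<in> carrier_vec n" for x
    using K(1) that by (simp add: uminus_mult_mat_vec)
  have mK: "- K \<in> carrier_mat n n" "(- K)\<^sup>T = - K"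
    using K by (auto simp: transpose_uminus)
  obtain u l where u: "u \<in> carrier_vec n" "vnorm u = 1" "(- K) *\<^sub>v u = l \<cdot>\<^sub>v u"
    and b: "\<And>v. v \<in> carrier_vec n \<Longrightarrow> scalar_prod v ((- K) *\<^sub>v v) \<le> l * (vnorm v)\<^sup>2"
    by (rule rayleigh_max[OF mK n]) (rule that)
  have "- (- (K *\<^sub>v u)) = - (l \<cdot>\<^sub>v u)" using u(3) mv[OF u(1)] by simp
  then have "K *\<^sub>v u = (- l) \<cdot>\<^sub>v u" using u(1) by (auto simp: vec_eq_iff)
  then have "lam_min K \<le> - l"
    unfolding lam_min_def using finite_eigenvalues[OF K(1)] eigenvalueI[OF K(1) u(1,2)]
    by (intro Min_le) auto
  then have "lam_min K * (vnorm v)\<^sup>2 \<le> (- l) * (vnorm v)\<^sup>2" by (intro mult_right_mono) auto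
  moreover have "scalar_prod v ((- K) *\<^sub>v v) = - scalar_prod v (K *\<^sub>v v)"
    using K(1) v by (simp add: mv[OF v] scalar_prod_uminus_right)
  ultimately show ?thesis using b[OF v] by linarith
qed

section \<open>Exponential stability of linear systems\<close>

lemma lin_solution_carrier: "lin_solution n F t1 \<xi> \<Longrightarrow> t \<ge> t1 \<Longrightarrow> \<xi> t \<in> carrier_vec n"
  by (simp add: lin_solution_def)

lemma lin_solution_deriv:
  "lin_solution n F t1 \<xi> \<Longrightarrow> t \<ge> t1 \<Longrightarrow> i < n \<Longrightarrow>
    ((\<lambda>s. \<xi> s $ i) has_real_derivative (F t *\<^sub>v \<xi> t) $ i) (at t within {t1..})"
  by (simp add: lin_solution_def)

lemma lin_solution_restrict:
  assumes "lin_solution n F t1 \<xi>" "t1 \<le> t2"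
  shows "lin_solution n F t2 \<xi>"
  unfolding lin_solution_def
  using assms by (auto intro: lin_solution_carrier DERIV_subset[OF lin_solution_deriv])

lemma has_derivative_half_line_cong:
  fixes f g :: "real \<Rightarrow> real"
  assumes "(f has_real_derivative d) (at t within {t1..})" "t1 \<le> t" "\<And>s. t1 \<le> s \<Longrightarrow> f s = g s"
  shows "(g has_real_derivative d) (at t within {t1..})"
  using assms by (auto intro: has_field_derivative_transform_within[where d = 1])

lemma lin_solution_smult:
  assumes F: "\<And>t. t \<ge> t1 \<Longrightarrow> F t \<in> carrier_mat n n" and s: "lin_solution n F t1 \<xi>"
  shows "lin_solution n F t1 (\<lambda>t. c \<cdot>\<^sub>v \<xi> t)"
  unfolding lin_solution_def
proof (intro conjI allI impI)
  fix t i assume t: "t \<ge> t1" and i: "i < n"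
  have "((\<lambda>s. c * \<xi> s $ i) has_real_derivative c * (F t *\<^sub>v \<xi> t) $ i) (at t within {t1..})"
    by (rule DERIV_cmult[OF lin_solution_deriv[OF s t i]])
  moreover have "c * (F t *\<^sub>v \<xi> t) $ i = (F t *\<^sub>v (c \<cdot>\<^sub>v \<xi> t)) $ i"
    using F[OF t] lin_solution_carrier[OF s t] i by (subst mult_mat_vec) auto
  ultimately have "((\<lambda>s. c * \<xi> s $ i) has_real_derivative (F t *\<^sub>v (c \<cdot>\<^sub>v \<xi> t)) $ i) (at t within {t1..})"
    by simp
  then show "((\<lambda>s. (c \<cdot>\<^sub>v \<xi> s) $ i) has_real_derivative (F t *\<^sub>v (c \<cdot>\<^sub>v \<xi> t)) $ i) (at t within {t1..})"
    by (rule has_derivative_half_line_cong) (simp add: lin_solution_carrier[OF s, THEN carrier_vecD] i t)+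
qed (use lin_solution_carrier[OF s] in auto)

lemma lin_solution_diff:
  assumes F: "\<And>t. t \<ge> t1 \<Longrightarrow> F t \<in> carrier_mat n n"
    and s: "lin_solution n F t1 \<xi>" "lin_solution n F t1 \<zeta>"
  shows "lin_solution n F t1 (\<lambda>t. \<xi> t - \<zeta> t)"
  unfolding lin_solution_def
proof (intro conjI allI impI)
  fix t i assume t: "t \<ge> t1" and i: "i < n"
  have "((\<lambda>s. \<xi> s $ i - \<zeta> s $ i) has_real_derivative (F t *\<^sub>v \<xi> t) $ i - (F t *\<^sub>v \<zeta> t) $ i) (at t within {t1..})"
    by (rule DERIV_diff[OF lin_solution_deriv[OF s(1) t i] lin_solution_deriv[OF s(2) t i]])
  moreover have "(F t *\<^sub>v \<xi> t) $ i - (F t *\<^sub>v \<zeta> t) $ i = (F t *\<^sub>v (\<xi> t - \<zeta> t)) $ i"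
    using F[OF t] lin_solution_carrier[OF s(1) t] lin_solution_carrier[OF s(2) t] i
    by (subst mult_minus_distrib_mat_vec) auto
  ultimately have "((\<lambda>s. \<xi> s $ i - \<zeta> s $ i) has_real_derivative (F t *\<^sub>v (\<xi> t - \<zeta> t)) $ i) (at t within {t1..})"
    by simp
  then show "((\<lambda>s. (\<xi> s - \<zeta> s) $ i) has_real_derivative (F t *\<^sub>v (\<xi> t - \<zeta> t)) $ i) (at t within {t1..})"
    by (rule has_derivative_half_line_cong)
      (simp add: lin_solution_carrier[OF s(2), THEN carrier_vecD] i t)+
qed (use lin_solution_carrier[OF s(1)] lin_solution_carrier[OF s(2)] in auto)

lemma deriv_vnorm_square:
  assumes F: "\<And>t. t \<ge> t1 \<Longrightarrow> F t \<in> carrier_mat n n" and s: "lin_solution n F t1 \<xi>" and t: "t \<ge> t1"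
  shows "((\<lambda>s. (vnorm (\<xi> s))\<^sup>2) has_real_derivative 2 * scalar_prod (\<xi> t) (F t *\<^sub>v \<xi> t)) (at t within {t1..})"
proof -
  have sq: "(vnorm (\<xi> s))\<^sup>2 = (\<Sum>i<n. (\<xi> s $ i)\<^sup>2)" if "s \<ge> t1" for s
    using lin_solution_carrier[OF s that]
    by (simp add: vnorm_eq_L2_set[of _ n] L2_set_def sum_nonneg)
  have "((\<lambda>s. \<Sum>i<n. (\<xi> s $ i)\<^sup>2) has_real_derivative (\<Sum>i<n. 2 * (\<xi> t $ i * (F t *\<^sub>v \<xi> t) $ i))) (at t within {t1..})"
    by (intro DERIV_sum) (auto intro!: derivative_eq_intros lin_solution_deriv[OF s t])
  moreover have "(\<Sum>i<n. 2 * (\<xi> t $ i * (F t *\<^sub>v \<xi> t) $ i)) = 2 * scalar_prod (\<xi> t) (F t *\<^sub>v \<xi> t)"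
    using F[OF t] lin_solution_carrier[OF s t]
    by (simp add: scalar_prod_def lessThan_atLeast0 sum_distrib_left)
  ultimately have "((\<lambda>s. \<Sum>i<n. (\<xi> s $ i)\<^sup>2) has_real_derivative 2 * scalar_prod (\<xi> t) (F t *\<^sub>v \<xi> t)) (at t within {t1..})"
    by simp
  then show ?thesis by (rule has_derivative_half_line_cong[OF _ t]) (simp add: sq)
qed

lemma nondecreasing_on_half_line:
  fixes f :: "real \<Rightarrow> real"
  assumes d: "\<And>s. s \<ge> t1 \<Longrightarrow> (f has_real_derivative f' s) (at s within {t1..})"
    and nonneg: "\<And>s. s \<ge> t1 \<Longrightarrow> 0 \<le> f' s" and t: "t1 \<le> t"
  shows "f t1 \<le> f t"
proof (rule DERIV_nonneg_imp_increasing_open[OF t])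
  fix s assume s: "t1 < s" "s < t"
  then have "at s within {t1..} = at s" by (intro at_within_interior) auto
  then show "\<exists>y. DERIV f s :> y \<and> 0 \<le> y" using d[of s] nonneg[of s] s by auto
next
  have "continuous_on {t1..} f" using d by (intro DERIV_continuous_on) auto
  then show "continuous_on {t1..t} f" by (rule continuous_on_subset) auto
qed

text \<open>Gronwall's estimate from below: a system with bounded coefficients cannot decay faster than
  a fixed exponential.\<close>
lemma lin_solution_lower_bound:
  assumes F: "\<And>t. t \<ge> t1 \<Longrightarrow> F t \<in> carrier_mat n n" and b: "\<And>t. t \<ge> t1 \<Longrightarrow> mnorm (F t) \<le> b"
    and s: "lin_solution n F t1 \<xi>" and t: "t \<ge> t1"
  shows "exp (- 2 * b * (t - t1)) * (vnorm (\<xi> t1))\<^sup>2 \<le> (vnorm (\<xi> t))\<^sup>2"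
proof -
  let ?w = "\<lambda>s. (vnorm (\<xi> s))\<^sup>2"
  let ?h = "\<lambda>s. exp (2 * b * (s - t1)) * ?w s"
  let ?h' = "\<lambda>s. exp (2 * b * (s - t1)) * (2 * b * ?w s + 2 * scalar_prod (\<xi> s) (F s *\<^sub>v \<xi> s))"
  have "?h t1 \<le> ?h t"
  proof (rule nondecreasing_on_half_line[where f = ?h and f' = ?h'])
    fix s assume st: "s \<ge> t1"
    show "(?h has_real_derivative ?h' s) (at s within {t1..})"
      by (rule DERIV_cong, rule DERIV_mult[OF _ deriv_vnorm_square[OF F s st]])
        (auto intro!: derivative_eq_intros simp: algebra_simps)
    have c: "\<xi> s \<in> carrier_vec n" "F s *\<^sub>v \<xi> s \<in> carrier_vec n"
      using F[OF st] lin_solution_carrier[OF s st] by auto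
    have "\<bar>scalar_prod (\<xi> s) (F s *\<^sub>v \<xi> s)\<bar> \<le> vnorm (\<xi> s) * vnorm (F s *\<^sub>v \<xi> s)"
      by (rule abs_scalar_prod_le_vnorm[OF c])
    also have "\<dots> \<le> vnorm (\<xi> s) * (b * vnorm (\<xi> s))"
      using vnorm_mult_mat_vec_le[OF F[OF st] c(1)] mult_right_mono[OF b[OF st], of "vnorm (\<xi> s)"]
      by (intro mult_left_mono) auto
    finally have "\<bar>scalar_prod (\<xi> s) (F s *\<^sub>v \<xi> s)\<bar> \<le> b * ?w s"
      by (simp add: power2_eq_square algebra_simps)
    then show "0 \<le> ?h' s" by (intro mult_nonneg_nonneg) auto
  qed (rule t)
  then have "?w t1 \<le> exp (2 * b * (t - t1)) * ?w t" by simp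
  then have "exp (- (2 * b * (t - t1))) * ?w t1
      \<le> exp (- (2 * b * (t - t1))) * (exp (2 * b * (t - t1)) * ?w t)"
    by (rule mult_left_mono) simp
  also have "\<dots> = ?w t" by (simp add: mult.assoc[symmetric] exp_add[symmetric])
  finally show ?thesis by simp
qed

text \<open>A threshold for small initial values is a norm bound for all of them: rescale the initial value
  to norm \<open>\<delta> / 2\<close>. For the initial value \<open>0\<close> every rescaling is admissible, so the solution vanishes.\<close>
lemma lin_solution_homogeneous_bound:
  assumes F: "\<And>t. t \<ge> t1 \<Longrightarrow> F t \<in> carrier_mat n n"
    and bound: "\<And>\<xi>. lin_solution n F t1 \<xi> \<Longrightarrow> vnorm (\<xi> t1) < \<delta> \<Longrightarrow> vnorm (\<xi> t) < \<eta>"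
    and pos: "\<delta> > 0" and s: "lin_solution n F t1 \<xi>"
  shows "vnorm (\<xi> t) \<le> 2 * \<eta> / \<delta> * vnorm (\<xi> t1)"
proof -
  have scaled: "\<bar>c\<bar> * vnorm (\<xi> t) < \<eta>" if "\<bar>c\<bar> * vnorm (\<xi> t1) < \<delta>" for c
    using bound[OF lin_solution_smult[OF F s, of c]] that by (simp add: vnorm_smult)
  show ?thesis
  proof (cases "vnorm (\<xi> t1) = 0")
    case True
    have "vnorm (\<xi> t) = 0"
    proof (rule ccontr)
      assume "vnorm (\<xi> t) \<noteq> 0"
      then have "vnorm (\<xi> t) > 0" using vnorm_nonneg[of "\<xi> t"] by linarith
      moreover from this have "\<eta> > 0" using scaled[of 1] True pos by simp
      ultimately show False using scaled[of "\<eta> / vnorm (\<xi> t)"] True pos by simp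
    qed
    then show ?thesis using True by simp
  next
    case False
    then have r: "vnorm (\<xi> t1) > 0" using vnorm_nonneg[of "\<xi> t1"] by linarith
    have "\<bar>\<delta> / (2 * vnorm (\<xi> t1))\<bar> * vnorm (\<xi> t) < \<eta>" by (rule scaled) (use r pos in simp)
    then show ?thesis using r pos by (simp add: field_simps)
  qed
qed

text \<open>By linearity the two halves of uniform asymptotic stability become norm bounds on the flow:
  it never amplifies by more than a constant, and over a fixed time span it contracts by one half.
  Iterating the contraction gives an exponential rate.\<close>
lemma uniformly_asymptotically_stable_exponential:
  assumes F: "\<And>t. t \<ge> t0 \<Longrightarrow> F t \<in> carrier_mat n n"
    and uas: "uniformly_asymptotically_stable t0 n F"
  obtains K g where "K > 0" "g > 0"
    "\<And>t1 t \<xi>. t0 \<le> t1 \<Longrightarrow> t1 \<le> t \<Longrightarrow> lin_solution n F t1 \<xi> \<Longrightarrow>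
       vnorm (\<xi> t) \<le> K * exp (- g * (t - t1)) * vnorm (\<xi> t1)"
proof -
  obtain \<delta> where \<delta>: "\<delta> > 0" "\<And>t1 t \<xi>. t1 \<ge> t0 \<Longrightarrow> t \<ge> t1 \<Longrightarrow> lin_solution n F t1 \<xi> \<Longrightarrow>
      vnorm (\<xi> t1) < \<delta> \<Longrightarrow> vnorm (\<xi> t) < 1"
    using uas[unfolded uniformly_asymptotically_stable_def, THEN conjunct1, rule_format, of 1] by auto
  obtain c where c: "c > 0" and att: "\<And>\<eta>. \<eta> > 0 \<Longrightarrow> \<exists>T\<ge>0. \<forall>t1\<ge>t0. \<forall>\<xi>. lin_solution n F t1 \<xi> \<and> vnorm (\<xi> t1) < c \<longrightarrow>
        (\<forall>t\<ge>t1 + T. vnorm (\<xi> t) < \<eta>)"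
    using uas[unfolded uniformly_asymptotically_stable_def, THEN conjunct2] by auto
  \<comment> \<open>the level \<open>c / 4\<close> turns the factor \<open>2 \<eta> / c\<close> of the homogeneous bound into \<open>1 / 2\<close>\<close>
  obtain T0 where T0: "T0 \<ge> 0" "\<And>t1 t \<xi>. t1 \<ge> t0 \<Longrightarrow> t \<ge> t1 + T0 \<Longrightarrow> lin_solution n F t1 \<xi> \<Longrightarrow>
      vnorm (\<xi> t1) < c \<Longrightarrow> vnorm (\<xi> t) < c / 4"
    using att[of "c / 4"] c by auto
  \<comment> \<open>a strictly longer span, as \<open>T0\<close> may be \<open>0\<close> and the rate is \<open>ln 2 / T\<close>\<close>
  define T where "T = T0 + 1"
  have T: "T > 0" using T0(1) by (simp add: T_def)
  have F1: "F t \<in> carrier_mat n n" if "t0 \<le> t1" "t1 \<le> t" for t1 t using F that by simp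
  have bounded: "vnorm (\<xi> t) \<le> 2 / \<delta> * vnorm (\<xi> t1)"
    if "t0 \<le> t1" "t1 \<le> t" "lin_solution n F t1 \<xi>" for t1 t \<xi>
    using lin_solution_homogeneous_bound[OF F1[OF that(1)] \<delta>(2)[OF that(1,2)] \<delta>(1) that(3)] by simp
  have contract: "vnorm (\<xi> (t1 + T)) \<le> 1 / 2 * vnorm (\<xi> t1)"
    if "t0 \<le> t1" "lin_solution n F t1 \<xi>" for t1 \<xi>
    using lin_solution_homogeneous_bound[OF F1[OF that(1)] T0(2)[OF that(1), of "t1 + T"] c that(2)] c
    by (simp add: T_def)
  have iterate: "vnorm (\<xi> (t1 + real k * T)) \<le> (1 / 2) ^ k * vnorm (\<xi> t1)"
    if "t0 \<le> t1" "lin_solution n F t1 \<xi>" for t1 \<xi> k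
  proof (induction k)
    case (Suc k)
    have k: "0 \<le> real k * T" using T by simp
    have "vnorm (\<xi> (t1 + real k * T + T)) \<le> 1 / 2 * vnorm (\<xi> (t1 + real k * T))"
      using k that by (intro contract lin_solution_restrict[OF that(2)]) auto
    then show ?case using Suc.IH by (simp add: algebra_simps)
  qed simp
  define g where "g = ln 2 / T"
  show thesis
  proof (rule that[of "4 / \<delta>" g])
    show "4 / \<delta> > 0" using \<delta>(1) by simp
    show "g > 0" using T by (simp add: g_def)
    fix t1 t :: real and \<xi> assume t: "t0 \<le> t1" "t1 \<le> t" and s: "lin_solution n F t1 \<xi>"
    \<comment> \<open>\<open>k\<close> full contraction spans fit before \<open>t\<close>; the incomplete last one costs a factor \<open>2\<close>\<close>
    define k where "k = nat \<lfloor>(t - t1) / T\<rfloor>"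
    have q: "0 \<le> (t - t1) / T" using t T by simp
    then have k: "real k \<le> (t - t1) / T" "(t - t1) / T < real k + 1" unfolding k_def by linarith+
    then have kT: "t1 + real k * T \<le> t" using T by (simp add: field_simps)
    have k0: "0 \<le> real k * T" using T by simp
    have "vnorm (\<xi> t) \<le> 2 / \<delta> * vnorm (\<xi> (t1 + real k * T))"
      using k0 t kT by (intro bounded lin_solution_restrict[OF s]) auto
    also have "\<dots> \<le> 2 / \<delta> * ((1 / 2) ^ k * vnorm (\<xi> t1))"
      using \<delta>(1) by (intro mult_left_mono iterate t s) auto
    also have "(1 / 2) ^ k = exp (- (ln 2 * real k))"
      by (simp add: exp_minus exp_of_nat2_mult mult.commute[of "ln 2"] exp_of_nat_mult power_one_over inverse_eq_divide)
    also have "2 / \<delta> * (exp (- (ln 2 * real k)) * vnorm (\<xi> t1))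
        \<le> 2 / \<delta> * (2 * exp (- g * (t - t1)) * vnorm (\<xi> t1))"
    proof (intro mult_left_mono mult_right_mono)
      have "ln 2 * ((t - t1) / T) \<le> ln 2 * (real k + 1)" using k(2) by (intro mult_left_mono) auto
      then have "- (ln 2 * real k) \<le> ln 2 + (- g * (t - t1))" by (simp add: g_def algebra_simps)
      then have "exp (- (ln 2 * real k)) \<le> exp (ln 2 + (- g * (t - t1)))" by simp
      then show "exp (- (ln 2 * real k)) \<le> 2 * exp (- g * (t - t1))" unfolding exp_add by simp
    qed (use \<delta>(1) in auto)
    finally show "vnorm (\<xi> t) \<le> 4 / \<delta> * exp (- g * (t - t1)) * vnorm (\<xi> t1)" by simp
  qed
qed

text \<open>Uniqueness comes for free from stability: the difference of two solutions with the same
  initial value is bounded by a multiple of \<open>0\<close>.\<close>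
lemma lin_solution_unique:
  assumes F: "\<And>t. t \<ge> t0 \<Longrightarrow> F t \<in> carrier_mat n n"
    and uas: "uniformly_asymptotically_stable t0 n F"
    and s: "lin_solution n F t1 \<xi>" "lin_solution n F t1 \<zeta>" and eq: "\<xi> t1 = \<zeta> t1"
    and t: "t0 \<le> t1" "t1 \<le> t"
  shows "\<xi> t = \<zeta> t"
proof -
  obtain K g where K: "\<And>t1 t \<xi>. t0 \<le> t1 \<Longrightarrow> t1 \<le> t \<Longrightarrow> lin_solution n F t1 \<xi> \<Longrightarrow>
       vnorm (\<xi> t) \<le> K * exp (- g * (t - t1)) * vnorm (\<xi> t1)"
    using uniformly_asymptotically_stable_exponential[OF F uas] by metis
  have c: "\<xi> t \<in> carrier_vec n" "\<zeta> t \<in> carrier_vec n" "\<zeta> t1 \<in> carrier_vec n"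
    using s t lin_solution_carrier by auto
  have "lin_solution n F t1 (\<lambda>t. \<xi> t - \<zeta> t)"
    using F t by (intro lin_solution_diff s) auto
  from K[OF t this] have "vnorm (\<xi> t - \<zeta> t) = 0"
    using c eq vnorm_nonneg[of "\<xi> t - \<zeta> t"] by simp
  then have "\<xi> t - \<zeta> t = 0\<^sub>v n" using c by (subst (asm) vnorm_eq_0_iff[of _ n]) auto
  then show ?thesis using c by (auto simp: vec_eq_iff)
qed

section \<open>The stability Gramian and the decay rate it certifies\<close>

lemma exp_decay_set_integrable:
  fixes c t :: real
  assumes "c > 0"
  shows "set_integrable lborel {t..} (\<lambda>s. exp (- c * (s - t)))"
    and "(LINT s:{t..}|lborel. exp (- c * (s - t))) = 1 / c"
proof -
  have "((\<lambda>s. exp (c * t) * exp (- c * s)) has_integral exp (c * t) * (exp (- c * t) / c)) {t..}"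
    by (intro has_integral_mult_right has_integral_exp_minus_to_infinity assms)
  moreover have "exp (c * t) * exp (- c * s) = exp (- c * (s - t))" for s
    by (simp add: exp_add[symmetric] algebra_simps)
  moreover have "exp (c * t) * (exp (- c * t) / c) = 1 / c"
    by (simp add: exp_add[symmetric])
  ultimately have hk: "((\<lambda>s. exp (- c * (s - t))) has_integral 1 / c) {t..}" by simp
  then have "(\<lambda>s. exp (- c * (s - t))) absolutely_integrable_on {t..}"
    by (intro nonnegative_absolutely_integrable_1) (auto simp: integrable_on_def)
  then show int: "set_integrable lborel {t..} (\<lambda>s. exp (- c * (s - t)))"
    unfolding set_integrable_def
    by (subst (asm) integrable_completion)
      (auto intro!: borel_measurable_continuous_on_indicator continuous_intros)
  show "(LINT s:{t..}|lborel. exp (- c * (s - t))) = 1 / c"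
    using set_borel_integral_eq_integral(2)[OF int] hk by (simp add: integral_unique)
qed

lemma exp_bounded_set_integrable:
  fixes f :: "real \<Rightarrow> real"
  assumes c: "c > 0" and f: "continuous_on {t..} f"
    and b: "\<And>s. t \<le> s \<Longrightarrow> \<bar>f s\<bar> \<le> a * exp (- c * (s - t))"
  shows "set_integrable lborel {t..} f"
proof (rule set_integrable_bound)
  show "set_integrable lborel {t..} (\<lambda>s. a * exp (- c * (s - t)))"
    by (intro set_integrable_mult_right) (use exp_decay_set_integrable(1)[OF c] in simp)
  show "set_borel_measurable lborel {t..} f"
    unfolding set_borel_measurable_def using borel_measurable_continuous_on_indicator[OF _ f] by simp
  show "AE s in lborel. s \<in> {t..} \<longrightarrow> norm (f s) \<le> norm (a * exp (- c * (s - t)))"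
    using b by (auto intro: order_trans[OF _ abs_ge_self])
qed

lemma tendsto_integral_half_line:
  fixes f :: "real \<Rightarrow> real"
  assumes "set_integrable lborel {t..} f"
  shows "((\<lambda>T. integral {t..T} f) \<longlongrightarrow> (LINT s:{t..}|lborel. f s)) at_top"
proof -
  have "(LINT s:{t..T}|lborel. f s) = integral {t..T} f" for T
    by (rule set_borel_integral_eq_integral(2)[OF set_integrable_subset[OF assms]]) auto
  then show ?thesis
    using tendsto_set_lebesgue_integral_at_top[OF _ assms] by simp
qed

lemma deriv_integral_half_line:
  fixes f :: "real \<Rightarrow> real"
  assumes f: "continuous_on {t0..} f" and t: "t0 \<le> t"
  shows "((\<lambda>x. integral {t0..x} f) has_real_derivative f t) (at t within {t0..})"
proof -
  have "((\<lambda>x. integral {t0..x} f) has_real_derivative f t) (at t within {t0..t + 1})"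
    using t by (intro integral_has_real_derivative continuous_on_subset[OF f]) auto
  moreover have "at t within {t0..t + 1} = at t within {t0..}"
    by (rule at_within_nhd[of t "{..<t + 1}"]) auto
  ultimately show ?thesis by simp
qed

lemma exp_double_rate:
  fixes g :: real
  shows "exp (- (2 * g * x)) = exp (- (g * x)) * exp (- (g * x))"
  by (simp add: exp_add[symmetric])

lemma mult_mat_unit_vec:
  assumes "A \<in> carrier_mat k m" "j < m"
  shows "A *\<^sub>v unit_vec m j = (col A j :: real vec)"
  using assms by (intro eq_vecI) auto

lemma scalar_prod_transpose_mult:
  assumes A: "(A :: real mat) \<in> carrier_mat n n" and v: "v \<in> carrier_vec n"
  shows "scalar_prod v ((A\<^sup>T * A) *\<^sub>v v) = (vnorm (A *\<^sub>v v))\<^sup>2"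
proof -
  have Av: "A *\<^sub>v v \<in> carrier_vec n" using A v by simp
  have "scalar_prod v ((A\<^sup>T * A) *\<^sub>v v) = scalar_prod v (A\<^sup>T *\<^sub>v (A *\<^sub>v v))"
    using A v by (subst assoc_mult_mat_vec[of _ n n]) auto
  also have "\<dots> = scalar_prod (A\<^sup>T *\<^sub>v (A *\<^sub>v v)) v"
    using A v Av by (intro comm_scalar_prod[of _ n]) auto
  also have "\<dots> = scalar_prod (A *\<^sub>v v) (A *\<^sub>v v)"
    by (rule transpose_vec_mult_scalar[OF A v Av])
  finally show ?thesis by (simp add: vnorm_square)
qed

locale stable_system =
  fixes t0 :: real and n :: nat and F :: "real \<Rightarrow> real mat" and \<Phi> :: "real \<Rightarrow> real \<Rightarrow> real mat"
  assumes n_pos: "0 < n"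
    and F_carrier: "\<And>t. t \<ge> t0 \<Longrightarrow> F t \<in> carrier_mat n n"
    and stable: "uniformly_asymptotically_stable t0 n F"
    and transition: "is_transition_matrix t0 n F \<Phi>"
begin

lemma transition_carrier: "t \<ge> t0 \<Longrightarrow> s \<ge> t0 \<Longrightarrow> \<Phi> s t \<in> carrier_mat n n"
  using transition unfolding is_transition_matrix_def mat_has_deriv_def by auto

lemma transition_refl: "t \<ge> t0 \<Longrightarrow> \<Phi> t t = 1\<^sub>m n"
  using transition unfolding is_transition_matrix_def by auto

lemma transition_cont: "t \<ge> t0 \<Longrightarrow> cont_mat t0 n n (\<lambda>s. \<Phi> s t)"
  using transition unfolding is_transition_matrix_def by (auto intro: cont_mat_has_deriv)

lemma transition_solution:
  assumes t: "t \<ge> t0" and v: "v \<in> carrier_vec n"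
  shows "lin_solution n F t (\<lambda>s. \<Phi> s t *\<^sub>v v)"
  unfolding lin_solution_def
proof (intro conjI allI impI)
  show "\<Phi> s t *\<^sub>v v \<in> carrier_vec n" if "s \<ge> t" for s
    using transition_carrier[OF t, of s] that t v by auto
  fix s i assume s: "s \<ge> t" and i: "i < n"
  have s0: "s \<ge> t0" using s t by simp
  have c: "F s \<in> carrier_mat n n" "\<Phi> s t \<in> carrier_mat n n"
    using F_carrier[OF s0] transition_carrier[OF t s0] by auto
  have entry: "((\<lambda>s. \<Phi> s t $$ (i, j)) has_real_derivative (F s * \<Phi> s t) $$ (i, j)) (at s within {t..})"
    if "j < n" for j
  proof (rule DERIV_subset)
    show "((\<lambda>s. \<Phi> s t $$ (i, j)) has_real_derivative (F s * \<Phi> s t) $$ (i, j)) (at s within {t0..})"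
      using transition t s0 i that unfolding is_transition_matrix_def mat_has_deriv_def by blast
  qed (use t in auto)
  have "((\<lambda>s. \<Sum>j<n. \<Phi> s t $$ (i, j) * v $ j) has_real_derivative
      (\<Sum>j<n. (F s * \<Phi> s t) $$ (i, j) * v $ j)) (at s within {t..})"
    by (intro DERIV_sum DERIV_cmult_right entry) auto
  moreover have "(\<Sum>j<n. (F s * \<Phi> s t) $$ (i, j) * v $ j) = (F s *\<^sub>v (\<Phi> s t *\<^sub>v v)) $ i"
    using c v i by (subst index_mult_mat_vec_sum[symmetric, of _ n n]) (auto simp: assoc_mult_mat_vec[of _ n n])
  ultimately have "((\<lambda>s. \<Sum>j<n. \<Phi> s t $$ (i, j) * v $ j) has_real_derivative
      (F s *\<^sub>v (\<Phi> s t *\<^sub>v v)) $ i) (at s within {t..})" by simp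
  then show "((\<lambda>s. (\<Phi> s t *\<^sub>v v) $ i) has_real_derivative (F s *\<^sub>v (\<Phi> s t *\<^sub>v v)) $ i) (at s within {t..})"
  proof (rule has_derivative_half_line_cong[OF _ s])
    fix r assume "t \<le> r"
    then show "(\<Sum>j<n. \<Phi> r t $$ (i, j) * v $ j) = (\<Phi> r t *\<^sub>v v) $ i"
      using transition_carrier[OF t, of r] t v i by (subst index_mult_mat_vec_sum[of _ n n]) auto
  qed
qed

lemma flow_decay:
  obtains K g where "K > 0" "g > 0"
    "\<And>t s v. t0 \<le> t \<Longrightarrow> t \<le> s \<Longrightarrow> v \<in> carrier_vec n \<Longrightarrow>
      vnorm (\<Phi> s t *\<^sub>v v) \<le> K * exp (- g * (s - t)) * vnorm v"
proof -
  obtain K g where K: "K > 0" "g > 0"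
    and b: "\<And>t1 t \<xi>. t0 \<le> t1 \<Longrightarrow> t1 \<le> t \<Longrightarrow> lin_solution n F t1 \<xi> \<Longrightarrow>
       vnorm (\<xi> t) \<le> K * exp (- g * (t - t1)) * vnorm (\<xi> t1)"
    by (rule uniformly_asymptotically_stable_exponential[OF F_carrier stable]) (auto intro: that)
  show thesis
  proof (rule that[OF K])
    fix t s :: real and v :: "real vec" assume a: "t0 \<le> t" "t \<le> s" "v \<in> carrier_vec n"
    show "vnorm (\<Phi> s t *\<^sub>v v) \<le> K * exp (- g * (s - t)) * vnorm v"
      using b[OF a(1,2) transition_solution[OF a(1,3)]] transition_refl[OF a(1)] a(3) by simp
  qed
qed

abbreviation gram_entry :: "real \<Rightarrow> nat \<Rightarrow> nat \<Rightarrow> real \<Rightarrow> real" where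
  "gram_entry t i j s \<equiv> ((\<Phi> s t)\<^sup>T * \<Phi> s t) $$ (i, j)"

text \<open>An entry of the integrand is the scalar product of two columns of the transition matrix, which
  are trajectories; so it decays at twice the rate of the flow.\<close>
lemma gram_entry_integrable:
  assumes t: "t0 \<le> t" and ij: "i < n" "j < n"
  shows "set_integrable lborel {t..} (gram_entry t i j)"
proof -
  obtain K g where K: "K > 0" "g > 0"
    and b: "\<And>t s v. t0 \<le> t \<Longrightarrow> t \<le> s \<Longrightarrow> v \<in> carrier_vec n \<Longrightarrow>
      vnorm (\<Phi> s t *\<^sub>v v) \<le> K * exp (- g * (s - t)) * vnorm v"
    by (rule flow_decay) (rule that)
  let ?U = "\<lambda>k. vnorm (unit_vec n k)"
  show ?thesis
  proof (rule exp_bounded_set_integrable)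
    show "2 * g > 0" using K by simp
    have "cont_mat t0 n n (\<lambda>s. (\<Phi> s t)\<^sup>T * \<Phi> s t)"
      using transition_cont[OF t] by (intro cont_mat_mult cont_mat_transpose)
    then show "continuous_on {t..} (gram_entry t i j)"
      using ij t by (intro continuous_on_subset[OF cont_matD]) auto
    fix s assume s: "t \<le> s"
    have P: "\<Phi> s t \<in> carrier_mat n n" using transition_carrier[OF t] s t by auto
    have "gram_entry t i j s = scalar_prod (\<Phi> s t *\<^sub>v unit_vec n i) (\<Phi> s t *\<^sub>v unit_vec n j)"
      using P ij by (simp add: mult_mat_unit_vec[OF P])
    also have "\<bar>\<dots>\<bar> \<le> vnorm (\<Phi> s t *\<^sub>v unit_vec n i) * vnorm (\<Phi> s t *\<^sub>v unit_vec n j)"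
      using P by (intro abs_scalar_prod_le_vnorm[of _ n]) auto
    also have "\<dots> \<le> (K * exp (- g * (s - t)) * ?U i) * (K * exp (- g * (s - t)) * ?U j)"
      using K by (intro mult_mono b t s) auto
    also have "\<dots> = (K * K * ?U i * ?U j) * exp (- (2 * g) * (s - t))"
      by (simp add: exp_double_rate)
    finally show "\<bar>gram_entry t i j s\<bar> \<le> (K * K * ?U i * ?U j) * exp (- (2 * g) * (s - t))" .
  qed
qed

lemma gramian_tendsto_half_line:
  assumes t: "t0 \<le> t" and ij: "i < n" "j < n"
  shows "((\<lambda>T. gramian n \<Phi> t T $$ (i, j)) \<longlongrightarrow> (LINT s:{t..}|lborel. gram_entry t i j s)) at_top"
  using tendsto_integral_half_line[OF gram_entry_integrable[OF t ij]] ij by (simp add: gramian_def)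

lemma gramian_lim_index:
  assumes t: "t0 \<le> t" and ij: "i < n" "j < n"
  shows "gramian_lim n \<Phi> t $$ (i, j) = (LINT s:{t..}|lborel. gram_entry t i j s)"
  using tendsto_Lim[OF _ gramian_tendsto_half_line[OF t ij]] ij by (simp add: gramian_lim_def)

lemma gramian_lim_carrier: "gramian_lim n \<Phi> t \<in> carrier_mat n n"
  by (simp add: gramian_lim_def)

lemma gramian_lim_symmetric:
  assumes t: "t0 \<le> t"
  shows "(gramian_lim n \<Phi> t)\<^sup>T = gramian_lim n \<Phi> t"
proof (rule eq_matI)
  fix i j assume "i < dim_row (gramian_lim n \<Phi> t)" "j < dim_col (gramian_lim n \<Phi> t)"
  then have ij: "i < n" "j < n" by (auto simp: gramian_lim_def)
  have "gram_entry t j i s = gram_entry t i j s" if "s \<in> {t..}" for s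
  proof -
    have P: "\<Phi> s t \<in> carrier_mat n n" using transition_carrier[OF t] that t by auto
    then show ?thesis using ij by (auto intro: comm_scalar_prod[of _ n])
  qed
  then have "(LINT s:{t..}|lborel. gram_entry t j i s) = (LINT s:{t..}|lborel. gram_entry t i j s)"
    by (intro set_lebesgue_integral_cong) auto
  then show "(gramian_lim n \<Phi> t)\<^sup>T $$ (i, j) = gramian_lim n \<Phi> t $$ (i, j)"
    using gramian_lim_carrier[of t] ij by (simp add: gramian_lim_index[OF t])
qed (auto simp: gramian_lim_def)

text \<open>The Gramian measures the energy that a trajectory has yet to dissipate.\<close>
lemma gramian_quadratic_form:
  assumes t: "t0 \<le> t" and v: "v \<in> carrier_vec n"
  shows "set_integrable lborel {t..} (\<lambda>s. (vnorm (\<Phi> s t *\<^sub>v v))\<^sup>2)"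
    and "scalar_prod v (gramian_lim n \<Phi> t *\<^sub>v v) = (LINT s:{t..}|lborel. (vnorm (\<Phi> s t *\<^sub>v v))\<^sup>2)"
proof -
  let ?h = "\<lambda>s. \<Sum>i<n. \<Sum>j<n. v $ i * gram_entry t i j s * v $ j"
  have eq: "?h s = (vnorm (\<Phi> s t *\<^sub>v v))\<^sup>2" if "s \<in> {t..}" for s
  proof -
    have P: "\<Phi> s t \<in> carrier_mat n n" using transition_carrier[OF t] that t by auto
    then have "(\<Phi> s t)\<^sup>T * \<Phi> s t \<in> carrier_mat n n" by simp
    from quadratic_form_sum[OF this v] show ?thesis
      using scalar_prod_transpose_mult[OF P v] by simp
  qed
  have int: "set_integrable lborel {t..} (\<lambda>s. v $ i * gram_entry t i j s * v $ j)"
    if "i < n" "j < n" for i j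
    using gram_entry_integrable[OF t that] by (intro set_integrable_mult_left set_integrable_mult_right)
  have "set_integrable lborel {t..} ?h"
    unfolding set_integrable_def scaleR_sum_right
    by (intro Bochner_Integration.integrable_sum int[unfolded set_integrable_def]) auto
  then show "set_integrable lborel {t..} (\<lambda>s. (vnorm (\<Phi> s t *\<^sub>v v))\<^sup>2)"
    using eq by (subst (asm) set_integrable_cong[OF refl refl]) auto
  have "(LINT s:{t..}|lborel. (vnorm (\<Phi> s t *\<^sub>v v))\<^sup>2) = (LINT s:{t..}|lborel. ?h s)"
    using eq by (intro set_lebesgue_integral_cong) auto
  also have "\<dots> = (\<Sum>i<n. \<Sum>j<n. (LINT s:{t..}|lborel. v $ i * gram_entry t i j s * v $ j))"
  proof -
    have int': "integrable lborel (\<lambda>s. indicator {t..} s *\<^sub>R (v $ i * gram_entry t i j s * v $ j))"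
      if "i \<in> {..<n}" "j \<in> {..<n}" for i j
      using int[of i j] that by (simp only: set_integrable_def lessThan_iff)
    have "(LINT s:{t..}|lborel. ?h s)
        = (\<Sum>i<n. (LINT s|lborel. (\<Sum>j<n. indicator {t..} s *\<^sub>R (v $ i * gram_entry t i j s * v $ j))))"
      unfolding set_lebesgue_integral_def scaleR_sum_right
      by (intro Bochner_Integration.integral_sum Bochner_Integration.integrable_sum int')
    also have "\<dots> = (\<Sum>i<n. \<Sum>j<n. (LINT s:{t..}|lborel. v $ i * gram_entry t i j s * v $ j))"
      unfolding set_lebesgue_integral_def
      by (intro sum.cong refl Bochner_Integration.integral_sum int')
    finally show ?thesis .
  qed
  also have "\<dots> = (\<Sum>i<n. \<Sum>j<n. v $ i * gramian_lim n \<Phi> t $$ (i, j) * v $ j)"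
    by (intro sum.cong refl) (simp add: gramian_lim_index[OF t])
  also have "\<dots> = scalar_prod v (gramian_lim n \<Phi> t *\<^sub>v v)"
    by (rule quadratic_form_sum[OF gramian_lim_carrier v, symmetric])
  finally show "scalar_prod v (gramian_lim n \<Phi> t *\<^sub>v v) = (LINT s:{t..}|lborel. (vnorm (\<Phi> s t *\<^sub>v v))\<^sup>2)" ..
qed

lemma gramian_upper_bound:
  obtains a where "\<And>t v. t0 \<le> t \<Longrightarrow> v \<in> carrier_vec n \<Longrightarrow>
    scalar_prod v (gramian_lim n \<Phi> t *\<^sub>v v) \<le> a * (vnorm v)\<^sup>2"
proof -
  obtain K g where K: "K > 0" "g > 0"
    and b: "\<And>t s v. t0 \<le> t \<Longrightarrow> t \<le> s \<Longrightarrow> v \<in> carrier_vec n \<Longrightarrow>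
      vnorm (\<Phi> s t *\<^sub>v v) \<le> K * exp (- g * (s - t)) * vnorm v"
    by (rule flow_decay) (rule that)
  show thesis
  proof (rule that)
    fix t and v :: "real vec" assume t: "t0 \<le> t" and v: "v \<in> carrier_vec n"
    have g2: "2 * g > 0" using K by simp
    have "(LINT s:{t..}|lborel. (vnorm (\<Phi> s t *\<^sub>v v))\<^sup>2)
        \<le> (LINT s:{t..}|lborel. (K\<^sup>2 * (vnorm v)\<^sup>2) * exp (- (2 * g) * (s - t)))"
    proof (rule set_integral_mono)
      show "set_integrable lborel {t..} (\<lambda>s. (K\<^sup>2 * (vnorm v)\<^sup>2) * exp (- (2 * g) * (s - t)))"
        by (intro set_integrable_mult_right) (use exp_decay_set_integrable(1)[OF g2] in simp)
      fix s assume "s \<in> {t..}"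
      then have "(vnorm (\<Phi> s t *\<^sub>v v))\<^sup>2 \<le> (K * exp (- g * (s - t)) * vnorm v)\<^sup>2"
        using t v by (intro power_mono b) auto
      also have "\<dots> = (K\<^sup>2 * (vnorm v)\<^sup>2) * exp (- (2 * g) * (s - t))"
        by (simp add: power2_eq_square exp_double_rate)
      finally show "(vnorm (\<Phi> s t *\<^sub>v v))\<^sup>2 \<le> (K\<^sup>2 * (vnorm v)\<^sup>2) * exp (- (2 * g) * (s - t))" .
    qed (rule gramian_quadratic_form(1)[OF t v])
    also have "\<dots> = (K\<^sup>2 * (vnorm v)\<^sup>2) * (1 / (2 * g))"
      using exp_decay_set_integrable(2)[OF g2, of t] by simp
    finally show "scalar_prod v (gramian_lim n \<Phi> t *\<^sub>v v) \<le> K\<^sup>2 / (2 * g) * (vnorm v)\<^sup>2"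
      using gramian_quadratic_form(2)[OF t v] by simp
  qed
qed

lemma lam_max_gramian_bdd_above: "bdd_above ((\<lambda>t. lam_max (gramian_lim n \<Phi> t)) ` {t0..})"
proof -
  obtain a where a: "\<And>t v. t0 \<le> t \<Longrightarrow> v \<in> carrier_vec n \<Longrightarrow>
    scalar_prod v (gramian_lim n \<Phi> t *\<^sub>v v) \<le> a * (vnorm v)\<^sup>2"
    by (rule gramian_upper_bound) (rule that)
  show ?thesis
    by (rule bdd_aboveI2[of _ _ a])
      (auto intro!: lam_max_le[OF gramian_lim_carrier gramian_lim_symmetric n_pos] a)
qed

end

locale bounded_stable_system = stable_system +
  fixes b :: real
  assumes bound: "\<And>t. t0 \<le> t \<Longrightarrow> mnorm (F t) \<le> b"
begin

lemma bound_nonneg: "0 \<le> b"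
  using bound[OF order_refl] mnorm_nonneg[OF F_carrier[OF order_refl]] by linarith

text \<open>Over a unit of time a trajectory keeps at least a fixed fraction of its initial energy,
  so the Gramian is bounded away from \<open>0\<close>, uniformly in time.\<close>
lemma gramian_lower_bound:
  assumes t: "t0 \<le> t" and v: "v \<in> carrier_vec n"
  shows "exp (- 2 * b) * (vnorm v)\<^sup>2 \<le> scalar_prod v (gramian_lim n \<Phi> t *\<^sub>v v)"
proof -
  let ?w = "\<lambda>s. (vnorm (\<Phi> s t *\<^sub>v v))\<^sup>2"
  have "exp (- 2 * b) * (vnorm v)\<^sup>2 = (LINT s:{t..t + 1}|lborel. exp (- 2 * b) * (vnorm v)\<^sup>2)"
    by (simp add: set_lebesgue_integral_def)
  also have "\<dots> \<le> (LINT s:{t..t + 1}|lborel. ?w s)"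
  proof (rule set_integral_mono)
    show "set_integrable lborel {t..t + 1} (\<lambda>s. exp (- 2 * b) * (vnorm v)\<^sup>2)"
      by (intro borel_integrable_atLeastAtMost' continuous_intros)
    show "set_integrable lborel {t..t + 1} ?w"
      by (rule set_integrable_subset[OF gramian_quadratic_form(1)[OF t v]]) auto
    fix s assume s: "s \<in> {t..t + 1}"
    have "b * (s - t) \<le> b * 1" using s bound_nonneg by (intro mult_left_mono) auto
    then have "exp (- 2 * b) * (vnorm v)\<^sup>2 \<le> exp (- 2 * b * (s - t)) * (vnorm v)\<^sup>2"
      by (intro mult_right_mono) auto
    also have "\<dots> \<le> ?w s"
      using lin_solution_lower_bound[OF F_carrier bound transition_solution[OF t v], of s]
        transition_refl[OF t] s t v by auto
    finally show "exp (- 2 * b) * (vnorm v)\<^sup>2 \<le> ?w s" .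
  qed
  also have "\<dots> \<le> (LINT s:{t..}|lborel. ?w s)"
    unfolding set_lebesgue_integral_def
  proof (rule integral_mono)
    show "integrable lborel (\<lambda>s. indicator {t..} s *\<^sub>R ?w s)"
      using gramian_quadratic_form(1)[OF t v] by (simp add: set_integrable_def)
    show "integrable lborel (\<lambda>s. indicator {t..t + 1} s *\<^sub>R ?w s)"
      using set_integrable_subset[OF gramian_quadratic_form(1)[OF t v], of "{t..t + 1}"]
      by (simp add: set_integrable_def)
  qed (auto simp: indicator_def)
  finally show ?thesis using gramian_quadratic_form(2)[OF t v] by simp
qed

lemma gramian_pos_def:
  assumes t: "t0 \<le> t"
  shows "pos_def n (gramian_lim n \<Phi> t)"
  unfolding pos_def_def
proof (intro conjI ballI impI gramian_lim_carrier gramian_lim_symmetric[OF t])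
  fix v :: "real vec" assume v: "v \<in> carrier_vec n" "v \<noteq> 0\<^sub>v n"
  then have "vnorm v \<noteq> 0" by (simp add: vnorm_eq_0_iff)
  then have "0 < exp (- 2 * b) * (vnorm v)\<^sup>2" by simp
  then show "0 < scalar_prod v (gramian_lim n \<Phi> t *\<^sub>v v)"
    using gramian_lower_bound[OF t v(1)] by linarith
qed

lemma lam_min_gramian_ge: "t0 \<le> t \<Longrightarrow> exp (- 2 * b) \<le> lam_min (gramian_lim n \<Phi> t)"
  by (intro le_lam_min[OF gramian_lim_carrier gramian_lim_symmetric n_pos] gramian_lower_bound)

lemma lam_inf_gramian_pos: "0 < lam_inf t0 (gramian_lim n \<Phi>)"
proof -
  have "exp (- 2 * b) \<le> lam_inf t0 (gramian_lim n \<Phi>)"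
    unfolding lam_inf_def
  proof (rule cINF_greatest)
    show "exp (- 2 * b) \<le> lam_min (gramian_lim n \<Phi> t)" if "t \<in> {t0..}" for t
      using lam_min_gramian_ge that by simp
  qed simp
  then show ?thesis using exp_gt_zero[of "- 2 * b"] by linarith
qed

lemma lam_inf_gramian_quadratic_form:
  assumes t: "t0 \<le> t" and v: "v \<in> carrier_vec n"
  shows "lam_inf t0 (gramian_lim n \<Phi>) * (vnorm v)\<^sup>2 \<le> scalar_prod v (gramian_lim n \<Phi> t *\<^sub>v v)"
proof -
  have "lam_inf t0 (gramian_lim n \<Phi>) \<le> lam_min (gramian_lim n \<Phi> t)"
    unfolding lam_inf_def using t lam_min_gramian_ge
    by (intro cINF_lower bdd_belowI2[where m = "exp (- 2 * b)"]) auto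
  then have "lam_inf t0 (gramian_lim n \<Phi>) * (vnorm v)\<^sup>2 \<le> lam_min (gramian_lim n \<Phi> t) * (vnorm v)\<^sup>2"
    by (intro mult_right_mono) auto
  also have "\<dots> \<le> scalar_prod v (gramian_lim n \<Phi> t *\<^sub>v v)"
    by (rule lam_min_quadratic_form_le[OF gramian_lim_carrier gramian_lim_symmetric[OF t] v])
  finally show ?thesis .
qed

lemma lam_sup_gramian_quadratic_form:
  assumes t: "t0 \<le> t" and v: "v \<in> carrier_vec n"
  shows "scalar_prod v (gramian_lim n \<Phi> t *\<^sub>v v) \<le> lam_sup t0 (gramian_lim n \<Phi>) * (vnorm v)\<^sup>2"
proof -
  have "scalar_prod v (gramian_lim n \<Phi> t *\<^sub>v v) \<le> lam_max (gramian_lim n \<Phi> t) * (vnorm v)\<^sup>2"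
    by (rule quadratic_form_le_lam_max[OF gramian_lim_carrier gramian_lim_symmetric[OF t] v])
  also have "lam_max (gramian_lim n \<Phi> t) \<le> lam_sup t0 (gramian_lim n \<Phi>)"
    unfolding lam_sup_def using t by (intro cSUP_upper lam_max_gramian_bdd_above) auto
  then have "lam_max (gramian_lim n \<Phi> t) * (vnorm v)\<^sup>2 \<le> lam_sup t0 (gramian_lim n \<Phi>) * (vnorm v)\<^sup>2"
    by (intro mult_right_mono) auto
  finally show ?thesis .
qed

lemma lam_sup_gramian_pos: "0 < lam_sup t0 (gramian_lim n \<Phi>)"
proof -
  let ?u = "unit_vec n 0 :: real vec"
  have u: "?u \<in> carrier_vec n" "?u \<noteq> 0\<^sub>v n" using n_pos by auto
  then have "0 < scalar_prod ?u (gramian_lim n \<Phi> t0 *\<^sub>v ?u)"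
    using gramian_pos_def[OF order_refl] unfolding pos_def_def by blast
  then have "0 < lam_sup t0 (gramian_lim n \<Phi>) * (vnorm ?u)\<^sup>2"
    using lam_sup_gramian_quadratic_form[OF order_refl u(1)] by linarith
  then show ?thesis by (simp add: zero_less_mult_iff)
qed

text \<open>The energy \<open>V(t) = \<xi>(t)\<^sup>T S(t) \<xi>(t)\<close> still to be dissipated is a Lyapunov function: it is lost
  at the rate \<open>|\<xi>|\<^sup>2\<close>, which is at least the fraction \<open>1 / \<lambda>\<close> of its value, where \<open>\<lambda>\<close> is the supremum of
  the largest eigenvalues of \<open>S\<close>. The square root relating \<open>|\<xi>|\<close> to \<open>V\<close> halves the exponent.\<close>
lemma lyapunov_decay:
  assumes s: "lin_solution n F t0 \<xi>" and t: "t0 \<le> t"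
  shows "vnorm (\<xi> t) \<le> bias_beta t0 (gramian_lim n \<Phi>) (\<xi> t0)
    * exp (- bias_gamma t0 (gramian_lim n \<Phi>) * (t - t0))"
proof -
  let ?S = "gramian_lim n \<Phi>"
  let ?l = "lam_sup t0 ?S"
  let ?w = "\<lambda>s. (vnorm (\<xi> s))\<^sup>2"
  define V where "V t = scalar_prod (\<xi> t) (?S t *\<^sub>v \<xi> t)" for t
  have c: "\<xi> r \<in> carrier_vec n" if "t0 \<le> r" for r using lin_solution_carrier[OF s that] .
  \<comment> \<open>the future of a trajectory is the flow of its present value, so that \<open>V\<close> is a tail integral\<close>
  have flow: "\<Phi> q r *\<^sub>v \<xi> r = \<xi> q" if "t0 \<le> r" "r \<le> q" for r q
  proof -
    have "(\<lambda>q. \<Phi> q r *\<^sub>v \<xi> r) q = \<xi> q"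
    proof (rule lin_solution_unique[OF F_carrier stable])
      show "lin_solution n F r (\<lambda>q. \<Phi> q r *\<^sub>v \<xi> r)" by (rule transition_solution[OF that(1) c[OF that(1)]])
      show "lin_solution n F r \<xi>" by (rule lin_solution_restrict[OF s that(1)])
      show "\<Phi> r r *\<^sub>v \<xi> r = \<xi> r" using transition_refl[OF that(1)] c[OF that(1)] by simp
    qed (use that in auto)
    then show ?thesis .
  qed
  have int: "set_integrable lborel {r..} ?w" if r: "t0 \<le> r" for r
    using gramian_quadratic_form(1)[OF r c[OF r]] flow[OF r]
    by (subst (asm) set_integrable_cong[OF refl refl, where f' = ?w]) auto
  have V: "V r = (LINT q:{r..}|lborel. ?w q)" if r: "t0 \<le> r" for r
    unfolding V_def gramian_quadratic_form(2)[OF r c[OF r]]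
    using flow[OF r] by (intro set_lebesgue_integral_cong) auto
  have V_eq: "V r = V t0 - integral {t0..r} ?w" if r: "t0 \<le> r" for r
  proof -
    have split: "{t0..} = {t0..<r} \<union> {r..}" using r by auto
    have "V t0 = (LINT q:{t0..<r}|lborel. ?w q) + V r"
      unfolding V[OF order_refl] V[OF r] split
      by (intro set_integral_Un set_integrable_subset[OF int[OF order_refl]]) (use r in auto)
    moreover have "(LINT q:{t0..<r}|lborel. ?w q) = integral {t0..<r} ?w"
      by (intro set_borel_integral_eq_integral set_integrable_subset[OF int[OF order_refl]]) auto
    moreover have "integral {t0..<r} ?w = integral {t0..r} ?w"
      by (rule integral_subset_negligible) (use r in \<open>auto intro!: negligible_subset[of "{r}"]\<close>)
    ultimately show ?thesis by simp
  qed
  have cont: "continuous_on {t0..} ?w"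
    using deriv_vnorm_square[OF F_carrier s] by (intro DERIV_continuous_on) auto
  have dV: "(V has_real_derivative - ?w r) (at r within {t0..})" if r: "t0 \<le> r" for r
  proof -
    have "((\<lambda>r. V t0 - integral {t0..r} ?w) has_real_derivative 0 - ?w r) (at r within {t0..})"
      by (intro DERIV_diff DERIV_const deriv_integral_half_line cont r)
    then have "((\<lambda>r. V t0 - integral {t0..r} ?w) has_real_derivative - ?w r) (at r within {t0..})"
      by simp
    then show ?thesis by (rule has_derivative_half_line_cong[OF _ r]) (rule V_eq[symmetric])
  qed
  have l: "?l > 0" by (rule lam_sup_gramian_pos)
  let ?h = "\<lambda>r. - (exp ((r - t0) / ?l) * V r)"
  let ?h' = "\<lambda>r. exp ((r - t0) / ?l) * (?w r - V r / ?l)"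
  have "?h t0 \<le> ?h t"
  proof (rule nondecreasing_on_half_line[where f = ?h and f' = ?h'])
    fix r assume r: "t0 \<le> r"
    show "(?h has_real_derivative ?h' r) (at r within {t0..})"
      by (rule DERIV_cong, rule DERIV_minus, rule DERIV_mult[OF _ dV[OF r]])
        (use l in \<open>auto intro!: derivative_eq_intros simp: algebra_simps\<close>)
    have "V r \<le> ?l * ?w r"
      unfolding V_def by (rule lam_sup_gramian_quadratic_form[OF r c[OF r]])
    then have "V r / ?l \<le> ?w r" using l by (simp add: field_simps)
    then show "0 \<le> ?h' r" by simp
  qed (rule t)
  then have "exp ((t - t0) / ?l) * V t \<le> V t0" by simp
  then have "exp (- ((t - t0) / ?l)) * (exp ((t - t0) / ?l) * V t) \<le> exp (- ((t - t0) / ?l)) * V t0"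
    by (intro mult_left_mono) auto
  then have Vt: "V t \<le> V t0 * exp (- ((t - t0) / ?l))"
    by (simp add: exp_minus field_simps)
  let ?m = "lam_inf t0 ?S"
  have m: "?m > 0" by (rule lam_inf_gramian_pos)
  have "?m * ?w t \<le> V t" unfolding V_def by (rule lam_inf_gramian_quadratic_form[OF t c[OF t]])
  then have "?w t \<le> V t0 / ?m * exp (- ((t - t0) / ?l))" using Vt m by (simp add: field_simps)
  then have "sqrt (?w t) \<le> sqrt (V t0 / ?m * exp (- ((t - t0) / ?l)))" by (rule real_sqrt_le_mono)
  also have "exp (- ((t - t0) / ?l)) = (exp (- bias_gamma t0 ?S * (t - t0)))\<^sup>2"
    unfolding bias_gamma_def power2_eq_square exp_add[symmetric] using l by (simp add: field_simps)
  also have "sqrt (V t0 / ?m * (exp (- bias_gamma t0 ?S * (t - t0)))\<^sup>2)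
      = bias_beta t0 ?S (\<xi> t0) * exp (- bias_gamma t0 ?S * (t - t0))"
    unfolding real_sqrt_mult[of "V t0 / ?m"] by (simp only: bias_beta_def V_def real_sqrt_pow2 real_sqrt_abs abs_exp_cancel)
  finally show ?thesis by simp
qed

end

section \<open>Mean functions of generalised signals\<close>

text \<open>The means of the single processes entering the filter, such as those of the inputs, are treated as
  measurable and locally bounded functions: this makes the pairing with a test function meaningful and
  is stable under sums and multiplication by continuous matrices. Continuity is recovered at the end,
  for the mean errors only.\<close>
definition locally_bounded_vec :: "real \<Rightarrow> nat \<Rightarrow> (real \<Rightarrow> real vec) \<Rightarrow> bool" where
  "locally_bounded_vec t0 k m \<longleftrightarrow> (\<forall>t\<ge>t0. m t \<in> carrier_vec k) \<and>
     (\<forall>i<k. set_borel_measurable lborel {t0..} (\<lambda>t. m t $ i)) \<and>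
     (\<forall>T. \<exists>b. \<forall>t\<in>{t0..T}. \<forall>i<k. \<bar>m t $ i\<bar> \<le> b)"

definition mean_of_signal ::
  "'w measure \<Rightarrow> real \<Rightarrow> nat \<Rightarrow> 'w signal \<Rightarrow> (real \<Rightarrow> real vec) \<Rightarrow> bool" where
  "mean_of_signal M t0 k g m \<longleftrightarrow> locally_bounded_vec t0 k m \<and>
     (\<forall>f. test_fun t0 k f \<longrightarrow> integrable M (g f) \<and>
        (LINT \<omega>|M. g f \<omega>) = (LINT t:{t0..}|lborel. scalar_prod (f t) (m t)))"

lemma locally_bounded_vec_carrier: "locally_bounded_vec t0 k m \<Longrightarrow> t0 \<le> t \<Longrightarrow> m t \<in> carrier_vec k"
  by (simp add: locally_bounded_vec_def)

lemma test_fun_carrier: "test_fun t0 k f \<Longrightarrow> t0 \<le> t \<Longrightarrow> f t \<in> carrier_vec k"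
  by (simp add: test_fun_def)

lemma test_funE:
  assumes "test_fun t0 k f"
  obtains b T where "0 \<le> b" "\<And>t i. t0 \<le> t \<Longrightarrow> i < k \<Longrightarrow> \<bar>f t $ i\<bar> \<le> b"
    "\<And>t. t0 \<le> t \<Longrightarrow> T < t \<Longrightarrow> f t = 0\<^sub>v k"
proof -
  obtain b T where bT: "\<forall>t\<ge>t0. (\<forall>i<k. \<bar>f t $ i\<bar> \<le> b) \<and> (t > T \<longrightarrow> f t = 0\<^sub>v k)"
    using assms unfolding test_fun_def by blast
  show thesis
  proof (rule that[of "\<bar>b\<bar>" T])
    fix t i assume "t0 \<le> t" "i < k"
    then have "\<bar>f t $ i\<bar> \<le> b" using bT by blast
    then show "\<bar>f t $ i\<bar> \<le> \<bar>b\<bar>" by linarith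
  qed (use bT in auto)
qed

lemma scalar_prod_lessThan: "w \<in> carrier_vec k \<Longrightarrow> scalar_prod v w = (\<Sum>i<k. v $ i * w $ i)"
  by (auto simp: scalar_prod_def lessThan_atLeast0)

lemma set_borel_measurable_sum:
  fixes f :: "'i \<Rightarrow> real \<Rightarrow> real"
  assumes "\<And>i. i \<in> I \<Longrightarrow> set_borel_measurable lborel A (f i)"
  shows "set_borel_measurable lborel A (\<lambda>t. \<Sum>i\<in>I. f i t)"
  using assms unfolding set_borel_measurable_def scaleR_sum_right
  by (intro borel_measurable_sum) auto

lemma set_borel_measurable_mult:
  fixes f g :: "real \<Rightarrow> real"
  assumes "set_borel_measurable lborel A f" "set_borel_measurable lborel A g"
  shows "set_borel_measurable lborel A (\<lambda>t. f t * g t)"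
proof -
  have "(\<lambda>t. indicator A t *\<^sub>R (f t * g t)) = (\<lambda>t. (indicator A t *\<^sub>R f t) * (indicator A t *\<^sub>R g t))"
    by (auto simp: indicator_def)
  then show ?thesis
    using assms unfolding set_borel_measurable_def by (simp only: borel_measurable_times)
qed

lemma set_borel_measurable_cong:
  assumes "set_borel_measurable lborel A f" "\<And>t. t \<in> A \<Longrightarrow> f t = (g t :: real)"
  shows "set_borel_measurable lborel A g"
proof -
  have "(\<lambda>t. indicator A t *\<^sub>R f t) = (\<lambda>t. indicator A t *\<^sub>R g t)"
    using assms(2) by (auto simp: indicator_def)
  then show ?thesis using assms(1) by (simp add: set_borel_measurable_def)
qed

lemma set_borel_measurable_continuous:
  fixes f :: "real \<Rightarrow> real"
  shows "continuous_on {t0..} f \<Longrightarrow> set_borel_measurable lborel {t0..} f"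
  unfolding set_borel_measurable_def
  using borel_measurable_continuous_on_indicator[of "{t0..}" f] by simp

lemma bounded_set_integrable_Icc:
  fixes f :: "real \<Rightarrow> real"
  assumes f: "set_borel_measurable lborel {t0..} f" and "t0 \<le> a"
    and b: "\<And>t. t \<in> {a..c} \<Longrightarrow> \<bar>f t\<bar> \<le> b"
  shows "set_integrable lborel {a..c} f"
proof (rule set_integrable_bound[where f = "\<lambda>t. b"])
  show "set_integrable lborel {a..c} (\<lambda>t. b)"
    by (intro borel_integrable_atLeastAtMost' continuous_intros)
  show "set_borel_measurable lborel {a..c} f"
    by (rule set_borel_measurable_subset[OF f]) (use \<open>t0 \<le> a\<close> in auto)
  show "AE t in lborel. t \<in> {a..c} \<longrightarrow> norm (f t) \<le> norm b"
    using b by (auto intro: order_trans[OF _ abs_ge_self])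
qed

lemma set_integrable_half_line_of_Icc:
  fixes f :: "real \<Rightarrow> real"
  assumes "set_integrable lborel {t0..T} f" "\<And>t. t0 \<le> t \<Longrightarrow> T < t \<Longrightarrow> f t = 0"
  shows "set_integrable lborel {t0..} f"
proof -
  have "(\<lambda>t. indicator {t0..} t *\<^sub>R f t) = (\<lambda>t. indicator {t0..T} t *\<^sub>R f t)"
    using assms(2) by (auto simp: indicator_def fun_eq_iff not_le)
  then show ?thesis using assms(1) by (simp add: set_integrable_def)
qed

lemma test_fun_pairing_integrable:
  assumes f: "test_fun t0 k f" and m: "locally_bounded_vec t0 k m"
  shows "set_integrable lborel {t0..} (\<lambda>t. scalar_prod (f t) (m t))"
proof -
  obtain b T where b: "0 \<le> b" "\<And>t i. t0 \<le> t \<Longrightarrow> i < k \<Longrightarrow> \<bar>f t $ i\<bar> \<le> b"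
    and T: "\<And>t. t0 \<le> t \<Longrightarrow> T < t \<Longrightarrow> f t = 0\<^sub>v k" by (rule test_funE[OF f]) (rule that)
  obtain c where c: "\<And>t i. t \<in> {t0..T} \<Longrightarrow> i < k \<Longrightarrow> \<bar>m t $ i\<bar> \<le> c"
    using m unfolding locally_bounded_vec_def by meson
  have mc: "m t \<in> carrier_vec k" if "t0 \<le> t" for t using locally_bounded_vec_carrier[OF m that] .
  have meas: "set_borel_measurable lborel {t0..} (\<lambda>t. scalar_prod (f t) (m t))"
  proof (rule set_borel_measurable_cong)
    show "set_borel_measurable lborel {t0..} (\<lambda>t. \<Sum>i<k. f t $ i * m t $ i)"
      using f m by (intro set_borel_measurable_sum set_borel_measurable_mult)
        (auto simp: test_fun_def locally_bounded_vec_def)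
  qed (simp add: scalar_prod_lessThan[OF mc])
  show ?thesis
  proof (rule set_integrable_half_line_of_Icc[where T = T])
    show "set_integrable lborel {t0..T} (\<lambda>t. scalar_prod (f t) (m t))"
    proof (rule bounded_set_integrable_Icc[OF meas order_refl])
      fix t assume t: "t \<in> {t0..T}"
      have "\<bar>scalar_prod (f t) (m t)\<bar> \<le> (\<Sum>i<k. \<bar>f t $ i * m t $ i\<bar>)"
        using mc[of t] t by (simp add: scalar_prod_lessThan)
      also have "\<dots> \<le> (\<Sum>i<k. b * c)"
        unfolding abs_mult using t b c by (intro sum_mono mult_mono) auto
      finally show "\<bar>scalar_prod (f t) (m t)\<bar> \<le> (\<Sum>i<k. b * c)" .
    qed
  qed (use T mc in auto)
qed

lemma locally_bounded_vec_add:
  assumes m: "locally_bounded_vec t0 k m" "locally_bounded_vec t0 k m'"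
  shows "locally_bounded_vec t0 k (\<lambda>t. m t + m' t)"
  unfolding locally_bounded_vec_def
proof (intro conjI allI impI)
  have c: "m t \<in> carrier_vec k" "m' t \<in> carrier_vec k" if "t0 \<le> t" for t
    using locally_bounded_vec_carrier that m by auto
  show "m t + m' t \<in> carrier_vec k" if "t0 \<le> t" for t using c[OF that] by simp
  show "set_borel_measurable lborel {t0..} (\<lambda>t. (m t + m' t) $ i)" if i: "i < k" for i
  proof (rule set_borel_measurable_cong)
    show "set_borel_measurable lborel {t0..} (\<lambda>t. m t $ i + m' t $ i)"
      using m i unfolding locally_bounded_vec_def set_borel_measurable_def scaleR_add_right
      by (intro borel_measurable_add) auto
  qed (simp add: c(2)[THEN carrier_vecD] i)
  fix T
  obtain b where b: "\<And>t i. t \<in> {t0..T} \<Longrightarrow> i < k \<Longrightarrow> \<bar>m t $ i\<bar> \<le> b"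
    using m(1) unfolding locally_bounded_vec_def by meson
  obtain b' where b': "\<And>t i. t \<in> {t0..T} \<Longrightarrow> i < k \<Longrightarrow> \<bar>m' t $ i\<bar> \<le> b'"
    using m(2) unfolding locally_bounded_vec_def by meson
  have "\<bar>(m t + m' t) $ i\<bar> \<le> b + b'" if "t \<in> {t0..T}" "i < k" for t i
    using b[OF that] b'[OF that] c(2)[of t] that by auto
  then show "\<exists>b. \<forall>t\<in>{t0..T}. \<forall>i<k. \<bar>(m t + m' t) $ i\<bar> \<le> b" by blast
qed

lemma locally_bounded_vec_mult:
  assumes F: "cont_mat t0 l k F" and m: "locally_bounded_vec t0 k m"
  shows "locally_bounded_vec t0 l (\<lambda>t. F t *\<^sub>v m t)"
  unfolding locally_bounded_vec_def
proof (intro conjI allI impI)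
  have c: "F t \<in> carrier_mat l k" "m t \<in> carrier_vec k" if "t0 \<le> t" for t
    using locally_bounded_vec_carrier[OF m that] cont_mat_carrier[OF F that] by auto
  show "F t *\<^sub>v m t \<in> carrier_vec l" if "t0 \<le> t" for t
    by (rule mult_mat_vec_carrier[OF c[OF that]])
  show "set_borel_measurable lborel {t0..} (\<lambda>t. (F t *\<^sub>v m t) $ i)" if i: "i < l" for i
  proof (rule set_borel_measurable_cong)
    show "set_borel_measurable lborel {t0..} (\<lambda>t. \<Sum>j<k. F t $$ (i, j) * m t $ j)"
    proof (intro set_borel_measurable_sum set_borel_measurable_mult)
      fix j assume j: "j \<in> {..<k}"
      then show "set_borel_measurable lborel {t0..} (\<lambda>t. F t $$ (i, j))"
        by (intro set_borel_measurable_continuous cont_matD[OF F i]) simp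
      show "set_borel_measurable lborel {t0..} (\<lambda>t. m t $ j)"
        using m j by (simp add: locally_bounded_vec_def)
    qed
  qed (simp add: index_mult_mat_vec_sum[OF c i] del: index_mult_mat_vec)
  fix T
  obtain b where b: "\<And>t i. t \<in> {t0..T} \<Longrightarrow> i < k \<Longrightarrow> \<bar>m t $ i\<bar> \<le> b"
    using m unfolding locally_bounded_vec_def by meson
  have "\<exists>a. \<forall>t\<in>{t0..T}. \<bar>F t $$ (i, j)\<bar> \<le> a" if "i < l" "j < k" for i j
  proof -
    have "continuous_on {t0..T} (\<lambda>t. F t $$ (i, j))"
      by (rule continuous_on_subset[OF cont_matD[OF F that]]) auto
    then have "bounded ((\<lambda>t. F t $$ (i, j)) ` {t0..T})"
      by (intro compact_imp_bounded compact_continuous_image) auto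
    then show ?thesis unfolding bounded_iff by auto
  qed
  then obtain a where a: "\<And>i j t. i < l \<Longrightarrow> j < k \<Longrightarrow> t \<in> {t0..T} \<Longrightarrow> \<bar>F t $$ (i, j)\<bar> \<le> a i j"
    by metis
  have "\<bar>(F t *\<^sub>v m t) $ i\<bar> \<le> (\<Sum>i<l. \<Sum>j<k. a i j * b)" if t: "t \<in> {t0..T}" and i: "i < l" for t i
  proof -
    have ab: "\<bar>F t $$ (i, j)\<bar> * \<bar>m t $ j\<bar> \<le> a i j * b" "0 \<le> a i j * b" if "i < l" "j < k" for i j
      using a[OF that t] b[OF t that(2)] order_trans[OF abs_ge_zero a[OF that t]]
        order_trans[OF abs_ge_zero b[OF t that(2)]] by (auto intro!: mult_mono)
    have "\<bar>(F t *\<^sub>v m t) $ i\<bar> \<le> (\<Sum>j<k. \<bar>F t $$ (i, j)\<bar> * \<bar>m t $ j\<bar>)"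
      using c[of t] t i by (subst index_mult_mat_vec_sum[of _ l k])
        (auto intro!: order_trans[OF sum_abs] simp: abs_mult)
    also have "\<dots> \<le> (\<Sum>j<k. a i j * b)" by (intro sum_mono ab i) auto
    also have "\<dots> \<le> (\<Sum>i<l. \<Sum>j<k. a i j * b)"
      by (rule member_le_sum) (use i ab in \<open>auto intro!: sum_nonneg\<close>)
    finally show ?thesis .
  qed
  then show "\<exists>b. \<forall>t\<in>{t0..T}. \<forall>i<l. \<bar>(F t *\<^sub>v m t) $ i\<bar> \<le> b" by blast
qed

lemma locally_bounded_vec_integrable_Icc:
  assumes m: "locally_bounded_vec t0 k m" and i: "i < k"
  shows "set_integrable lborel {t0..t} (\<lambda>s. m s $ i)"
proof -
  obtain b where "\<And>s. s \<in> {t0..t} \<Longrightarrow> \<bar>m s $ i\<bar> \<le> b"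
    using m i unfolding locally_bounded_vec_def by meson
  then show ?thesis
    using m i by (intro bounded_set_integrable_Icc[of t0 _ t0 t b]) (auto simp: locally_bounded_vec_def)
qed

text \<open>By definition \<open>F \<triangleright> g\<close> acts on \<open>f\<close> as \<open>g\<close> acts on \<open>F\<^sup>T f\<close>, which has to be a test function again: \<open>F\<close>
  is bounded on the bounded support of \<open>f\<close>.\<close>
lemma test_fun_transpose_mult:
  assumes F: "cont_mat t0 l k F" and f: "test_fun t0 l f"
  shows "test_fun t0 k (\<lambda>t. (F t)\<^sup>T *\<^sub>v f t)"
proof -
  obtain b T where b: "0 \<le> b" "\<And>t i. t0 \<le> t \<Longrightarrow> i < l \<Longrightarrow> \<bar>f t $ i\<bar> \<le> b"
    and T: "\<And>t. t0 \<le> t \<Longrightarrow> T < t \<Longrightarrow> f t = 0\<^sub>v l" by (rule test_funE[OF f]) (rule that)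
  have FT: "cont_mat t0 k l (\<lambda>t. (F t)\<^sup>T)" by (rule cont_mat_transpose[OF F])
  have "locally_bounded_vec t0 l f"
    unfolding locally_bounded_vec_def
  proof (intro conjI allI impI)
    show "\<exists>b. \<forall>t\<in>{t0..T}. \<forall>i<l. \<bar>f t $ i\<bar> \<le> b" for T by (intro exI[of _ b]) (simp add: b(2))
  qed (use f in \<open>auto simp: test_fun_def\<close>)
  note lb = locally_bounded_vec_mult[OF FT this]
  have zero: "(F t)\<^sup>T *\<^sub>v f t = 0\<^sub>v k" if "t0 \<le> t" "T < t" for t
    using T[OF that] cont_mat_carrier[OF FT that(1)] by (intro eq_vecI) auto
  obtain c where c: "\<And>t i. t \<in> {t0..T} \<Longrightarrow> i < k \<Longrightarrow> \<bar>((F t)\<^sup>T *\<^sub>v f t) $ i\<bar> \<le> c"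
    using lb unfolding locally_bounded_vec_def by meson
  have "\<bar>((F t)\<^sup>T *\<^sub>v f t) $ i\<bar> \<le> \<bar>c\<bar>" if "t0 \<le> t" "i < k" for t i
  proof (cases "t \<le> T")
    case True
    then have "\<bar>((F t)\<^sup>T *\<^sub>v f t) $ i\<bar> \<le> c" using that by (intro c) auto
    then show ?thesis by linarith
  next
    case False
    then show ?thesis using zero[OF that(1)] that by simp
  qed
  then show ?thesis
    using lb zero unfolding locally_bounded_vec_def test_fun_def by blast
qed

lemma mean_of_signal_integrable:
  "mean_of_signal M t0 k g m \<Longrightarrow> test_fun t0 k f \<Longrightarrow> integrable M (g f)"
  by (simp add: mean_of_signal_def)

lemma mean_of_signal_eq:
  "mean_of_signal M t0 k g m \<Longrightarrow> test_fun t0 k f \<Longrightarrow>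
    (LINT \<omega>|M. g f \<omega>) = (LINT t:{t0..}|lborel. scalar_prod (f t) (m t))"
  by (simp add: mean_of_signal_def)

lemma mean_of_signal_locally_bounded: "mean_of_signal M t0 k g m \<Longrightarrow> locally_bounded_vec t0 k m"
  by (simp add: mean_of_signal_def)

lemma mean_of_signal_carrier: "mean_of_signal M t0 k g m \<Longrightarrow> t0 \<le> t \<Longrightarrow> m t \<in> carrier_vec k"
  by (simp add: mean_of_signal_def locally_bounded_vec_def)

lemma mean_of_signal_add:
  assumes g: "mean_of_signal M t0 k g m" and h: "mean_of_signal M t0 k h m'"
  shows "mean_of_signal M t0 k (g + h) (\<lambda>t. m t + m' t)"
  unfolding mean_of_signal_def
proof (intro conjI allI impI)
  show "locally_bounded_vec t0 k (\<lambda>t. m t + m' t)"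
    by (rule locally_bounded_vec_add[OF mean_of_signal_locally_bounded[OF g] mean_of_signal_locally_bounded[OF h]])
  fix f assume f: "test_fun t0 k f"
  have int: "integrable M (g f)" "integrable M (h f)"
    by (rule mean_of_signal_integrable[OF g f], rule mean_of_signal_integrable[OF h f])
  have sum: "(g + h) f = (\<lambda>\<omega>. g f \<omega> + h f \<omega>)" by (simp add: plus_fun_def)
  show "integrable M ((g + h) f)" unfolding sum by (intro Bochner_Integration.integrable_add int)
  have "(LINT \<omega>|M. (g + h) f \<omega>)
      = (LINT t:{t0..}|lborel. scalar_prod (f t) (m t)) + (LINT t:{t0..}|lborel. scalar_prod (f t) (m' t))"
    unfolding sum using int mean_of_signal_eq[OF g f] mean_of_signal_eq[OF h f] by simp
  also have "\<dots> = (LINT t:{t0..}|lborel. scalar_prod (f t) (m t) + scalar_prod (f t) (m' t))"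
    by (intro set_integral_add(2)[symmetric] test_fun_pairing_integrable[OF f]
        mean_of_signal_locally_bounded[OF g] mean_of_signal_locally_bounded[OF h])
  also have "\<dots> = (LINT t:{t0..}|lborel. scalar_prod (f t) (m t + m' t))"
    using test_fun_carrier[OF f] mean_of_signal_carrier[OF g] mean_of_signal_carrier[OF h]
    by (intro set_lebesgue_integral_cong) (auto simp: scalar_prod_add_distrib[of _ k])
  finally show "(LINT \<omega>|M. (g + h) f \<omega>) = (LINT t:{t0..}|lborel. scalar_prod (f t) (m t + m' t))" .
qed

lemma mean_of_signal_cong:
  assumes "mean_of_signal M t0 k g m" "\<And>t. t0 \<le> t \<Longrightarrow> m t = m' t"
  shows "mean_of_signal M t0 k g m'"
proof -
  have c: "set_borel_measurable lborel {t0..} (\<lambda>t. m' t $ i)"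
    if "set_borel_measurable lborel {t0..} (\<lambda>t. m t $ i)" for i
    by (rule set_borel_measurable_cong[OF that]) (use assms(2) in auto)
  have "(LINT t:{t0..}|lborel. scalar_prod (f t) (m t)) = (LINT t:{t0..}|lborel. scalar_prod (f t) (m' t))" for f
    using assms(2) by (intro set_lebesgue_integral_cong) auto
  then show ?thesis
    using assms c unfolding mean_of_signal_def locally_bounded_vec_def by auto
qed

lemma mean_of_signal_mult:
  assumes F: "cont_mat t0 l k F" and g: "mean_of_signal M t0 k g m"
  shows "mean_of_signal M t0 l (F \<triangleright> g) (\<lambda>t. F t *\<^sub>v m t)"
  unfolding mean_of_signal_def
proof (intro conjI allI impI)
  show "locally_bounded_vec t0 l (\<lambda>t. F t *\<^sub>v m t)"
    by (rule locally_bounded_vec_mult[OF F mean_of_signal_locally_bounded[OF g]])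
  fix f assume f: "test_fun t0 l f"
  note Ff = test_fun_transpose_mult[OF F f]
  show "integrable M ((F \<triangleright> g) f)"
    unfolding sig_mult_def by (rule mean_of_signal_integrable[OF g Ff])
  have "(LINT \<omega>|M. (F \<triangleright> g) f \<omega>) = (LINT t:{t0..}|lborel. scalar_prod ((F t)\<^sup>T *\<^sub>v f t) (m t))"
    unfolding sig_mult_def by (rule mean_of_signal_eq[OF g Ff])
  also have "\<dots> = (LINT t:{t0..}|lborel. scalar_prod (f t) (F t *\<^sub>v m t))"
    using transpose_vec_mult_scalar[OF cont_mat_carrier[OF F] mean_of_signal_carrier[OF g] test_fun_carrier[OF f]]
    by (intro set_lebesgue_integral_cong) auto
  finally show "(LINT \<omega>|M. (F \<triangleright> g) f \<omega>) = (LINT t:{t0..}|lborel. scalar_prod (f t) (F t *\<^sub>v m t))" .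
qed


lemma mean_of_signal_diff:
  assumes g: "mean_of_signal M t0 k g m" and h: "mean_of_signal M t0 k h m'"
  shows "mean_of_signal M t0 k (g - h) (\<lambda>t. m t - m' t)"
proof -
  have "mean_of_signal M t0 k (- h) (\<lambda>t. - m' t)"
    unfolding mean_of_signal_def
  proof (intro conjI allI impI)
    have c: "m' t \<in> carrier_vec k" if "t0 \<le> t" for t by (rule mean_of_signal_carrier[OF h that])
    have lb: "locally_bounded_vec t0 k m'" by (rule mean_of_signal_locally_bounded[OF h])
    have one: "cont_mat t0 k k (\<lambda>t. - 1\<^sub>m k)" by (intro cont_mat_const) simp
    have eq: "- 1\<^sub>m k *\<^sub>v m' t = - m' t" if "t0 \<le> t" for t
      using c[OF that] by simp
    show "locally_bounded_vec t0 k (\<lambda>t. - m' t)"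
    proof -
      have neg: "(- m' t) $ i = (- 1\<^sub>m k *\<^sub>v m' t) $ i" if "t0 \<le> t" for t i using eq[OF that] by simp
      show ?thesis
        using locally_bounded_vec_mult[OF one lb] c
        unfolding locally_bounded_vec_def
        by (auto simp: eq intro: set_borel_measurable_cong[OF _ neg[symmetric]])
    qed
    fix f assume f: "test_fun t0 k f"
    have minus: "(- h) f = (\<lambda>\<omega>. - h f \<omega>)" by (simp add: fun_Compl_def)
    show "integrable M ((- h) f)"
      unfolding minus using mean_of_signal_integrable[OF h f] by simp
    have "(LINT \<omega>|M. (- h) f \<omega>) = (LINT t:{t0..}|lborel. - scalar_prod (f t) (m' t))"
      unfolding minus using mean_of_signal_eq[OF h f] by (simp add: set_lebesgue_integral_def)
    also have "\<dots> = (LINT t:{t0..}|lborel. scalar_prod (f t) (- m' t))"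
      by (intro set_lebesgue_integral_cong)
        (auto simp: test_fun_carrier[OF f, THEN carrier_vecD] c[THEN carrier_vecD])
    finally show "(LINT \<omega>|M. (- h) f \<omega>) = (LINT t:{t0..}|lborel. scalar_prod (f t) (- m' t))" .
  qed
  from mean_of_signal_add[OF g this]
  have "mean_of_signal M t0 k (g + - h) (\<lambda>t. m t + - m' t)" .
  moreover have "g + - h = g - h" by (simp add: fun_eq_iff plus_fun_def fun_Compl_def fun_diff_def)
  ultimately have "mean_of_signal M t0 k (g - h) (\<lambda>t. m t + - m' t)" by simp
  then show ?thesis
    by (rule mean_of_signal_cong)
      (use mean_of_signal_carrier[OF g] mean_of_signal_carrier[OF h] in \<open>auto simp: minus_add_uminus_vec[of _ k]\<close>)
qed

lemma mean_of_noise: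
  assumes M: "prob_space M" and N: "zero_mean_noise M t0 k N"
  shows "mean_of_signal M t0 k N (\<lambda>t. 0\<^sub>v k)"
proof -
  interpret prob_space M by fact
  have "locally_bounded_vec t0 k (\<lambda>t. 0\<^sub>v k)"
    unfolding locally_bounded_vec_def by (auto intro!: set_borel_measurable_continuous exI[of _ 0])
  moreover have "integrable M (N f) \<and>
      (LINT \<omega>|M. N f \<omega>) = (LINT t:{t0..}|lborel. scalar_prod (f t) (0\<^sub>v k))" if f: "test_fun t0 k f" for f
  proof
    have Nf: "N f \<in> borel_measurable M" "integrable M (\<lambda>\<omega>. (N f \<omega>)\<^sup>2)" "(LINT \<omega>|M. N f \<omega>) = 0"
      using N f unfolding zero_mean_noise_def by auto
    show "integrable M (N f)" by (rule square_integrable_imp_integrable[OF Nf(1,2)])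
    have "(LINT t:{t0..}|lborel. scalar_prod (f t) (0\<^sub>v k)) = (LINT t:{t0..}|lborel. 0)"
      using test_fun_carrier[OF f] by (intro set_lebesgue_integral_cong) auto
    then show "(LINT \<omega>|M. N f \<omega>) = (LINT t:{t0..}|lborel. scalar_prod (f t) (0\<^sub>v k))"
      using Nf(3) by (simp add: set_lebesgue_integral_def)
  qed
  ultimately show ?thesis unfolding mean_of_signal_def by blast
qed

text \<open>Fubini's theorem: the mean of the integral of \<open>f\<^sup>T x\<close> is the integral of \<open>f\<^sup>T E[x]\<close>. Bounded
  second moments on bounded intervals, together with the bounded support of \<open>f\<close>, give the
  integrability on the product space. Only times \<open>t \<ge> t0\<close> carry measurability assumptions, so the
  process is frozen at its initial value before \<open>t0\<close>.\<close>
lemma mean_of_process: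
  assumes M: "prob_space M" and x: "second_order_process M t0 k x"
  shows "mean_of_signal M t0 k (sig t0 x) (\<lambda>t. expect_vec M k (x t))"
    and "\<And>t i. t0 \<le> t \<Longrightarrow> i < k \<Longrightarrow> integrable M (\<lambda>\<omega>. x t \<omega> $ i)"
proof -
  interpret prob_space M by fact
  interpret P: pair_sigma_finite lborel M ..
  define X where "X i t \<omega> = x (max t0 t) \<omega> $ i" for i t \<omega>
  have X_meas: "(\<lambda>p. X i (fst p) (snd p)) \<in> borel_measurable (lborel \<Otimes>\<^sub>M M)" if i: "i < k" for i
  proof -
    have "(\<lambda>p. (max t0 (fst p), snd p)) \<in> measurable (lborel \<Otimes>\<^sub>M M) (restrict_space borel {t0..} \<Otimes>\<^sub>M M)"
      by (intro measurable_Pair measurable_restrict_space2) auto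
    moreover have "(\<lambda>(t, \<omega>). x t \<omega> $ i) \<in> borel_measurable (restrict_space borel {t0..} \<Otimes>\<^sub>M M)"
      using x i unfolding second_order_process_def by blast
    ultimately show ?thesis
      using measurable_compose by (fastforce simp: X_def case_prod_beta)
  qed
  have X_section: "X i t \<in> borel_measurable M" if i: "i < k" for i t
    using measurable_compose[OF measurable_Pair1'[of t lborel M] X_meas[OF i]] by simp
  have X_bound: "\<exists>b. \<forall>t\<in>{t0..T}. \<forall>i<k. integrable M (X i t) \<and> (LINT \<omega>|M. \<bar>X i t \<omega>\<bar>) \<le> b" for T
  proof -
    obtain b where b: "\<And>t i. t \<in> {t0..T} \<Longrightarrow> i < k \<Longrightarrow> integrable M (\<lambda>\<omega>. (x t \<omega> $ i)\<^sup>2) \<and>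
        (LINT \<omega>|M. (x t \<omega> $ i)\<^sup>2) \<le> b"
      using x unfolding second_order_process_def by meson
    have "integrable M (X i t) \<and> (LINT \<omega>|M. \<bar>X i t \<omega>\<bar>) \<le> 1 + b" if t: "t \<in> {t0..T}" and i: "i < k" for t i
    proof
      have sq: "integrable M (\<lambda>\<omega>. (X i t \<omega>)\<^sup>2)" "(LINT \<omega>|M. (X i t \<omega>)\<^sup>2) \<le> b"
        using b[OF t i] t by (auto simp: X_def max_def)
      show int: "integrable M (X i t)"
        by (rule square_integrable_imp_integrable[OF X_section[OF i] sq(1)])
      have "\<bar>y\<bar> \<le> 1 + y\<^sup>2" for y :: real
      proof -
        have "0 \<le> (\<bar>y\<bar> - 1)\<^sup>2 + \<bar>y\<bar>" by simp
        then show ?thesis by (simp add: power2_eq_square algebra_simps)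
      qed
      then have "(LINT \<omega>|M. \<bar>X i t \<omega>\<bar>) \<le> (LINT \<omega>|M. 1 + (X i t \<omega>)\<^sup>2)"
        using int sq(1) by (intro integral_mono) auto
      also have "\<dots> = 1 + (LINT \<omega>|M. (X i t \<omega>)\<^sup>2)"
        using sq(1) by (simp add: prob_space)
      finally show "(LINT \<omega>|M. \<bar>X i t \<omega>\<bar>) \<le> 1 + b" using sq(2) by linarith
    qed
    then show ?thesis by (intro exI[of _ "1 + b"]) simp
  qed
  have X_int: "integrable M (X i t)" if "t0 \<le> t" "i < k" for i t
    using X_bound[of t] that by (meson atLeastAtMost_iff order_refl)
  show int_x: "integrable M (\<lambda>\<omega>. x t \<omega> $ i)" if "t0 \<le> t" "i < k" for t i
  proof -
    have "X i t = (\<lambda>\<omega>. x t \<omega> $ i)" using that by (simp add: X_def max_def fun_eq_iff)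
    then show ?thesis using X_int[OF that] by simp
  qed
  have mean_index: "expect_vec M k (x t) $ i = (LINT \<omega>|M. X i t \<omega>)" if "t0 \<le> t" "i < k" for t i
    using that by (simp add: expect_vec_def X_def max_def)
  have mean_meas: "(\<lambda>t. LINT \<omega>|M. X i t \<omega>) \<in> borel_measurable lborel" if "i < k" for i
    using X_meas[OF that] by (intro borel_measurable_lebesgue_integral) (simp add: case_prod_beta)
  have lb: "locally_bounded_vec t0 k (\<lambda>t. expect_vec M k (x t))"
    unfolding locally_bounded_vec_def
  proof (intro conjI allI impI)
    show "set_borel_measurable lborel {t0..} (\<lambda>t. expect_vec M k (x t) $ i)" if i: "i < k" for i
    proof (rule set_borel_measurable_cong)
      show "set_borel_measurable lborel {t0..} (\<lambda>t. LINT \<omega>|M. X i t \<omega>)"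
        unfolding set_borel_measurable_def using mean_meas[OF i] by simp
    qed (simp add: mean_index i)
    fix T
    obtain b where b: "\<And>t i. t \<in> {t0..T} \<Longrightarrow> i < k \<Longrightarrow> (LINT \<omega>|M. \<bar>X i t \<omega>\<bar>) \<le> b"
      using X_bound[of T] by meson
    have "\<bar>expect_vec M k (x t) $ i\<bar> \<le> b" if t: "t \<in> {t0..T}" and i: "i < k" for t i
      using order_trans[OF integral_abs_bound[of M "X i t"] b[OF t i]] t by (simp add: mean_index i)
    then show "\<exists>b. \<forall>t\<in>{t0..T}. \<forall>i<k. \<bar>expect_vec M k (x t) $ i\<bar> \<le> b" by blast
  qed (simp add: expect_vec_def)
  moreover have "integrable M (sig t0 x f) \<and>
    (LINT \<omega>|M. sig t0 x f \<omega>) = (LINT t:{t0..}|lborel. scalar_prod (f t) (expect_vec M k (x t)))"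
    if f: "test_fun t0 k f" for f
  proof -
    obtain b T where b: "0 \<le> b" "\<And>t i. t0 \<le> t \<Longrightarrow> i < k \<Longrightarrow> \<bar>f t $ i\<bar> \<le> b"
      and T: "\<And>t. t0 \<le> t \<Longrightarrow> T < t \<Longrightarrow> f t = 0\<^sub>v k" by (rule test_funE[OF f]) (rule that)
    obtain c where c: "\<And>t i. t \<in> {t0..T} \<Longrightarrow> i < k \<Longrightarrow> (LINT \<omega>|M. \<bar>X i t \<omega>\<bar>) \<le> c"
      using X_bound[of T] by meson
    let ?\<phi> = "\<lambda>i t. indicator {t0..} t *\<^sub>R f t $ i"
    have phi_meas: "?\<phi> i \<in> borel_measurable lborel" if "i < k" for i
      using f that unfolding test_fun_def set_borel_measurable_def by blast
    have phi_zero: "?\<phi> i t = 0" if "t \<notin> {t0..T}" "i < k" for i t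
      using T[of t] that by (auto simp: indicator_def)
    have phi_bound: "\<bar>?\<phi> i t\<bar> \<le> b" if "i < k" for i t
      using b that by (auto simp: indicator_def)
    let ?h = "\<lambda>i t \<omega>. ?\<phi> i t * X i t \<omega>"
    have h_int: "integrable (lborel \<Otimes>\<^sub>M M) (\<lambda>p. ?h i (fst p) (snd p))" if i: "i < k" for i
    proof (rule P.Fubini_integrable)
      show meas: "(\<lambda>p. ?h i (fst p) (snd p)) \<in> borel_measurable (lborel \<Otimes>\<^sub>M M)"
        by (intro borel_measurable_times X_meas[OF i] measurable_compose[OF measurable_fst phi_meas[OF i]])
      have sec: "integrable M (?h i t)" for t
      proof (cases "t \<in> {t0..T}")
        case True
        then show ?thesis using X_int[of t i] i by (intro integrable_mult_right) auto
      next
        case False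
        then show ?thesis using phi_zero[OF False i] by simp
      qed
      then show "AE t in lborel. integrable M (\<lambda>\<omega>. ?h i (fst (t, \<omega>)) (snd (t, \<omega>)))" by simp
      have "integrable lborel (\<lambda>t. LINT \<omega>|M. \<bar>?h i t \<omega>\<bar>)"
      proof (rule Bochner_Integration.integrable_bound)
        show "integrable lborel (\<lambda>t. indicator {t0..T} t *\<^sub>R (b * c))"
          using borel_integrable_atLeastAtMost'[of t0 T "\<lambda>t. b * c"]
          by (simp add: set_integrable_def continuous_on_const)
        show "(\<lambda>t. LINT \<omega>|M. \<bar>?h i t \<omega>\<bar>) \<in> borel_measurable lborel"
          using meas by (intro borel_measurable_lebesgue_integral) (simp add: case_prod_beta)
        have "norm (LINT \<omega>|M. \<bar>?h i t \<omega>\<bar>) \<le> norm (indicator {t0..T} t *\<^sub>R (b * c))" for t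
        proof (cases "t \<in> {t0..T}")
          case True
          have eq: "(LINT \<omega>|M. \<bar>?h i t \<omega>\<bar>) = \<bar>?\<phi> i t\<bar> * (LINT \<omega>|M. \<bar>X i t \<omega>\<bar>)"
            unfolding abs_mult by (rule integral_mult_right_zero)
          also have "\<dots> \<le> b * c"
            using b(1) by (intro mult_mono phi_bound i c True) auto
          finally have "(LINT \<omega>|M. \<bar>?h i t \<omega>\<bar>) \<le> b * c" .
          moreover have "0 \<le> (LINT \<omega>|M. \<bar>?h i t \<omega>\<bar>)" by simp
          ultimately show ?thesis using True by simp
        next
          case False
          show ?thesis unfolding phi_zero[OF False i] by simp
        qed
        then show "AE t in lborel. norm (LINT \<omega>|M. \<bar>?h i t \<omega>\<bar>) \<le> norm (indicator {t0..T} t *\<^sub>R (b * c))"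
          by simp
      qed
      then show "integrable lborel (\<lambda>t. LINT \<omega>|M. norm (?h i (fst (t, \<omega>)) (snd (t, \<omega>))))" by simp
    qed
    let ?H = "\<lambda>t \<omega>. \<Sum>i<k. ?h i t \<omega>"
    have H_int: "integrable (lborel \<Otimes>\<^sub>M M) (case_prod ?H)"
      unfolding case_prod_beta by (intro Bochner_Integration.integrable_sum h_int) auto
    have sig_eq: "sig t0 x f \<omega> = (LINT t|lborel. ?H t \<omega>)" if \<omega>: "\<omega> \<in> space M" for \<omega>
      unfolding sig_def set_lebesgue_integral_def
    proof (rule Bochner_Integration.integral_cong[OF refl])
      fix t
      have "scalar_prod (f t) (x t \<omega>) = (\<Sum>i<k. f t $ i * x t \<omega> $ i)" if "t0 \<le> t"
        using x \<omega> that by (intro scalar_prod_lessThan) (auto simp: second_order_process_def)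
      then show "indicator {t0..} t *\<^sub>R scalar_prod (f t) (x t \<omega>) = ?H t \<omega>"
        by (auto simp: indicator_def X_def max_def)
    qed
    have mean_eq: "indicator {t0..} t *\<^sub>R scalar_prod (f t) (expect_vec M k (x t)) = (LINT \<omega>|M. ?H t \<omega>)" for t
    proof (cases "t0 \<le> t")
      case True
      have "(LINT \<omega>|M. ?H t \<omega>) = (\<Sum>i<k. LINT \<omega>|M. ?h i t \<omega>)"
        by (intro Bochner_Integration.integral_sum integrable_mult_right X_int True) auto
      also have "\<dots> = (\<Sum>i<k. f t $ i * expect_vec M k (x t) $ i)"
        using True by (intro sum.cong refl) (simp add: mean_index)
      also have "\<dots> = scalar_prod (f t) (expect_vec M k (x t))"
        by (rule scalar_prod_lessThan[symmetric]) (simp add: expect_vec_def)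
      finally show ?thesis using True by simp
    qed simp
    have "integrable M (\<lambda>\<omega>. LINT t|lborel. ?H t \<omega>)" by (rule P.integrable_snd[OF H_int])
    then have int: "integrable M (sig t0 x f)"
      by (subst Bochner_Integration.integrable_cong[OF refl sig_eq])
    have "(LINT \<omega>|M. sig t0 x f \<omega>) = (LINT \<omega>|M. (LINT t|lborel. ?H t \<omega>))"
      by (rule Bochner_Integration.integral_cong[OF refl sig_eq])
    also have "\<dots> = (LINT t|lborel. (LINT \<omega>|M. ?H t \<omega>))" by (rule P.Fubini_integral[OF H_int])
    also have "\<dots> = (LINT t:{t0..}|lborel. scalar_prod (f t) (expect_vec M k (x t)))"
      unfolding set_lebesgue_integral_def mean_eq ..
    finally show ?thesis using int by blast
  qed
  ultimately show "mean_of_signal M t0 k (sig t0 x) (\<lambda>t. expect_vec M k (x t))"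
    unfolding mean_of_signal_def by blast
qed

text \<open>Testing with the indicator function of \<open>[t0, t]\<close> times a unit vector carries the integrated
  differential equation over to the means.\<close>
lemma mean_of_solution:
  assumes M: "prob_space M" and x: "second_order_process M t0 k x" and s: "solves M t0 k x g"
    and g: "mean_of_signal M t0 k g m" and t: "t0 \<le> t" and i: "i < k"
  shows "expect_vec M k (x t) $ i = expect_vec M k (x t0) $ i + (LINT s:{t0..t}|lborel. m s $ i)"
proof -
  interpret prob_space M by fact
  let ?f = "\<lambda>s. if s \<in> {t0..t} then unit_vec k i else (0\<^sub>v k :: real vec)"
  have f: "test_fun t0 k ?f"
    unfolding test_fun_def
  proof (intro conjI allI impI)
    show "set_borel_measurable lborel {t0..} (\<lambda>s. ?f s $ j)" if "j < k" for j
    proof -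
      have "(\<lambda>s. indicator {t0..} s *\<^sub>R ?f s $ j) = (\<lambda>s. indicator {t0..t} s *\<^sub>R (if j = i then 1 else 0))"
        using that i by (auto simp: indicator_def fun_eq_iff)
      then show ?thesis unfolding set_borel_measurable_def by simp
    qed
    show "\<exists>b T. \<forall>s\<ge>t0. (\<forall>j<k. \<bar>?f s $ j\<bar> \<le> b) \<and> (T < s \<longrightarrow> ?f s = 0\<^sub>v k)"
      using i by (intro exI[of _ 1] exI[of _ t]) auto
  qed auto
  have int: "integrable M (\<lambda>\<omega>. x t0 \<omega> $ i)" "integrable M (g ?f)"
    using mean_of_process(2)[OF M x order_refl i] mean_of_signal_integrable[OF g f] by auto
  have "expect_vec M k (x t) $ i = (LINT \<omega>|M. x t \<omega> $ i)" using i by (simp add: expect_vec_def)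
  also have "\<dots> = (LINT \<omega>|M. x t0 \<omega> $ i + g ?f \<omega>)"
  proof (rule integral_cong_AE)
    show "AE \<omega> in M. x t \<omega> $ i = x t0 \<omega> $ i + g ?f \<omega>" using s t i unfolding solves_def by blast
    show "(\<lambda>\<omega>. x t \<omega> $ i) \<in> borel_measurable M"
      using mean_of_process(2)[OF M x t i] by simp
    show "(\<lambda>\<omega>. x t0 \<omega> $ i + g ?f \<omega>) \<in> borel_measurable M"
      by (intro borel_measurable_add borel_measurable_integrable int)
  qed
  also have "\<dots> = (LINT \<omega>|M. x t0 \<omega> $ i) + (LINT \<omega>|M. g ?f \<omega>)"
    by (rule Bochner_Integration.integral_add[OF int])
  also have "(LINT \<omega>|M. g ?f \<omega>) = (LINT s:{t0..}|lborel. scalar_prod (?f s) (m s))"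
    by (rule mean_of_signal_eq[OF g f])
  also have "\<dots> = (LINT s:{t0..t}|lborel. m s $ i)"
    unfolding set_lebesgue_integral_def
  proof (rule Bochner_Integration.integral_cong[OF refl])
    fix s
    show "indicator {t0..} s *\<^sub>R scalar_prod (?f s) (m s) = indicator {t0..t} s *\<^sub>R m s $ i"
      using mean_of_signal_carrier[OF g, of s] i by (auto simp: indicator_def)
  qed
  finally show ?thesis using i by (simp add: expect_vec_def)
qed

text \<open>Bootstrapping regularity: a locally bounded solution of the integral equation is continuous,
  hence its right-hand side is continuous, hence it is differentiable.\<close>
lemma lin_solution_of_integral_equation:
  assumes F: "cont_mat t0 n n F" and e: "locally_bounded_vec t0 n e"
    and eq: "\<And>t i. t0 \<le> t \<Longrightarrow> i < n \<Longrightarrow> e t $ i = e t0 $ i + (LINT s:{t0..t}|lborel. (F s *\<^sub>v e s) $ i)"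
  shows "lin_solution n F t0 e"
    and "\<And>i. i < n \<Longrightarrow> continuous_on {t0..} (\<lambda>t. e t $ i)"
proof -
  have lb: "locally_bounded_vec t0 n (\<lambda>t. F t *\<^sub>v e t)" by (rule locally_bounded_vec_mult[OF F e])
  have c: "e t \<in> carrier_vec n" if "t0 \<le> t" for t by (rule locally_bounded_vec_carrier[OF e that])
  have int: "set_integrable lborel {t0..t} (\<lambda>s. (F s *\<^sub>v e s) $ i)" if "i < n" for t i
    by (rule locally_bounded_vec_integrable_Icc[OF lb that])
  have eq': "e t $ i = e t0 $ i + integral {t0..t} (\<lambda>s. (F s *\<^sub>v e s) $ i)" if "t0 \<le> t" "i < n" for t i
    using eq[OF that] set_borel_integral_eq_integral(2)[OF int[OF that(2)]] by simp
  have cont_Icc: "continuous_on {t0..T} (\<lambda>t. e t $ i)" if i: "i < n" for T i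
  proof (rule continuous_on_eq)
    show "continuous_on {t0..T} (\<lambda>t. e t0 $ i + integral {t0..t} (\<lambda>s. (F s *\<^sub>v e s) $ i))"
      by (intro continuous_on_add continuous_on_const indefinite_integral_continuous_1
          set_borel_integral_eq_integral(1) int i)
    show "e t0 $ i + integral {t0..t} (\<lambda>s. (F s *\<^sub>v e s) $ i) = e t $ i" if "t \<in> {t0..T}" for t
      using that by (intro eq'[symmetric] i) simp
  qed
  show cont: "continuous_on {t0..} (\<lambda>t. e t $ i)" if i: "i < n" for i
    unfolding continuous_on_eq_continuous_within
  proof
    fix t assume t: "t \<in> {t0..}"
    have "continuous (at t within {t0..t + 1}) (\<lambda>t. e t $ i)"
      using cont_Icc[OF i, of "t + 1"] t by (auto simp: continuous_on_eq_continuous_within)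
    moreover have "at t within {t0..t + 1} = at t within {t0..}"
      by (rule at_within_nhd[of t "{..<t + 1}"]) auto
    ultimately show "continuous (at t within {t0..}) (\<lambda>t. e t $ i)" by (simp add: continuous_within)
  qed
  have rhs: "continuous_on {t0..} (\<lambda>s. (F s *\<^sub>v e s) $ i)" if i: "i < n" for i
  proof (rule continuous_on_eq)
    show "continuous_on {t0..} (\<lambda>s. \<Sum>j<n. F s $$ (i, j) * e s $ j)"
      by (intro continuous_on_sum continuous_on_mult cont cont_matD[OF F i]) auto
    show "(\<Sum>j<n. F s $$ (i, j) * e s $ j) = (F s *\<^sub>v e s) $ i" if "s \<in> {t0..}" for s
      using that by (intro index_mult_mat_vec_sum[of _ n n, symmetric] cont_mat_carrier[OF F] c i) auto
  qed
  show "lin_solution n F t0 e"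
    unfolding lin_solution_def
  proof (intro conjI allI impI c)
    fix t i assume t: "t0 \<le> t" and i: "i < n"
    have "((\<lambda>t. e t0 $ i + integral {t0..t} (\<lambda>s. (F s *\<^sub>v e s) $ i)) has_real_derivative
        0 + (F t *\<^sub>v e t) $ i) (at t within {t0..})"
      by (intro DERIV_add DERIV_const deriv_integral_half_line rhs i t)
    then have "((\<lambda>t. e t0 $ i + integral {t0..t} (\<lambda>s. (F s *\<^sub>v e s) $ i)) has_real_derivative
        (F t *\<^sub>v e t) $ i) (at t within {t0..})" by simp
    then show "((\<lambda>t. e t $ i) has_real_derivative (F t *\<^sub>v e t) $ i) (at t within {t0..})"
      by (rule has_derivative_half_line_cong[OF _ t]) (rule eq'[OF _ i, symmetric])
  qed
qed

section \<open>Singular value decompositions in block form\<close>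

lemma hcat_carrier:
  "A \<in> carrier_mat k r \<Longrightarrow> B \<in> carrier_mat k s \<Longrightarrow> hcat A B \<in> carrier_mat k (r + s)"
  unfolding hcat_def by auto

lemma index_hcat:
  assumes "A \<in> carrier_mat k r" "B \<in> carrier_mat k s" "i < k" "j < r + s"
  shows "hcat A B $$ (i, j) = (if j < r then A $$ (i, j) else B $$ (i, j - r))"
  using assms unfolding hcat_def by auto

lemma col_hcat:
  assumes "A \<in> carrier_mat k r" "B \<in> carrier_mat k s" "j < r + s"
  shows "col (hcat A B) j = (if j < r then col A j else col B (j - r))"
  using hcat_carrier[OF assms(1,2)] assms by (intro eq_vecI) (auto simp: index_hcat)

lemma hcat_mult_transpose:
  assumes A: "A \<in> carrier_mat k r" and B: "B \<in> carrier_mat k s"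
    and C: "C \<in> carrier_mat m r" and D: "D \<in> carrier_mat m s"
  shows "hcat A B * (hcat C D)\<^sup>T = A * C\<^sup>T + B * D\<^sup>T"
proof -
  have "(hcat C D)\<^sup>T = four_block_mat C\<^sup>T (0\<^sub>m 0 r)\<^sup>T D\<^sup>T (0\<^sub>m 0 s)\<^sup>T"
    unfolding hcat_def using C D by (subst transpose_four_block_mat[of _ m r _ s _ 0]) auto
  moreover have "hcat A B = four_block_mat A B (0\<^sub>m 0 r) (0\<^sub>m 0 s)"
    unfolding hcat_def using A B by simp
  ultimately have "hcat A B * (hcat C D)\<^sup>T = four_block_mat (A * C\<^sup>T + B * D\<^sup>T)
      (A * (0\<^sub>m 0 r)\<^sup>T + B * (0\<^sub>m 0 s)\<^sup>T) (0\<^sub>m 0 r * C\<^sup>T + 0\<^sub>m 0 s * D\<^sup>T)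
      (0\<^sub>m 0 r * (0\<^sub>m 0 r)\<^sup>T + 0\<^sub>m 0 s * (0\<^sub>m 0 s)\<^sup>T)"
    by (simp only:) (rule mult_four_block_mat, use assms in auto)
  also have "\<dots> = A * C\<^sup>T + B * D\<^sup>T"
    using assms by (intro eq_matI) auto
  finally show ?thesis .
qed

lemma hcat_mult_diagonal_block:
  assumes A: "A \<in> carrier_mat k r" and B: "B \<in> carrier_mat k s" and Z: "Z \<in> carrier_mat r r"
  shows "hcat A B * four_block_mat Z (0\<^sub>m r l) (0\<^sub>m s r) (0\<^sub>m s l) = hcat (A * Z) (0\<^sub>m k l)"
proof -
  have "hcat A B * four_block_mat Z (0\<^sub>m r l) (0\<^sub>m s r) (0\<^sub>m s l) =
    four_block_mat (A * Z + B * 0\<^sub>m s r) (A * 0\<^sub>m r l + B * 0\<^sub>m s l)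
      (0\<^sub>m 0 r * Z + 0\<^sub>m 0 s * 0\<^sub>m s r) (0\<^sub>m 0 r * 0\<^sub>m r l + 0\<^sub>m 0 s * 0\<^sub>m s l)"
    using assms unfolding hcat_def
    by (simp add: mult_four_block_mat[of A k r B s "0\<^sub>m 0 r" 0 "0\<^sub>m 0 s" Z r "0\<^sub>m r l" l "0\<^sub>m s r" "0\<^sub>m s l"])
  also have "\<dots> = hcat (A * Z) (0\<^sub>m k l)"
    unfolding hcat_def using assms by (intro cong_four_block_mat) auto
  finally show ?thesis .
qed

lemma unitary_hcat_columns:
  assumes A: "A \<in> carrier_mat k r" and B: "B \<in> carrier_mat k s" and u: "unitary (r + s) (hcat A B)"
  shows "A\<^sup>T * A = 1\<^sub>m r" "B\<^sup>T * A = 0\<^sub>m s r" "B\<^sup>T * B = 1\<^sub>m s"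
proof -
  let ?U = "hcat A B"
  have U: "?U \<in> carrier_mat k (r + s)" by (rule hcat_carrier[OF A B])
  have entry: "scalar_prod (col ?U i) (col ?U j) = (if i = j then 1 else 0)" if "i < r + s" "j < r + s" for i j
  proof -
    have "(?U\<^sup>T * ?U) $$ (i, j) = 1\<^sub>m (r + s) $$ (i, j)" using u unfolding unitary_def by simp
    then show ?thesis using U that by auto
  qed
  note cols = col_hcat[OF A B]
  show "A\<^sup>T * A = 1\<^sub>m r"
  proof (rule eq_matI)
    fix i j assume ij: "i < dim_row (1\<^sub>m r :: real mat)" "j < dim_col (1\<^sub>m r :: real mat)"
    then show "(A\<^sup>T * A) $$ (i, j) = 1\<^sub>m r $$ (i, j)"
      using entry[of i j] A by (simp add: cols)
  qed (use A in auto)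
  show "B\<^sup>T * A = 0\<^sub>m s r"
  proof (rule eq_matI)
    fix i j assume ij: "i < dim_row (0\<^sub>m s r :: real mat)" "j < dim_col (0\<^sub>m s r :: real mat)"
    then show "(B\<^sup>T * A) $$ (i, j) = 0\<^sub>m s r $$ (i, j)"
      using entry[of "i + r" j] A B by (simp add: cols)
  qed (use A B in auto)
  show "B\<^sup>T * B = 1\<^sub>m s"
  proof (rule eq_matI)
    fix i j assume ij: "i < dim_row (1\<^sub>m s :: real mat)" "j < dim_col (1\<^sub>m s :: real mat)"
    then show "(B\<^sup>T * B) $$ (i, j) = 1\<^sub>m s $$ (i, j)"
      using entry[of "i + r" "j + r"] B by (simp add: cols)
  qed (use B in auto)
qed

lemma is_svdD:
  assumes svd: "is_svd k m r H U1 U2 Z V1 V2"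
  shows "r \<le> k" "r \<le> m" "U1 \<in> carrier_mat k r" "U2 \<in> carrier_mat k (k - r)" "V1 \<in> carrier_mat m r"
    "V2 \<in> carrier_mat m (m - r)" "Z \<in> carrier_mat r r" "invertible_mat Z"
    "U1\<^sup>T * U1 = 1\<^sub>m r" "U2\<^sup>T * U1 = 0\<^sub>m (k - r) r" "U2\<^sup>T * U2 = 1\<^sub>m (k - r)"
    "V1 * V1\<^sup>T + V2 * V2\<^sup>T = 1\<^sub>m m" "H = U1 * Z * V1\<^sup>T"
proof -
  show r: "r \<le> k" "r \<le> m" and c: "U1 \<in> carrier_mat k r" "U2 \<in> carrier_mat k (k - r)"
    "V1 \<in> carrier_mat m r" "V2 \<in> carrier_mat m (m - r)" "Z \<in> carrier_mat r r"
    using svd unfolding is_svd_def by auto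
  show "invertible_mat Z"
    using svd invertible_matI_det[OF c(5)] vec_space.det_rank_iff[OF c(5)] unfolding is_svd_def by auto
  have "unitary (r + (k - r)) (hcat U1 U2)" using svd r unfolding is_svd_def by simp
  from unitary_hcat_columns[OF c(1,2) this]
  show "U1\<^sup>T * U1 = 1\<^sub>m r" "U2\<^sup>T * U1 = 0\<^sub>m (k - r) r" "U2\<^sup>T * U2 = 1\<^sub>m (k - r)" .
  show "V1 * V1\<^sup>T + V2 * V2\<^sup>T = 1\<^sub>m m"
    using svd hcat_mult_transpose[OF c(3,4) c(3,4)] unfolding is_svd_def unitary_def by auto
  have "H = hcat (U1 * Z) (0\<^sub>m k (m - r)) * (hcat V1 V2)\<^sup>T"
    using svd hcat_mult_diagonal_block[OF c(1,2,5)] unfolding is_svd_def by auto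
  also have "\<dots> = U1 * Z * V1\<^sup>T + 0\<^sub>m k (m - r) * V2\<^sup>T"
    using c by (intro hcat_mult_transpose) auto
  also have "\<dots> = U1 * Z * V1\<^sup>T" using c by (simp add: left_mult_zero_mat[of _ "m - r" m])
  finally show "H = U1 * Z * V1\<^sup>T" .
qed

text \<open>Orthonormal columns make \<open>U\<close> injective, and congruence with an injective matrix preserves
  definiteness.\<close>
lemma pos_def_congruence:
  assumes R: "pos_def k R" and U: "U \<in> carrier_mat k r" and orth: "U\<^sup>T * U = 1\<^sub>m r"
  shows "pos_def r (U\<^sup>T * R * U)"
proof -
  have Rc: "R \<in> carrier_mat k k" "R\<^sup>T = R" using R by (auto simp: pos_def_def)
  have c: "U\<^sup>T * R * U \<in> carrier_mat r r" using U Rc by simp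
  have "(U\<^sup>T * R * U)\<^sup>T = U\<^sup>T * R * U"
  proof -
    have "(U\<^sup>T * R * U)\<^sup>T = U\<^sup>T * (U\<^sup>T * R)\<^sup>T" using U Rc by (intro transpose_mult[of _ r k]) auto
    also have "(U\<^sup>T * R)\<^sup>T = R\<^sup>T * U\<^sup>T\<^sup>T" using U Rc by (intro transpose_mult[of _ r k]) auto
    also have "U\<^sup>T * (R\<^sup>T * U\<^sup>T\<^sup>T) = U\<^sup>T * R * U"
      using U Rc by (simp add: assoc_mult_mat[of _ r k _ k _ r])
    finally show ?thesis .
  qed
  moreover have "0 < scalar_prod a ((U\<^sup>T * R * U) *\<^sub>v a)" if a: "a \<in> carrier_vec r" "a \<noteq> 0\<^sub>v r" for a
  proof -
    have Ua: "U *\<^sub>v a \<in> carrier_vec k" using U a by simp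
    have "U *\<^sub>v a \<noteq> 0\<^sub>v k"
    proof
      assume z: "U *\<^sub>v a = 0\<^sub>v k"
      have "a = (U\<^sup>T * U) *\<^sub>v a" using orth a by simp
      also have "\<dots> = U\<^sup>T *\<^sub>v (U *\<^sub>v a)" using U a by (subst assoc_mult_mat_vec[of _ r k _ r]) auto
      also have "\<dots> = 0\<^sub>v r" unfolding z using U by (intro eq_vecI) auto
      finally show False using a by simp
    qed
    then have "0 < scalar_prod (U *\<^sub>v a) (R *\<^sub>v (U *\<^sub>v a))" using R Ua by (auto simp: pos_def_def)
    also have "\<dots> = scalar_prod (R *\<^sub>v (U *\<^sub>v a)) (U *\<^sub>v a)"
      using Ua Rc by (intro comm_scalar_prod) auto
    also have "\<dots> = scalar_prod (U\<^sup>T *\<^sub>v (R *\<^sub>v (U *\<^sub>v a))) a"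
      using U Rc Ua a by (intro transpose_vec_mult_scalar[symmetric]) auto
    also have "\<dots> = scalar_prod a (U\<^sup>T *\<^sub>v (R *\<^sub>v (U *\<^sub>v a)))"
      using U Rc Ua a by (intro comm_scalar_prod[of _ r]) auto
    also have "U\<^sup>T *\<^sub>v (R *\<^sub>v (U *\<^sub>v a)) = (U\<^sup>T * R * U) *\<^sub>v a"
      using U Rc a Ua by (simp add: assoc_mult_mat_vec[of _ r k _ r] assoc_mult_mat_vec[of _ r k _ k])
    finally show ?thesis .
  qed
  ultimately show ?thesis using c by (auto simp: pos_def_def)
qed

section \<open>Cancellation of the unknown input in the filter equations\<close>

text \<open>Expanding all matrix expressions acting on vectors into sums of iterated products; the side
  conditions are equations between dimensions, which the simplifier computes.\<close>

lemma mult_mat_vec_assoc_dim: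
  "dim_col A = dim_row B \<Longrightarrow> dim_vec v = dim_col B \<Longrightarrow> (A * B) *\<^sub>v (v :: real vec) = A *\<^sub>v (B *\<^sub>v v)"
  by (rule assoc_mult_mat_vec[of _ "dim_row A" "dim_row B" _ "dim_col B"]) (auto intro: carrier_matI carrier_vecI)

lemma mult_mat_vec_add_dim:
  "dim_vec v = dim_col A \<Longrightarrow> dim_vec w = dim_col A \<Longrightarrow> A *\<^sub>v (v + w) = A *\<^sub>v v + A *\<^sub>v (w :: real vec)"
  by (rule mult_add_distrib_mat_vec[of _ "dim_row A" "dim_col A"]) (auto intro: carrier_matI carrier_vecI)

lemma mult_mat_vec_minus_dim:
  "dim_vec v = dim_col A \<Longrightarrow> dim_vec w = dim_col A \<Longrightarrow> A *\<^sub>v (v - w) = A *\<^sub>v v - A *\<^sub>v (w :: real vec)"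
  by (rule mult_minus_distrib_mat_vec[of _ "dim_row A" "dim_col A"]) (auto intro: carrier_matI carrier_vecI)

lemma add_mat_mult_vec_dim:
  "dim_row A = dim_row B \<Longrightarrow> dim_col A = dim_col B \<Longrightarrow> dim_vec v = dim_col B \<Longrightarrow>
    (A + B) *\<^sub>v v = A *\<^sub>v v + B *\<^sub>v (v :: real vec)"
  by (rule add_mult_distrib_mat_vec[of _ "dim_row B" "dim_col B"]) (auto intro: carrier_matI carrier_vecI)

lemma minus_mat_mult_vec_dim:
  "dim_row A = dim_row B \<Longrightarrow> dim_col A = dim_col B \<Longrightarrow> dim_vec v = dim_col B \<Longrightarrow>
    (A - B) *\<^sub>v v = A *\<^sub>v v - B *\<^sub>v (v :: real vec)"
  by (rule minus_mult_distrib_mat_vec[of _ "dim_row B" "dim_col B"]) (auto intro: carrier_matI carrier_vecI)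

lemma one_mat_mult_vec_dim: "dim_vec v = k \<Longrightarrow> 1\<^sub>m k *\<^sub>v v = (v :: real vec)"
  by (rule one_mult_mat_vec) (auto intro: carrier_vecI)

lemma mult_mat_zero_vec_dim: "dim_col A = k \<Longrightarrow> A *\<^sub>v 0\<^sub>v k = (0\<^sub>v (dim_row A) :: real vec)"
  by (intro eq_vecI) auto

lemmas mat_vec_expand = mult_mat_vec_assoc_dim mult_mat_vec_add_dim mult_mat_vec_minus_dim
  add_mat_mult_vec_dim minus_mat_mult_vec_dim one_mat_mult_vec_dim mult_mat_zero_vec_dim

text \<open>With \<open>d = V\<^sub>1 a + V\<^sub>2 b\<close>, the first estimate reproduces \<open>a\<close> and the second one \<open>b\<close>, each up to a
  linear function of the state error. The known input cancels as the filter subtracts it.\<close>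
lemma filter_error_algebra:
  fixes A B G C D H Cb Cbb Db Dbb Hb Hbb V1 V2 T1 T2 T2b M1 M2 L :: "real mat"
    and x xh u u' d d' a b :: "real vec"
  assumes dims:
    "A \<in> carrier_mat n n" "B \<in> carrier_mat n m" "G \<in> carrier_mat n p" "W \<in> carrier_mat n q"
    "C \<in> carrier_mat l n" "D \<in> carrier_mat l m" "H \<in> carrier_mat l p"
    "Cb \<in> carrier_mat lb n" "Cbb \<in> carrier_mat lb n" "Db \<in> carrier_mat lb m"
    "Dbb \<in> carrier_mat lb m" "Hb \<in> carrier_mat lb p" "Hbb \<in> carrier_mat lb p"
    "V1 \<in> carrier_mat p r" "V2 \<in> carrier_mat p r2"
    "T1 \<in> carrier_mat r l" "T2 \<in> carrier_mat l2 l" "T2b \<in> carrier_mat rb lb"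
    "M1 \<in> carrier_mat r r" "M2 \<in> carrier_mat r2 rb" "L \<in> carrier_mat n l2"
    and vecs: "x \<in> carrier_vec n" "xh \<in> carrier_vec n" "u \<in> carrier_vec m" "u' \<in> carrier_vec m"
      "d \<in> carrier_vec p" "d' \<in> carrier_vec p" "a \<in> carrier_vec r" "b \<in> carrier_vec r2"
    and split: "d = V1 *\<^sub>v a + V2 *\<^sub>v b"
    and first: "M1 *\<^sub>v (T1 *\<^sub>v (H *\<^sub>v d)) = a" and second: "T2 *\<^sub>v (H *\<^sub>v d) = 0\<^sub>v l2"
    and third: "M2 *\<^sub>v (T2b *\<^sub>v (Cb *\<^sub>v (G *\<^sub>v (V2 *\<^sub>v b)))) = b"
    and zero: "T2b *\<^sub>v (Hb *\<^sub>v d') = 0\<^sub>v rb" "T2b *\<^sub>v (Hbb *\<^sub>v d) = 0\<^sub>v rb"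
  defines "xdot \<equiv> A *\<^sub>v x + B *\<^sub>v u + G *\<^sub>v d + W *\<^sub>v 0\<^sub>v q"
    and "y \<equiv> C *\<^sub>v x + D *\<^sub>v u + H *\<^sub>v d + 0\<^sub>v l"
  defines "yb \<equiv> Cb *\<^sub>v xdot + Cbb *\<^sub>v x + Db *\<^sub>v u' + Dbb *\<^sub>v u + Hb *\<^sub>v d' + Hbb *\<^sub>v d + 0\<^sub>v lb"
    and "d1 \<equiv> M1 *\<^sub>v (T1 *\<^sub>v y - (T1 * C) *\<^sub>v xh - (T1 * D) *\<^sub>v u)"
  defines "d2 \<equiv> M2 *\<^sub>v (T2b *\<^sub>v yb - (T2b * Cb * A + T2b * Cbb) *\<^sub>v xh - (T2b * Cb * B) *\<^sub>v u
      - (T2b * Cb * (G * V1)) *\<^sub>v d1 - (T2b * Db) *\<^sub>v u' - (T2b * Dbb) *\<^sub>v u)"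
    and "Ah \<equiv> A - G * V1 * M1 * (T1 * C)"
  defines "E \<equiv> T2b * Cb * Ah + T2b * Cbb"
  shows "d - (V1 *\<^sub>v d1 + V2 *\<^sub>v d2)
      = - ((V1 * M1 * (T1 * C)) *\<^sub>v (x - xh) + (V2 * M2 * E) *\<^sub>v (x - xh))"
    and "xdot - (A *\<^sub>v xh + B *\<^sub>v u + (G * V1) *\<^sub>v d1 + (G * V2) *\<^sub>v d2
        + L *\<^sub>v (T2 *\<^sub>v y - (T2 * C) *\<^sub>v xh - (T2 * D) *\<^sub>v u))
      = ((1\<^sub>m n - G * V2 * M2 * (T2b * Cb)) * Ah - G * V2 * M2 * T2b * Cbb - L * (T2 * C)) *\<^sub>v (x - xh)"
proof -
  note ds = dims[THEN carrier_matD(1)] dims[THEN carrier_matD(2)] vecs[THEN carrier_vecD]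
  note ex = mat_vec_expand ds
  define e where "e = x - xh"
  have e: "e \<in> carrier_vec n" using vecs by (simp add: e_def)
  have de: "dim_vec e = n" using e by simp
  have d1: "d1 = M1 *\<^sub>v (T1 *\<^sub>v (C *\<^sub>v e)) + a"
    unfolding d1_def y_def e_def
    by (rule eq_vecI) (simp_all add: ex first del: index_mult_mat_vec)
  have Gd: "G *\<^sub>v d = G *\<^sub>v (V1 *\<^sub>v a) + G *\<^sub>v (V2 *\<^sub>v b)"
    unfolding split by (simp add: ex)
  have d2: "d2 = M2 *\<^sub>v (E *\<^sub>v e) + b"
    unfolding d2_def d1 yb_def xdot_def E_def Ah_def Gd e_def
    by (rule eq_vecI) (simp_all add: ex third zero del: index_mult_mat_vec)
  have Ec: "dim_row E = rb" "dim_col E = n" unfolding E_def Ah_def using ds by simp_all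
  show "d - (V1 *\<^sub>v d1 + V2 *\<^sub>v d2)
      = - ((V1 * M1 * (T1 * C)) *\<^sub>v (x - xh) + (V2 * M2 * E) *\<^sub>v (x - xh))"
    unfolding d1 d2 e_def[symmetric] by (subst split, rule eq_vecI) (simp_all add: ex de Ec del: index_mult_mat_vec)
  show "xdot - (A *\<^sub>v xh + B *\<^sub>v u + (G * V1) *\<^sub>v d1 + (G * V2) *\<^sub>v d2
        + L *\<^sub>v (T2 *\<^sub>v y - (T2 * C) *\<^sub>v xh - (T2 * D) *\<^sub>v u))
      = ((1\<^sub>m n - G * V2 * M2 * (T2b * Cb)) * Ah - G * V2 * M2 * T2b * Cbb - L * (T2 * C)) *\<^sub>v (x - xh)"
    unfolding d1 d2 xdot_def y_def Gd E_def Ah_def e_def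
    by (rule eq_vecI) (simp_all add: ex second del: index_mult_mat_vec)
qed

section \<open>Continuity of the filter matrices\<close>

context elise
begin

abbreviation "t0 \<equiv> tini S"

lemma cont_inputs:
  "cont_mat t0 (dn S) (dn S) (mA S)" "cont_mat t0 (dn S) (dm S) (mB S)"
  "cont_mat t0 (dn S) (dp S) (mG S)" "cont_mat t0 (dl S) (dn S) (mC S)"
  "cont_mat t0 (dl S) (dm S) (mD S)" "cont_mat t0 (dn S) (dq S) (mW S)"
  using smooth by (auto intro: cont_mat_smooth)

lemma pos_def_U2RU2:
  assumes "t \<ge> t0"
  shows "pos_def (dl S - pH S) ((mU2 S t)\<^sup>T * mR S t * mU2 S t)"
  using is_svdD[OF H_svd[OF assms]] cov_def(2)[OF assms] by (intro pos_def_congruence) auto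

lemma cont_H: "cont_mat t0 (dl S) (dp S) (mH S)"
proof -
  have c: "cont_mat t0 (dl S) (dp S) (\<lambda>t. mU1 S t * mSig S t * (mV1 S t)\<^sup>T)"
    by (rule cont_mat_mult[OF cont_mat_mult[OF H_svd_cont(1,3)] cont_mat_transpose[OF H_svd_cont(4)]])
  show ?thesis
  proof (rule cont_matI)
    show "continuous_on {t0..} (\<lambda>t. (mU1 S t * mSig S t * (mV1 S t)\<^sup>T) $$ (i, j))"
      if "i < dl S" "j < dp S" for i j
      by (rule cont_matD[OF c that])
  qed (use cont_mat_carrier[OF c] is_svdD(13)[OF H_svd] in auto)
qed

lemma cont_T:
  "cont_mat t0 (pH S) (dl S) (mT1 S)" "cont_mat t0 (dl S - pH S) (dl S) (mT2 S)"
  "cont_mat t0 (dlb S - pHb S) (dlb S) (mT2b S)"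
proof -
  note U1T = cont_mat_transpose[OF H_svd_cont(1)] and U2T = cont_mat_transpose[OF H_svd_cont(2)]
  note X = cont_mat_minv[OF cont_mat_mult[OF cont_mat_mult[OF U2T cov_cont(2)] H_svd_cont(2)]
      pos_def_invertible[OF pos_def_U2RU2]]
  show "cont_mat t0 (pH S) (dl S) (mT1 S)"
    unfolding mT1_def[abs_def]
    by (rule cont_mat_diff[OF U1T cont_mat_mult[OF cont_mat_mult[OF
          cont_mat_mult[OF cont_mat_mult[OF U1T cov_cont(2)] H_svd_cont(2)] X] U2T]])
  show "cont_mat t0 (dl S - pH S) (dl S) (mT2 S)" unfolding mT2_def[abs_def] by (rule U2T)
  show "cont_mat t0 (dlb S - pHb S) (dlb S) (mT2b S)"
    unfolding mT2b_def[abs_def] by (rule cont_mat_transpose[OF Hb_svd_cont])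
qed

lemma cont_blocks:
  "cont_mat t0 (dn S) (pH S) (mG1 S)" "cont_mat t0 (dn S) (dp S - pH S) (mG2 S)"
  "cont_mat t0 (pH S) (dn S) (mC1 S)" "cont_mat t0 (dl S - pH S) (dn S) (mC2 S)"
  "cont_mat t0 (pH S) (dm S) (mD1 S)" "cont_mat t0 (dl S - pH S) (dm S) (mD2 S)"
  "cont_mat t0 (dlb S - pHb S) (dn S) (mC2b S)" "cont_mat t0 (dlb S - pHb S) (dm S) (mD2b S)"
  "cont_mat t0 (pH S) (pH S) (mR1 S)" "cont_mat t0 (dl S - pH S) (dl S - pH S) (mR2 S)"
  "cont_mat t0 (dlb S - pHb S) (dlb S - pHb S) (mR2b S)"
  "cont_mat t0 (dl S - pH S) (dlb S - pHb S) (mR2g S)" "cont_mat t0 (pH S) (dlb S - pHb S) (mR12g S)"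
  unfolding mG1_def[abs_def] mG2_def[abs_def] mC1_def[abs_def] mC2_def[abs_def] mD1_def[abs_def]
    mD2_def[abs_def] mC2b_def[abs_def] mD2b_def[abs_def] mR1_def[abs_def] mR2_def[abs_def]
    mR2b_def[abs_def] mR2g_def[abs_def] mR12g_def[abs_def]
  by (intro cont_mat_mult[OF cont_inputs(3)] H_svd_cont cont_mat_mult[OF cont_T(1)] cont_mat_mult[OF cont_T(2)]
      cont_mat_mult[OF cont_T(3)] cont_inputs yb_cont
      cont_mat_mult[OF cont_mat_mult[OF cont_T(1) cov_cont(2)] cont_mat_transpose[OF cont_T(1)]]
      cont_mat_mult[OF cont_mat_mult[OF cont_T(2) cov_cont(2)] cont_mat_transpose[OF cont_T(2)]]
      cont_mat_mult[OF cont_mat_mult[OF cont_T(3) cov_cont(4)] cont_mat_transpose[OF cont_T(3)]]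
      cont_mat_mult[OF cont_mat_mult[OF cont_T(2) cov_cont(3)] cont_mat_transpose[OF cont_T(3)]]
      cont_mat_mult[OF cont_mat_mult[OF cont_T(1) cov_cont(3)] cont_mat_transpose[OF cont_T(3)]])+

lemma cont_M1: "cont_mat t0 (pH S) (pH S) (mM1 S)"
  unfolding mM1_def[abs_def]
  by (intro cont_mat_minv H_svd_cont) (rule is_svdD(8)[OF H_svd])

lemma cont_Ahat: "cont_mat t0 (dn S) (dn S) (mAhat S)"
  unfolding mAhat_def[abs_def]
  by (intro cont_mat_diff cont_mat_mult[OF cont_mat_mult[OF cont_blocks(1) cont_M1] cont_blocks(3)] cont_inputs)

lemma cont_Qhat: "cont_mat t0 (dn S) (dn S) (mQhat S)"
  unfolding mQhat_def[abs_def]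
  by (intro cont_mat_add cont_mat_mult[OF cont_mat_mult[OF cont_inputs(6) cov_cont(1)] cont_mat_transpose[OF cont_inputs(6)]]
      cont_mat_mult[OF cont_mat_mult[OF cont_mat_mult[OF cont_mat_mult[OF cont_blocks(1) cont_M1] cont_blocks(9)]
        cont_mat_transpose[OF cont_M1]] cont_mat_transpose[OF cont_blocks(1)]])

lemma cont_E: "cont_mat t0 (dlb S - pHb S) (dn S) (mE S)"
  unfolding mE_def[abs_def]
  by (intro cont_mat_add cont_mat_mult[OF cont_blocks(7) cont_Ahat] cont_mat_mult[OF cont_T(3) yb_cont(2)])

lemma cont_P: "cont_mat t0 (dn S) (dn S) (mP S)"
  by (rule cont_mat_has_deriv[OF riccati])

lemma cont_R2tilde: "cont_mat t0 (dlb S - pHb S) (dlb S - pHb S) (mR2tilde S)"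
  unfolding mR2tilde_def[abs_def]
  by (intro cont_mat_add cont_mat_diff cont_blocks(11)
      cont_mat_mult[OF cont_mat_mult[OF cont_E cont_P] cont_mat_transpose[OF cont_E]]
      cont_mat_mult[OF cont_mat_mult[OF cont_blocks(7) cont_Qhat] cont_mat_transpose[OF cont_blocks(7)]]
      cont_mat_mult[OF cont_mat_mult[OF cont_mat_mult[OF cont_mat_transpose[OF cont_blocks(13)]
        cont_mat_transpose[OF cont_M1]] cont_mat_transpose[OF cont_blocks(1)]] cont_mat_transpose[OF cont_blocks(7)]]
      cont_mat_mult[OF cont_mat_mult[OF cont_mat_mult[OF cont_blocks(7) cont_blocks(1)] cont_M1] cont_blocks(13)])

lemma cont_minv_R2tilde: "cont_mat t0 (dlb S - pHb S) (dlb S - pHb S) (\<lambda>t. minv (mR2tilde S t))"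
  by (rule cont_mat_minv[OF cont_R2tilde filter_defined(1)])

lemma cont_N2: "cont_mat t0 (dp S - pH S) (dp S - pH S) (mN2 S)"
  unfolding mN2_def[abs_def]
  by (rule cont_mat_mult[OF cont_mat_mult[OF cont_mat_mult[OF cont_mat_mult[OF
      cont_mat_transpose[OF cont_blocks(2)] cont_mat_transpose[OF cont_blocks(7)]] cont_minv_R2tilde]
      cont_blocks(7)] cont_blocks(2)])

lemma cont_M2: "cont_mat t0 (dp S - pH S) (dlb S - pHb S) (mM2 S)"
  unfolding mM2_def[abs_def]
  by (rule cont_mat_mult[OF cont_mat_mult[OF cont_mat_mult[OF cont_mat_minv[OF cont_N2 filter_defined(2)]
      cont_mat_transpose[OF cont_blocks(2)]] cont_mat_transpose[OF cont_blocks(7)]] cont_minv_R2tilde])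

lemma cont_L: "cont_mat t0 (dn S) (dl S - pH S) (mL S)"
  unfolding mL_def[abs_def]
proof (rule cont_mat_mult)
  show "cont_mat t0 (dn S) (dl S - pH S) (\<lambda>t. mP S t * (mC2 S t)\<^sup>T - mG2 S t * mM2 S t * (mR2g S t)\<^sup>T)"
    by (intro cont_mat_diff cont_mat_mult[OF cont_P cont_mat_transpose[OF cont_blocks(4)]]
        cont_mat_mult[OF cont_mat_mult[OF cont_blocks(2) cont_M2] cont_mat_transpose[OF cont_blocks(12)]])
  have "invertible_mat (mR2 S t)" if "t \<ge> t0" for t
    using pos_def_invertible[OF pos_def_U2RU2[OF that]] by (simp add: mR2_def mT2_def)
  then show "cont_mat t0 (dl S - pH S) (dl S - pH S) (\<lambda>t. minv (mR2 S t))"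
    by (intro cont_mat_minv cont_blocks)
qed

lemma cont_Abreve: "cont_mat t0 (dn S) (dn S) (mAbreve S)"
  unfolding mAbreve_def[abs_def] mAbar_def[abs_def]
  by (intro cont_mat_diff cont_mat_const one_carrier_mat
      cont_mat_mult[OF cont_L cont_blocks(4)]
      cont_mat_mult[OF cont_mat_mult[OF cont_mat_mult[OF cont_blocks(2) cont_M2] cont_T(3)] yb_cont(2)]
      cont_mat_mult[OF _ cont_Ahat]
      cont_mat_mult[OF cont_mat_mult[OF cont_blocks(2) cont_M2] cont_blocks(7)])


section \<open>Exactness of the input estimates\<close>

lemma carriers:
  assumes t: "t \<ge> t0"
  shows "mA S t \<in> carrier_mat (dn S) (dn S)" "mB S t \<in> carrier_mat (dn S) (dm S)"
    "mG S t \<in> carrier_mat (dn S) (dp S)" "mW S t \<in> carrier_mat (dn S) (dq S)"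
    "mC S t \<in> carrier_mat (dl S) (dn S)" "mD S t \<in> carrier_mat (dl S) (dm S)"
    "mH S t \<in> carrier_mat (dl S) (dp S)" "mCb S t \<in> carrier_mat (dlb S) (dn S)"
    "mCbb S t \<in> carrier_mat (dlb S) (dn S)" "mDb S t \<in> carrier_mat (dlb S) (dm S)"
    "mDbb S t \<in> carrier_mat (dlb S) (dm S)" "mHb S t \<in> carrier_mat (dlb S) (dp S)"
    "mHbb S t \<in> carrier_mat (dlb S) (dp S)" "mV1 S t \<in> carrier_mat (dp S) (pH S)"
    "mV2 S t \<in> carrier_mat (dp S) (dp S - pH S)" "mT1 S t \<in> carrier_mat (pH S) (dl S)"
    "mT2 S t \<in> carrier_mat (dl S - pH S) (dl S)" "mT2b S t \<in> carrier_mat (dlb S - pHb S) (dlb S)"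
    "mM1 S t \<in> carrier_mat (pH S) (pH S)" "mM2 S t \<in> carrier_mat (dp S - pH S) (dlb S - pHb S)"
    "mL S t \<in> carrier_mat (dn S) (dl S - pH S)"
  using cont_inputs cont_H yb_cont H_svd_cont cont_T cont_M1 cont_M2 cont_L t
  by (auto intro: cont_mat_carrier)

text \<open>The correction term of \<open>T\<^sub>1\<close> vanishes on the range of \<open>U\<^sub>1\<close>, because \<open>U\<^sub>2\<^sup>T U\<^sub>1 = 0\<close>. Hence
  \<open>T\<^sub>1 H = \<Sigma> V\<^sub>1\<^sup>T\<close>, and \<open>M\<^sub>1\<close> inverts \<open>\<Sigma>\<close>.\<close>
lemma first_estimate_exact:
  assumes t: "t \<ge> t0" and d: "\<delta> \<in> carrier_vec (dp S)"
  shows "mM1 S t *\<^sub>v (mT1 S t *\<^sub>v (mH S t *\<^sub>v \<delta>)) = (mV1 S t)\<^sup>T *\<^sub>v \<delta>"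
    and "mT2 S t *\<^sub>v (mH S t *\<^sub>v \<delta>) = 0\<^sub>v (dl S - pH S)"
proof -
  note svd = is_svdD[OF H_svd[OF t]]
  define X where "X = minv ((mU2 S t)\<^sup>T * mR S t * mU2 S t)"
  have X: "X \<in> carrier_mat (dl S - pH S) (dl S - pH S)"
    unfolding X_def using pos_def_U2RU2[OF t] by (intro minv pos_def_invertible) (auto simp: pos_def_def)
  have R: "mR S t \<in> carrier_mat (dl S) (dl S)" using cov_def(2)[OF t] by (simp add: pos_def_def)
  define a where "a = (mV1 S t)\<^sup>T *\<^sub>v \<delta>"
  have a: "a \<in> carrier_vec (pH S)" unfolding a_def using svd(5) d by simp
  define s where "s = mSig S t *\<^sub>v a"
  have s: "s \<in> carrier_vec (pH S)" unfolding s_def using svd(7) a by simp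
  note ds = svd(3-7)[THEN carrier_matD(1)] svd(3-7)[THEN carrier_matD(2)]
    carrier_matD[OF X] carrier_matD[OF R] carrier_vecD[OF d] carrier_vecD[OF a] carrier_vecD[OF s]
  have H: "mH S t *\<^sub>v \<delta> = mU1 S t *\<^sub>v s"
    unfolding svd(13) s_def a_def by (simp add: mat_vec_expand ds)
  have U11: "(mU1 S t)\<^sup>T *\<^sub>v (mU1 S t *\<^sub>v s) = s"
    using arg_cong[OF svd(9), of "\<lambda>K. K *\<^sub>v s"] by (simp add: mat_vec_expand ds)
  have U21: "(mU2 S t)\<^sup>T *\<^sub>v (mU1 S t *\<^sub>v s) = 0\<^sub>v (dl S - pH S)"
  proof -
    have "(mU2 S t)\<^sup>T *\<^sub>v (mU1 S t *\<^sub>v s) = 0\<^sub>m (dl S - pH S) (pH S) *\<^sub>v s"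
      using arg_cong[OF svd(10), of "\<lambda>K. K *\<^sub>v s"] by (simp add: mat_vec_expand ds)
    also have "\<dots> = 0\<^sub>v (dl S - pH S)" using s by (intro eq_vecI) auto
    finally show ?thesis .
  qed
  show "mT2 S t *\<^sub>v (mH S t *\<^sub>v \<delta>) = 0\<^sub>v (dl S - pH S)" unfolding mT2_def H by (rule U21)
  have "mT1 S t *\<^sub>v (mH S t *\<^sub>v \<delta>) = s"
    unfolding mT1_def X_def[symmetric] H
    by (rule eq_vecI) (simp_all add: mat_vec_expand ds U11 U21 del: index_mult_mat_vec)
  then show "mM1 S t *\<^sub>v (mT1 S t *\<^sub>v (mH S t *\<^sub>v \<delta>)) = (mV1 S t)\<^sup>T *\<^sub>v \<delta>"
    using arg_cong[OF minv(3)[OF svd(7,8)], of "\<lambda>K. K *\<^sub>v a"] minv(1)[OF svd(7,8)]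
    by (simp add: mM1_def s_def a_def[symmetric] mat_vec_expand ds)
qed

text \<open>A weighted least squares estimator recovers the parameter from exact data; the design matrix is
  the product of the additional output matrix with \<open>G\<^sub>2\<close>.\<close>
lemma second_estimate_exact:
  assumes t: "t \<ge> t0" and b: "b \<in> carrier_vec (dp S - pH S)"
  shows "mM2 S t *\<^sub>v (mT2b S t *\<^sub>v (mCb S t *\<^sub>v (mG S t *\<^sub>v (mV2 S t *\<^sub>v b)))) = b"
proof -
  note ds = carriers[OF t, THEN carrier_matD(1)] carriers[OF t, THEN carrier_matD(2)] carrier_vecD[OF b]
  have c: "mC2b S t \<in> carrier_mat (dlb S - pHb S) (dn S)" "mG2 S t \<in> carrier_mat (dn S) (dp S - pH S)"
    "minv (mR2tilde S t) \<in> carrier_mat (dlb S - pHb S) (dlb S - pHb S)"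
    "mN2 S t \<in> carrier_mat (dp S - pH S) (dp S - pH S)"
    using cont_blocks cont_minv_R2tilde cont_N2 t by (auto intro: cont_mat_carrier)
  note cs = c[THEN carrier_matD(1)] c[THEN carrier_matD(2)]
  note N = minv[OF c(4) filter_defined(2)[OF t]]
  have "mM2 S t *\<^sub>v (mC2b S t *\<^sub>v (mG2 S t *\<^sub>v b)) = minv (mN2 S t) *\<^sub>v (mN2 S t *\<^sub>v b)"
    unfolding mM2_def mN2_def[of S t]
    using N(1) by (simp add: mat_vec_expand cs carrier_vecD[OF b] mN2_def)
  also have "\<dots> = b"
    using arg_cong[OF N(3), of "\<lambda>K. K *\<^sub>v b"] N(1) by (simp add: mat_vec_expand cs carrier_vecD[OF b])
  finally show ?thesis unfolding mC2b_def mG2_def by (simp add: mat_vec_expand ds)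
qed

text \<open>The range of the derivative gain is spanned by columns of \<open>U1b\<close>, which are orthogonal to those of
  \<open>U2b\<close>; for the other gain the assumption on the additional measurement applies.\<close>
lemma derivative_input_eliminated:
  assumes t: "t \<ge> t0" and d: "\<delta> \<in> carrier_vec (dp S)"
  shows "mT2b S t *\<^sub>v (mHb S t *\<^sub>v \<delta>) = 0\<^sub>v (dlb S - pHb S)"
    and "mT2b S t *\<^sub>v (mHbb S t *\<^sub>v \<delta>) = 0\<^sub>v (dlb S - pHb S)"
proof -
  note svd = is_svdD[OF Hb_svd[OF t]]
  note ds = carriers[OF t, THEN carrier_matD(1)] carriers[OF t, THEN carrier_matD(2)] carrier_vecD[OF d]
    svd(3-7)[THEN carrier_matD(1)] svd(3-7)[THEN carrier_matD(2)]
  define s where "s = mSigb S t *\<^sub>v ((mV1b S t)\<^sup>T *\<^sub>v \<delta>)"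
  have s: "s \<in> carrier_vec (pHb S)" unfolding s_def using svd(5,7) d by simp
  have "mHb S t *\<^sub>v \<delta> = mU1b S t *\<^sub>v s"
    unfolding svd(13) s_def by (simp add: mat_vec_expand ds)
  then have "mT2b S t *\<^sub>v (mHb S t *\<^sub>v \<delta>) = 0\<^sub>m (dlb S - pHb S) (pHb S) *\<^sub>v s"
    using arg_cong[OF svd(10), of "\<lambda>K. K *\<^sub>v s"] by (simp add: mT2b_def mat_vec_expand ds carrier_vecD[OF s])
  also have "\<dots> = 0\<^sub>v (dlb S - pHb S)" using s by (intro eq_vecI) auto
  finally show "mT2b S t *\<^sub>v (mHb S t *\<^sub>v \<delta>) = 0\<^sub>v (dlb S - pHb S)" .
  have "mT2b S t *\<^sub>v (mHbb S t *\<^sub>v \<delta>) = 0\<^sub>m (dlb S - pHb S) (dp S) *\<^sub>v \<delta>"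
    using arg_cong[OF Hbb[OF t], of "\<lambda>K. K *\<^sub>v \<delta>"] by (simp add: mat_vec_expand ds)
  also have "\<dots> = 0\<^sub>v (dlb S - pHb S)" using d by (intro eq_vecI) auto
  finally show "mT2b S t *\<^sub>v (mHbb S t *\<^sub>v \<delta>) = 0\<^sub>v (dlb S - pHb S)" .
qed

section \<open>The mean errors of the filter\<close>

text \<open>Taking means term by term in the definitions of the signals; the noises contribute \<open>0\<close>. These
  zero vectors are kept so that the means match the signals summand by summand.\<close>

abbreviation "x_mean t \<equiv> expect_vec M (dn S) (x t)"
abbreviation "xh_mean t \<equiv> expect_vec M (dn S) (xh t)"
abbreviation "u_mean t \<equiv> expect_vec M (dm S) (u t)"
abbreviation "u'_mean t \<equiv> expect_vec M (dm S) (u' t)"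
abbreviation "d_mean t \<equiv> expect_vec M (dp S) (d t)"
abbreviation "d'_mean t \<equiv> expect_vec M (dp S) (d' t)"

definition xdot_mean :: "real \<Rightarrow> real vec" where
  "xdot_mean t = mA S t *\<^sub>v x_mean t + mB S t *\<^sub>v u_mean t + mG S t *\<^sub>v d_mean t + mW S t *\<^sub>v 0\<^sub>v (dq S)"

definition y_mean :: "real \<Rightarrow> real vec" where
  "y_mean t = mC S t *\<^sub>v x_mean t + mD S t *\<^sub>v u_mean t + mH S t *\<^sub>v d_mean t + 0\<^sub>v (dl S)"

definition yb_mean :: "real \<Rightarrow> real vec" where
  "yb_mean t = mCb S t *\<^sub>v xdot_mean t + mCbb S t *\<^sub>v x_mean t + mDb S t *\<^sub>v u'_mean t + mDbb S t *\<^sub>v u_mean t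
     + mHb S t *\<^sub>v d'_mean t + mHbb S t *\<^sub>v d_mean t + 0\<^sub>v (dlb S)"

definition d1hat_mean :: "real \<Rightarrow> real vec" where
  "d1hat_mean t = mM1 S t *\<^sub>v (mT1 S t *\<^sub>v y_mean t - mC1 S t *\<^sub>v xh_mean t - mD1 S t *\<^sub>v u_mean t)"

definition d2hat_mean :: "real \<Rightarrow> real vec" where
  "d2hat_mean t = mM2 S t *\<^sub>v (mT2b S t *\<^sub>v yb_mean t
     - (mC2b S t * mA S t + mT2b S t * mCbb S t) *\<^sub>v xh_mean t - (mC2b S t * mB S t) *\<^sub>v u_mean t
     - (mC2b S t * mG1 S t) *\<^sub>v d1hat_mean t - mD2b S t *\<^sub>v u'_mean t - (mT2b S t * mDbb S t) *\<^sub>v u_mean t)"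

definition xhdot_mean :: "real \<Rightarrow> real vec" where
  "xhdot_mean t = mA S t *\<^sub>v xh_mean t + mB S t *\<^sub>v u_mean t + mG1 S t *\<^sub>v d1hat_mean t + mG2 S t *\<^sub>v d2hat_mean t
     + mL S t *\<^sub>v (mT2 S t *\<^sub>v y_mean t - mC2 S t *\<^sub>v xh_mean t - mD2 S t *\<^sub>v u_mean t)"

lemma prob: "prob_space M" by (rule prob_space_axioms)

lemmas mean_processes = processes[THEN mean_of_process(1)[OF prob]]
lemmas mean_noises = noise[THEN mean_of_noise[OF prob]]

lemma mean_xdot: "mean_of_signal M t0 (dn S) (xdot_sig S x u d w) xdot_mean"
  unfolding xdot_sig_def xdot_mean_def[abs_def]
  by (intro mean_of_signal_add mean_of_signal_mult[OF cont_inputs(1) mean_processes(1)]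
      mean_of_signal_mult[OF cont_inputs(2) mean_processes(3)] mean_of_signal_mult[OF cont_inputs(3) mean_processes(5)]
      mean_of_signal_mult[OF cont_inputs(6) mean_noises(1)])

lemma mean_y: "mean_of_signal M t0 (dl S) (y_sig S x u d v) y_mean"
  unfolding y_sig_def y_mean_def[abs_def]
  by (intro mean_of_signal_add mean_of_signal_mult[OF cont_inputs(4) mean_processes(1)]
      mean_of_signal_mult[OF cont_inputs(5) mean_processes(3)] mean_of_signal_mult[OF cont_H mean_processes(5)]
      mean_noises(2))

lemma mean_yb: "mean_of_signal M t0 (dlb S) (yb_sig S x u u' d d' w vb) yb_mean"
  unfolding yb_sig_def yb_mean_def[abs_def]
  by (intro mean_of_signal_add mean_of_signal_mult[OF yb_cont(1) mean_xdot]
      mean_of_signal_mult[OF yb_cont(2) mean_processes(1)] mean_of_signal_mult[OF yb_cont(3) mean_processes(4)]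
      mean_of_signal_mult[OF yb_cont(4) mean_processes(3)] mean_of_signal_mult[OF yb_cont(5) mean_processes(6)]
      mean_of_signal_mult[OF yb_cont(6) mean_processes(5)] mean_noises(3))

lemma mean_d1hat: "mean_of_signal M t0 (pH S) (d1hat_sig S xh u (y_sig S x u d v)) d1hat_mean"
  unfolding d1hat_sig_def d1hat_mean_def[abs_def]
  by (intro mean_of_signal_mult[OF cont_M1] mean_of_signal_diff mean_of_signal_mult[OF cont_T(1) mean_y]
      mean_of_signal_mult[OF cont_blocks(3) mean_processes(2)] mean_of_signal_mult[OF cont_blocks(5) mean_processes(3)])

lemma mean_d2hat: "mean_of_signal M t0 (dp S - pH S)
    (d2hat_sig S xh u u' (y_sig S x u d v) (yb_sig S x u u' d d' w vb)) d2hat_mean"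
  unfolding d2hat_sig_def d2hat_mean_def[abs_def]
  by (intro mean_of_signal_mult[OF cont_M2] mean_of_signal_diff mean_of_signal_mult[OF cont_T(3) mean_yb]
      mean_of_signal_mult[OF cont_mat_add[OF cont_mat_mult[OF cont_blocks(7) cont_inputs(1)]
        cont_mat_mult[OF cont_T(3) yb_cont(2)]] mean_processes(2)]
      mean_of_signal_mult[OF cont_mat_mult[OF cont_blocks(7) cont_inputs(2)] mean_processes(3)]
      mean_of_signal_mult[OF cont_mat_mult[OF cont_blocks(7) cont_blocks(1)] mean_d1hat]
      mean_of_signal_mult[OF cont_blocks(8) mean_processes(4)]
      mean_of_signal_mult[OF cont_mat_mult[OF cont_T(3) yb_cont(4)] mean_processes(3)])

lemma mean_xhdot: "mean_of_signal M t0 (dn S)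
    (xhdot_sig S xh u u' (y_sig S x u d v) (yb_sig S x u u' d d' w vb)) xhdot_mean"
  unfolding xhdot_sig_def xhdot_mean_def[abs_def]
  by (intro mean_of_signal_add mean_of_signal_mult[OF cont_L] mean_of_signal_diff
      mean_of_signal_mult[OF cont_inputs(1) mean_processes(2)] mean_of_signal_mult[OF cont_inputs(2) mean_processes(3)]
      mean_of_signal_mult[OF cont_blocks(1) mean_d1hat] mean_of_signal_mult[OF cont_blocks(2) mean_d2hat]
      mean_of_signal_mult[OF cont_T(2) mean_y] mean_of_signal_mult[OF cont_blocks(4) mean_processes(2)]
      mean_of_signal_mult[OF cont_blocks(6) mean_processes(3)])

lemma mean_dtilde: "mean_of_signal M t0 (dp S) (dtilde_sig S x xh u u' d d' w v vb)
    (\<lambda>t. d_mean t - (mV1 S t *\<^sub>v d1hat_mean t + mV2 S t *\<^sub>v d2hat_mean t))"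
  unfolding dtilde_sig_def dhat_sig_def
  by (intro mean_of_signal_diff mean_of_signal_add mean_processes(5)
      mean_of_signal_mult[OF H_svd_cont(4) mean_d1hat] mean_of_signal_mult[OF H_svd_cont(5) mean_d2hat])

definition state_bias :: "real \<Rightarrow> real vec" where
  "state_bias t = x_mean t - xh_mean t"

definition input_bias :: "real \<Rightarrow> real vec" where
  "input_bias t = - ((mV1 S t * mM1 S t * mC1 S t) *\<^sub>v state_bias t + (mV2 S t * mM2 S t * mE S t) *\<^sub>v state_bias t)"

text \<open>At every instant the means of both inputs and of their derivatives drop out, and only the mean
  state error is left.\<close>
lemma mean_error_equations:
  assumes t: "t \<ge> t0"
  shows "d_mean t - (mV1 S t *\<^sub>v d1hat_mean t + mV2 S t *\<^sub>v d2hat_mean t) = input_bias t"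
    and "xdot_mean t - xhdot_mean t = mAbreve S t *\<^sub>v state_bias t"
proof -
  have vecs: "x_mean t \<in> carrier_vec (dn S)" "xh_mean t \<in> carrier_vec (dn S)" "u_mean t \<in> carrier_vec (dm S)"
    "u'_mean t \<in> carrier_vec (dm S)" "d_mean t \<in> carrier_vec (dp S)" "d'_mean t \<in> carrier_vec (dp S)"
    by (simp_all add: expect_vec_def)
  let ?a = "(mV1 S t)\<^sup>T *\<^sub>v d_mean t" and ?b = "(mV2 S t)\<^sup>T *\<^sub>v d_mean t"
  have ab: "?a \<in> carrier_vec (pH S)" "?b \<in> carrier_vec (dp S - pH S)"
    using carriers(14,15)[OF t] vecs(5) by auto
  note ds = carriers[OF t, THEN carrier_matD(1)] carriers[OF t, THEN carrier_matD(2)] vecs[THEN carrier_vecD]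
  have split: "d_mean t = mV1 S t *\<^sub>v ?a + mV2 S t *\<^sub>v ?b"
    using arg_cong[OF is_svdD(12)[OF H_svd[OF t]], of "\<lambda>K. K *\<^sub>v d_mean t"] by (simp add: mat_vec_expand ds)
  note algebra = filter_error_algebra[OF carriers[OF t] vecs ab split first_estimate_exact[OF t vecs(5)]
      second_estimate_exact[OF t ab(2)] derivative_input_eliminated(1)[OF t vecs(6)]
      derivative_input_eliminated(2)[OF t vecs(5)]]
  note defs = input_bias_def state_bias_def d1hat_mean_def d2hat_mean_def xhdot_mean_def yb_mean_def xdot_mean_def y_mean_def
    mAbreve_def mAbar_def mE_def mAhat_def mC1_def mC2_def mD1_def mD2_def mC2b_def mD2b_def mG1_def mG2_def
  show "d_mean t - (mV1 S t *\<^sub>v d1hat_mean t + mV2 S t *\<^sub>v d2hat_mean t) = input_bias t"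
    unfolding defs by (rule algebra(1))
  show "xdot_mean t - xhdot_mean t = mAbreve S t *\<^sub>v state_bias t"
    unfolding defs by (rule algebra(2))
qed

lemma state_bias_carrier: "state_bias t \<in> carrier_vec (dn S)"
  by (simp add: state_bias_def expect_vec_def carrier_vecI)

lemma state_bias_solution:
  shows "lin_solution (dn S) (mAbreve S) t0 state_bias"
    and "\<And>i. i < dn S \<Longrightarrow> continuous_on {t0..} (\<lambda>t. state_bias t $ i)"
proof -
  have lb: "locally_bounded_vec t0 (dn S) state_bias"
  proof -
    have "mean_of_signal M t0 (dn S) (sig t0 x - sig t0 xh) (\<lambda>t. x_mean t - xh_mean t)"
      by (intro mean_of_signal_diff mean_processes(1,2))
    then show ?thesis unfolding state_bias_def[abs_def] by (rule mean_of_signal_locally_bounded)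
  qed
  have eq: "state_bias t $ i = state_bias t0 $ i + (LINT s:{t0..t}|lborel. (mAbreve S s *\<^sub>v state_bias s) $ i)"
    if t: "t0 \<le> t" and i: "i < dn S" for t i
  proof -
    have int: "set_integrable lborel {t0..t} (\<lambda>s. xdot_mean s $ i)" "set_integrable lborel {t0..t} (\<lambda>s. xhdot_mean s $ i)"
      using mean_xdot mean_xhdot i by (auto intro!: locally_bounded_vec_integrable_Icc mean_of_signal_locally_bounded)
    have "state_bias t $ i - state_bias t0 $ i
        = (LINT s:{t0..t}|lborel. xdot_mean s $ i) - (LINT s:{t0..t}|lborel. xhdot_mean s $ i)"
      using mean_of_solution[OF prob processes(1) state_eq mean_xdot t i]
        mean_of_solution[OF prob processes(2) filter_eq mean_xhdot t i] i
      by (simp add: state_bias_def expect_vec_def)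
    also have "\<dots> = (LINT s:{t0..t}|lborel. xdot_mean s $ i - xhdot_mean s $ i)"
      by (rule set_integral_diff(2)[OF int, symmetric])
    also have "\<dots> = (LINT s:{t0..t}|lborel. (mAbreve S s *\<^sub>v state_bias s) $ i)"
    proof (rule set_lebesgue_integral_cong)
      show "\<forall>s. s \<in> {t0..t} \<longrightarrow> xdot_mean s $ i - xhdot_mean s $ i = (mAbreve S s *\<^sub>v state_bias s) $ i"
        using i by (auto simp: mean_error_equations(2)[symmetric]
            mean_of_signal_carrier[OF mean_xhdot, THEN carrier_vecD])
    qed simp
    finally show ?thesis by simp
  qed
  show "lin_solution (dn S) (mAbreve S) t0 state_bias"
    by (rule lin_solution_of_integral_equation(1)[OF cont_Abreve lb eq])
  show "\<And>i. i < dn S \<Longrightarrow> continuous_on {t0..} (\<lambda>t. state_bias t $ i)"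
    by (rule lin_solution_of_integral_equation(2)[OF cont_Abreve lb eq])
qed

lemma gains:
  "cont_mat t0 (dp S) (dn S) (\<lambda>t. mV1 S t * mM1 S t * mC1 S t)"
  "cont_mat t0 (dp S) (dn S) (\<lambda>t. mV2 S t * mM2 S t * mE S t)"
  by (rule cont_mat_mult[OF cont_mat_mult[OF H_svd_cont(4) cont_M1] cont_blocks(3)],
      rule cont_mat_mult[OF cont_mat_mult[OF H_svd_cont(5) cont_M2] cont_E])

lemma input_bias_mean: "has_mean M t0 (dp S) (dtilde_sig S x xh u u' d d' w v vb) input_bias"
proof -
  have m: "mean_of_signal M t0 (dp S) (dtilde_sig S x xh u u' d d' w v vb) input_bias"
    using mean_dtilde by (rule mean_of_signal_cong) (rule mean_error_equations(1))
  have "continuous_on {t0..} (\<lambda>t. input_bias t $ i)" if i: "i < dp S" for i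
  proof (rule continuous_on_eq)
    show "continuous_on {t0..} (\<lambda>t.
        - ((\<Sum>j<dn S. (mV1 S t * mM1 S t * mC1 S t) $$ (i, j) * state_bias t $ j)
          + (\<Sum>j<dn S. (mV2 S t * mM2 S t * mE S t) $$ (i, j) * state_bias t $ j)))"
      by (intro continuous_on_minus continuous_on_add continuous_on_sum continuous_on_mult
          state_bias_solution(2) cont_matD[OF gains(1) i] cont_matD[OF gains(2) i]) auto
    show "- ((\<Sum>j<dn S. (mV1 S t * mM1 S t * mC1 S t) $$ (i, j) * state_bias t $ j)
          + (\<Sum>j<dn S. (mV2 S t * mM2 S t * mE S t) $$ (i, j) * state_bias t $ j)) = input_bias t $ i"
      if t: "t \<in> {t0..}" for t
    proof -
      have c: "mV1 S t * mM1 S t * mC1 S t \<in> carrier_mat (dp S) (dn S)"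
        "mV2 S t * mM2 S t * mE S t \<in> carrier_mat (dp S) (dn S)"
        using t by (auto intro: cont_mat_carrier[OF gains(1)] cont_mat_carrier[OF gains(2)])
      have "input_bias t $ i = - (((mV1 S t * mM1 S t * mC1 S t) *\<^sub>v state_bias t) $ i
          + ((mV2 S t * mM2 S t * mE S t) *\<^sub>v state_bias t) $ i)"
        unfolding input_bias_def
        using c[THEN carrier_matD(1)] i by (simp del: index_mult_mat_vec)
      then show ?thesis
        by (simp only: index_mult_mat_vec_sum[OF c(1) state_bias_carrier i]
            index_mult_mat_vec_sum[OF c(2) state_bias_carrier i])
    qed
  qed
  then show ?thesis using m unfolding mean_of_signal_def locally_bounded_vec_def has_mean_def by blast
qed

lemma vnorm_input_bias_le:
  assumes t: "t0 \<le> t"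
  shows "vnorm (input_bias t) \<le> input_gain S t * vnorm (state_bias t)"
proof -
  note c = cont_mat_carrier[OF gains(1) t] cont_mat_carrier[OF gains(2) t]
  have "vnorm (input_bias t) \<le> vnorm ((mV1 S t * mM1 S t * mC1 S t) *\<^sub>v state_bias t)
      + vnorm ((mV2 S t * mM2 S t * mE S t) *\<^sub>v state_bias t)"
    unfolding input_bias_def vnorm_uminus
    by (rule vnorm_triangle[OF mult_mat_vec_carrier[OF c(1) state_bias_carrier]
          mult_mat_vec_carrier[OF c(2) state_bias_carrier]])
  also have "\<dots> \<le> mnorm (mV1 S t * mM1 S t * mC1 S t) * vnorm (state_bias t)
      + mnorm (mV2 S t * mM2 S t * mE S t) * vnorm (state_bias t)"
    by (intro add_mono vnorm_mult_mat_vec_le[OF c(1) state_bias_carrier]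
        vnorm_mult_mat_vec_le[OF c(2) state_bias_carrier])
  finally show ?thesis by (simp add: input_gain_def algebra_simps)
qed

lemma input_gain_nonneg: "t0 \<le> t \<Longrightarrow> 0 \<le> input_gain S t"
  unfolding input_gain_def
  by (intro add_nonneg_nonneg mnorm_nonneg[OF cont_mat_carrier[OF gains(1)]]
      mnorm_nonneg[OF cont_mat_carrier[OF gains(2)]])

lemma state_bias_initial: "state_bias t0 = expect_vec M (dn S) (xtilde x xh t0)"
proof (rule eq_vecI)
  fix i assume "i < dim_vec (expect_vec M (dn S) (xtilde x xh t0))"
  then have i: "i < dn S" by (simp add: expect_vec_def)
  have int: "integrable M (\<lambda>\<omega>. x t0 \<omega> $ i)" "integrable M (\<lambda>\<omega>. xh t0 \<omega> $ i)"
    using mean_of_process(2)[OF prob processes(1) order_refl i] mean_of_process(2)[OF prob processes(2) order_refl i] by auto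
  have "(LINT \<omega>|M. xtilde x xh t0 \<omega> $ i) = (LINT \<omega>|M. x t0 \<omega> $ i - xh t0 \<omega> $ i)"
  proof (rule Bochner_Integration.integral_cong[OF refl])
    fix \<omega> assume "\<omega> \<in> space M"
    then have "xh t0 \<omega> \<in> carrier_vec (dn S)" using processes(2) unfolding second_order_process_def by blast
    then show "xtilde x xh t0 \<omega> $ i = x t0 \<omega> $ i - xh t0 \<omega> $ i" using i by (simp add: xtilde_def)
  qed
  also have "\<dots> = (LINT \<omega>|M. x t0 \<omega> $ i) - (LINT \<omega>|M. xh t0 \<omega> $ i)"
    by (rule Bochner_Integration.integral_diff[OF int])
  finally show "state_bias t0 $ i = expect_vec M (dn S) (xtilde x xh t0) $ i"
    using i by (simp add: state_bias_def expect_vec_def)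
qed (simp add: state_bias_def expect_vec_def)

end

section \<open>Exponential decay of the input bias\<close>

theorem lemma2:
  fixes M :: "'w measure" and S :: elise_data
    and x xh :: "'w proc" and xh0 :: "'w \<Rightarrow> real vec"
    and u u' d d' :: "'w proc"
    and w v vb :: "'w signal"
    and \<Phi> :: "real \<Rightarrow> real \<Rightarrow> real mat"
  assumes setting: "elise M S x xh xh0 u u' d d' w v vb"
    and stable: "elise_uas S"
    and gain_finite: "bdd_above (input_gain S ` {tini S..})"
    and transition: "is_transition_matrix (tini S) (dn S) (mAbreve S) \<Phi>"
  shows "\<exists>bias. has_mean M (tini S) (dp S) (dtilde_sig S x xh u u' d d' w v vb) bias \<and>
    (\<exists>\<alpha>1>0. \<exists>\<gamma>>0. \<forall>t\<ge>tini S. vnorm (bias t) \<le> \<alpha>1 * exp (- \<gamma> * (t - tini S))) \<and>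
    (bounded_mat (tini S) (mAbreve S) \<longrightarrow>
      (let Sm = gramian_lim (dn S) \<Phi>;
           e0 = expect_vec M (dn S) (xtilde x xh (tini S));
           \<gamma> = bias_gamma (tini S) Sm;
           \<alpha>1 = bias_alpha S Sm e0
       in (\<forall>t\<ge>tini S. \<forall>i<dn S. \<forall>j<dn S.
             ((\<lambda>T. gramian (dn S) \<Phi> t T $$ (i, j)) \<longlongrightarrow> Sm t $$ (i, j)) at_top) \<and>
          (\<forall>t\<ge>tini S. pos_def (dn S) (Sm t)) \<and>
          bdd_above ((\<lambda>t. lam_max (Sm t)) ` {tini S..}) \<and>
          0 < lam_inf (tini S) Sm \<and>
          0 < \<gamma> \<and> 0 \<le> \<alpha>1 \<and>
          (\<forall>t\<ge>tini S. vnorm (bias t) \<le> \<alpha>1 * exp (- \<gamma> * (t - tini S)))))"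
proof -
  interpret elise M S x xh xh0 u u' d d' w v vb by (rule setting)
  let ?e = state_bias
  let ?g = "SUP t\<in>{tini S..}. input_gain S t"
  have sys: "stable_system (tini S) (dn S) (mAbreve S) \<Phi>"
    using dims stable transition cont_mat_carrier[OF cont_Abreve]
    by unfold_locales (auto simp: elise_uas_def)
  interpret stable_system "tini S" "dn S" "mAbreve S" \<Phi> by (rule sys)
  have g: "input_gain S t \<le> ?g" if "tini S \<le> t" for t
    using that by (intro cSUP_upper gain_finite) auto
  have g0: "0 \<le> ?g" using g[of "tini S"] input_gain_nonneg[of "tini S"] by simp
  have bias_le: "vnorm (input_bias t) \<le> ?g * vnorm (?e t)" if t: "tini S \<le> t" for t
    using vnorm_input_bias_le[OF t] mult_right_mono[OF g[OF t] vnorm_nonneg[of "?e t"]] by linarith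
  have general: "\<exists>\<alpha>1>0. \<exists>\<gamma>>0. \<forall>t\<ge>tini S. vnorm (input_bias t) \<le> \<alpha>1 * exp (- \<gamma> * (t - tini S))"
  proof -
    obtain K c where K: "K > 0" "c > 0"
      and b: "\<And>t1 t \<xi>. tini S \<le> t1 \<Longrightarrow> t1 \<le> t \<Longrightarrow> lin_solution (dn S) (mAbreve S) t1 \<xi> \<Longrightarrow>
        vnorm (\<xi> t) \<le> K * exp (- c * (t - t1)) * vnorm (\<xi> t1)"
      using uniformly_asymptotically_stable_exponential[OF F_carrier stable_system.stable[OF sys]] by metis
    \<comment> \<open>the summand \<open>1\<close> keeps the constant positive when the bias vanishes\<close>
    let ?\<alpha> = "?g * (K * vnorm (?e (tini S))) + 1"
    have "0 \<le> ?g * (K * vnorm (?e (tini S)))" using g0 K by simp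
    then have "?\<alpha> > 0" by linarith
    moreover have "vnorm (input_bias t) \<le> ?\<alpha> * exp (- c * (t - tini S))" if t: "tini S \<le> t" for t
    proof -
      have "vnorm (input_bias t) \<le> ?g * (K * exp (- c * (t - tini S)) * vnorm (?e (tini S)))"
        using bias_le[OF t] mult_left_mono[OF b[OF order_refl t state_bias_solution(1)] g0] by linarith
      also have "\<dots> \<le> ?\<alpha> * exp (- c * (t - tini S))" by (simp add: algebra_simps)
      finally show ?thesis .
    qed
    ultimately show ?thesis using K(2) by blast
  qed
  have explicit: "let Sm = gramian_lim (dn S) \<Phi>;
           e0 = expect_vec M (dn S) (xtilde x xh (tini S));
           \<gamma> = bias_gamma (tini S) Sm;
           \<alpha>1 = bias_alpha S Sm e0
       in (\<forall>t\<ge>tini S. \<forall>i<dn S. \<forall>j<dn S.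
             ((\<lambda>T. gramian (dn S) \<Phi> t T $$ (i, j)) \<longlongrightarrow> Sm t $$ (i, j)) at_top) \<and>
          (\<forall>t\<ge>tini S. pos_def (dn S) (Sm t)) \<and>
          bdd_above ((\<lambda>t. lam_max (Sm t)) ` {tini S..}) \<and>
          0 < lam_inf (tini S) Sm \<and>
          0 < \<gamma> \<and> 0 \<le> \<alpha>1 \<and>
          (\<forall>t\<ge>tini S. vnorm (input_bias t) \<le> \<alpha>1 * exp (- \<gamma> * (t - tini S)))"
    if A_bounded: "bounded_mat (tini S) (mAbreve S)"
  proof -
    obtain k where k: "\<forall>t\<ge>tini S. mnorm (mAbreve S t) \<le> k"
      using A_bounded unfolding bounded_mat_def by (rule exE)
    interpret bounded_stable_system "tini S" "dn S" "mAbreve S" \<Phi> k by unfold_locales (use k in simp)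
    let ?S = "gramian_lim (dn S) \<Phi>"
    let ?\<beta> = "bias_beta (tini S) ?S (?e (tini S))"
    have lyap: "vnorm (?e t) \<le> ?\<beta> * exp (- bias_gamma (tini S) ?S * (t - tini S))" if "tini S \<le> t" for t
      by (rule lyapunov_decay[OF state_bias_solution(1) that])
    have \<beta>: "0 \<le> ?\<beta>" using order_trans[OF vnorm_nonneg lyap[OF order_refl]] by simp
    have "vnorm (input_bias t) \<le> ?\<beta> * ?g * exp (- bias_gamma (tini S) ?S * (t - tini S))" if t: "tini S \<le> t" for t
      using bias_le[OF t] mult_left_mono[OF lyap[OF t] g0] by (simp add: mult_ac)
    moreover have "((\<lambda>T. gramian (dn S) \<Phi> t T $$ (i, j)) \<longlongrightarrow> ?S t $$ (i, j)) at_top"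
      if "tini S \<le> t" "i < dn S" "j < dn S" for t i j
      using gramian_tendsto_half_line[OF that] gramian_lim_index[OF that] by simp
    moreover have "0 < bias_gamma (tini S) ?S" using lam_sup_gramian_pos by (simp add: bias_gamma_def)
    ultimately show ?thesis
      using gramian_pos_def lam_max_gramian_bdd_above lam_inf_gramian_pos \<beta> g0
      unfolding Let_def bias_alpha_def state_bias_initial by auto
  qed
  show ?thesis using input_bias_mean general explicit by blast
qed
end
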